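(* The middle degree Hodge spectrum cannot distinguish Riemannian manifolds from Riemannian orbifolds with singularities. Explicitly: there exist an integer $m\ge 1$, a $2m$-dimensional closed Riemannian manifold $N$, and a $2m$-dimensional compact Riemannian orbifold $\mathcal{O}$ with non-empty singular set, the singular set not being of codimension one, such that $\mathrm{spec}_m(N)=\mathrm{spec}_m(\mathcal{O})$.
   Context: A Riemannian orbifold is a space locally modelled on quotients of Riemannian manifolds by finite effective isometric group actions; the singularities correspond to singular orbits. For a closed Riemannian manifold $N$ of dimension $2m$, $\mathrm{spec}_m(N)$ denotes the spectrum (eigenvalues with multiplicities) of the Hodge Laplacian $dd^*+d^*d$ acting on smooth $m$-forms. If $\mathcal{O}=\langle\tau\rangle\backslash M$ is the quotient of a closed Riemannian manifold $M$ by an isometric involution $\tau$, then $\mathrm{spec}_m(\mathcal{O})$ is the spectrum of the Hodge Laplacian of $M$ acting on the space of $\tau$-invariant smooth $m$-forms on $M$. Convention: when the fixed point set of $\tau$ has codimension one, the quotient is regarded as a manifold with boundary rather than as an orbifold with singularities. *)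

theory Defs
  imports
    "HOL-Analysis.Analysis"
    "HOL-Algebra.Bij"
    "HOL-Library.Function_Algebras"
    "HOL-Library.Extended_Nat"
begin

section \<open>Smooth functions on open subsets of \<open>\<real>\<^sup>n\<close>\<close>

text \<open>
  The dimension is quantified inside the statement, so \<open>\<real>\<^sup>n\<close> is the library's
  \<^const>\<open>Euclidean_space\<close> \<open>n\<close>, whose points are the functions \<open>nat \<Rightarrow> real\<close> vanishing at all
  indices \<open>\<ge> n\<close>. Coordinates and tensor indices run over \<open>{..<n}\<close>.
\<close>

definition pd :: "nat \<Rightarrow> ((nat \<Rightarrow> real) \<Rightarrow> real) \<Rightarrow> (nat \<Rightarrow> real) \<Rightarrow> real" where
  "pd i f x = deriv (\<lambda>t. f (x(i := t))) (x i)"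

fun Ck_on :: "nat \<Rightarrow> nat \<Rightarrow> (nat \<Rightarrow> real) set \<Rightarrow> ((nat \<Rightarrow> real) \<Rightarrow> real) \<Rightarrow> bool" where
  "Ck_on n 0 U f \<longleftrightarrow> continuous_map (subtopology (Euclidean_space n) U) euclideanreal f"
| "Ck_on n (Suc k) U f \<longleftrightarrow>
     continuous_map (subtopology (Euclidean_space n) U) euclideanreal f \<and>
     (\<forall>i<n. (\<forall>x\<in>U. (\<lambda>t. f (x(i := t))) differentiable (at (x i))) \<and> Ck_on n k U (pd i f))"

definition smooth_on :: "nat \<Rightarrow> (nat \<Rightarrow> real) set \<Rightarrow> ((nat \<Rightarrow> real) \<Rightarrow> real) \<Rightarrow> bool" where
  "smooth_on n U f \<longleftrightarrow> (\<forall>k. Ck_on n k U f)"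

definition smooth_map_on ::
  "nat \<Rightarrow> (nat \<Rightarrow> real) set \<Rightarrow> ((nat \<Rightarrow> real) \<Rightarrow> (nat \<Rightarrow> real)) \<Rightarrow> bool" where
  "smooth_map_on n U h \<longleftrightarrow> (\<forall>j<n. smooth_on n U (\<lambda>x. h x j))"


section \<open>Riemannian metrics and isometries in coordinates\<close>

type_synonym metric = "(nat \<Rightarrow> real) \<Rightarrow> nat \<Rightarrow> nat \<Rightarrow> real"

definition riemannian_metric_on :: "nat \<Rightarrow> (nat \<Rightarrow> real) set \<Rightarrow> metric \<Rightarrow> bool" where
  "riemannian_metric_on n U g \<longleftrightarrow>
     (\<forall>i<n. \<forall>j<n. smooth_on n U (\<lambda>x. g x i j)) \<and>
     (\<forall>x\<in>U. \<forall>i<n. \<forall>j<n. g x i j = g x j i) \<and>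
     (\<forall>x\<in>U. \<forall>v. (\<exists>i<n. v i \<noteq> 0) \<longrightarrow> (\<Sum>i<n. \<Sum>j<n. g x i j * v i * v j) > 0)"

definition isometric_diffeo ::
  "nat \<Rightarrow> (nat \<Rightarrow> real) set \<Rightarrow> metric \<Rightarrow> (nat \<Rightarrow> real) set \<Rightarrow> metric \<Rightarrow>
   ((nat \<Rightarrow> real) \<Rightarrow> (nat \<Rightarrow> real)) \<Rightarrow> bool" where
  "isometric_diffeo n V g W g' h \<longleftrightarrow>
     bij_betw h V W \<and> smooth_map_on n V h \<and> smooth_map_on n W (inv_into V h) \<and>
     (\<forall>x\<in>V. \<forall>a<n. \<forall>b<n.
        g x a b = (\<Sum>i<n. \<Sum>j<n. pd a (\<lambda>y. h y i) x * pd b (\<lambda>y. h y j) x * g' (h x) i j))"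


section \<open>Riemannian orbifolds and manifolds\<close>

text \<open>
  An orbifold chart \<open>(U, \<Gamma>, \<phi>)\<close> with a metric on \<open>U\<close>: the finite group \<open>\<Gamma>\<close> acts effectively
  (being a subgroup of the bijections of \<open>U\<close>) by isometries, and \<open>\<phi>\<close> induces a homeomorphism
  from \<open>\<Gamma>\<setminus>U\<close> onto an open subset of the underlying space.
\<close>

record 'p orbi_chart =
  chart_dom :: "(nat \<Rightarrow> real) set"
  chart_grp :: "((nat \<Rightarrow> real) \<Rightarrow> (nat \<Rightarrow> real)) set"
  chart_map :: "(nat \<Rightarrow> real) \<Rightarrow> 'p"
  chart_met :: metric

definition riemannian_orbi_chart :: "nat \<Rightarrow> 'p topology \<Rightarrow> 'p orbi_chart \<Rightarrow> bool" where
  "riemannian_orbi_chart n X c \<longleftrightarrow>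
     openin (Euclidean_space n) (chart_dom c) \<and>
     connectedin (Euclidean_space n) (chart_dom c) \<and>
     riemannian_metric_on n (chart_dom c) (chart_met c) \<and>
     finite (chart_grp c) \<and>
     subgroup (chart_grp c) (BijGroup (chart_dom c)) \<and>
     (\<forall>\<gamma>\<in>chart_grp c.
        isometric_diffeo n (chart_dom c) (chart_met c) (chart_dom c) (chart_met c) \<gamma>) \<and>
     openin X (chart_map c ` chart_dom c) \<and>
     quotient_map (subtopology (Euclidean_space n) (chart_dom c))
       (subtopology X (chart_map c ` chart_dom c)) (chart_map c) \<and>
     (\<forall>x\<in>chart_dom c. \<forall>y\<in>chart_dom c.
        chart_map c x = chart_map c y \<longleftrightarrow> (\<exists>\<gamma>\<in>chart_grp c. \<gamma> x = y))"

text \<open>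
  Changes of charts are local isometries between the domains that commute with the projections to
  the underlying space. The elements of the local groups are among them (with \<open>c = d\<close>).
\<close>

definition chart_change ::
  "nat \<Rightarrow> 'p orbi_chart \<Rightarrow> 'p orbi_chart \<Rightarrow> (nat \<Rightarrow> real) set \<Rightarrow>
   ((nat \<Rightarrow> real) \<Rightarrow> (nat \<Rightarrow> real)) \<Rightarrow> bool" where
  "chart_change n c d V h \<longleftrightarrow>
     openin (Euclidean_space n) V \<and> V \<subseteq> chart_dom c \<and>
     openin (Euclidean_space n) (h ` V) \<and> h ` V \<subseteq> chart_dom d \<and>
     isometric_diffeo n V (chart_met c) (h ` V) (chart_met d) h \<and>
     (\<forall>z\<in>V. chart_map d (h z) = chart_map c z)"

definition riemannian_orbifold :: "nat \<Rightarrow> 'p topology \<Rightarrow> 'p orbi_chart set \<Rightarrow> bool" where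
  "riemannian_orbifold n X A \<longleftrightarrow>
     Hausdorff_space X \<and> second_countable X \<and>
     (\<forall>c\<in>A. riemannian_orbi_chart n X c) \<and>
     topspace X = (\<Union>c\<in>A. chart_map c ` chart_dom c) \<and>
     (\<forall>c\<in>A. \<forall>d\<in>A. \<forall>x\<in>chart_dom c. \<forall>y\<in>chart_dom d. chart_map c x = chart_map d y \<longrightarrow>
        (\<exists>V h. chart_change n c d V h \<and> x \<in> V \<and> h x = y))"

definition compact_riemannian_orbifold :: "nat \<Rightarrow> 'p topology \<Rightarrow> 'p orbi_chart set \<Rightarrow> bool" where
  "compact_riemannian_orbifold n X A \<longleftrightarrow> riemannian_orbifold n X A \<and> compact_space X"

text \<open>
  When all local groups are trivial, the chart maps are homeomorphisms from open subsets of
  \<open>\<real>\<^sup>n\<close> onto open subsets of the space (inverses of ordinary charts) with smooth isometric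
  transition maps, that is, the atlas is an ordinary Riemannian manifold atlas. There is no
  boundary.
\<close>

definition closed_riemannian_manifold :: "nat \<Rightarrow> 'p topology \<Rightarrow> 'p orbi_chart set \<Rightarrow> bool" where
  "closed_riemannian_manifold n X A \<longleftrightarrow>
     riemannian_orbifold n X A \<and> compact_space X \<and>
     (\<forall>c\<in>A. chart_grp c = {\<one>\<^bsub>BijGroup (chart_dom c)\<^esub>})"

definition singular_set :: "'p orbi_chart set \<Rightarrow> 'p set" where
  "singular_set A =
     {chart_map c x | c x. c \<in> A \<and> x \<in> chart_dom c \<and>
        (\<exists>\<gamma>\<in>chart_grp c. \<gamma> \<noteq> \<one>\<^bsub>BijGroup (chart_dom c)\<^esub> \<and> \<gamma> x = x)}"

definition hypersurface_at :: "nat \<Rightarrow> (nat \<Rightarrow> real) set \<Rightarrow> (nat \<Rightarrow> real) \<Rightarrow> bool" where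
  "hypersurface_at n S x \<longleftrightarrow> x \<in> S \<and>
     (\<exists>V f. openin (Euclidean_space n) V \<and> x \<in> V \<and> smooth_on n V f \<and>
        (\<forall>z\<in>V. \<exists>i<n. pd i f z \<noteq> 0) \<and> S \<inter> V = {z \<in> V. f z = 0})"

text \<open>
  In a chart the singular set is a finite union of fixed point submanifolds, possibly of different
  dimensions. Codimension one is understood as having some part of codimension one, so that
  the negation says that the whole singular set has codimension at least two.
\<close>

definition singular_set_codim_one :: "nat \<Rightarrow> 'p orbi_chart set \<Rightarrow> bool" where
  "singular_set_codim_one n A \<longleftrightarrow>
     (\<exists>c\<in>A. \<exists>x\<in>chart_dom c.
        hypersurface_at n {z \<in> chart_dom c. chart_map c z \<in> singular_set A} x)"


section \<open>Differential forms in coordinates\<close>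

text \<open>
  A \<open>p\<close>-form is given by the components of the alternating covariant \<open>p\<close>-tensor:
  \<open>\<omega> x [i\<^sub>1, \<dots>, i\<^sub>p]\<close> is the value of \<open>\<omega>\<close> at \<open>x\<close> on the coordinate vectors number
  \<open>i\<^sub>1, \<dots>, i\<^sub>p\<close>.
\<close>

type_synonym local_form = "(nat \<Rightarrow> real) \<Rightarrow> nat list \<Rightarrow> real"

definition multi_idx :: "nat \<Rightarrow> nat \<Rightarrow> nat list set" where
  "multi_idx n p = {I. length I = p \<and> set I \<subseteq> {..<n}}"

definition smooth_form_on :: "nat \<Rightarrow> nat \<Rightarrow> (nat \<Rightarrow> real) set \<Rightarrow> local_form \<Rightarrow> bool" where
  "smooth_form_on n p U \<omega> \<longleftrightarrow>
     (\<forall>I\<in>multi_idx n p. smooth_on n U (\<lambda>x. \<omega> x I)) \<and>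
     (\<forall>x\<in>U. \<forall>I\<in>multi_idx n p. \<forall>i<p. \<forall>j<p. i \<noteq> j \<longrightarrow>
        \<omega> x (I[i := I ! j, j := I ! i]) = - \<omega> x I)"

definition pullback ::
  "nat \<Rightarrow> ((nat \<Rightarrow> real) \<Rightarrow> (nat \<Rightarrow> real)) \<Rightarrow> local_form \<Rightarrow> local_form" where
  "pullback n h \<omega> x I =
     (\<Sum>J\<in>multi_idx n (length I).
        (\<Prod>k<length I. pd (I ! k) (\<lambda>y. h y (J ! k)) x) * \<omega> (h x) J)"

definition ext_d :: "local_form \<Rightarrow> local_form" where
  "ext_d \<omega> x I =
     (\<Sum>k<length I. (-1) ^ k * pd (I ! k) (\<lambda>y. \<omega> y (take k I @ drop (Suc k) I)) x)"

definition levi_civita :: "nat \<Rightarrow> nat list \<Rightarrow> real" where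
  "levi_civita n I =
     (if I \<in> multi_idx n n \<and> distinct I
      then of_int (sign (\<lambda>k. if k < n then I ! k else k)) else 0)"

definition mat_det :: "nat \<Rightarrow> (nat \<Rightarrow> nat \<Rightarrow> real) \<Rightarrow> real" where
  "mat_det n G = (\<Sum>p | p permutes {..<n}. of_int (sign p) * (\<Prod>i<n. G i (p i)))"

definition mat_inverse :: "nat \<Rightarrow> (nat \<Rightarrow> nat \<Rightarrow> real) \<Rightarrow> nat \<Rightarrow> nat \<Rightarrow> real" where
  "mat_inverse n G =
     (THE H. (\<forall>i j. \<not> (i < n \<and> j < n) \<longrightarrow> H i j = 0) \<and>
             (\<forall>i<n. \<forall>j<n. (\<Sum>k<n. G i k * H k j) = (if i = j then 1 else 0)))"

definition raise_idx :: "nat \<Rightarrow> metric \<Rightarrow> local_form \<Rightarrow> local_form" where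
  "raise_idx n g \<omega> x I =
     (\<Sum>J\<in>multi_idx n (length I).
        (\<Prod>k<length I. mat_inverse n (g x) (I ! k) (J ! k)) * \<omega> x J)"

text \<open>
  The Hodge star of a \<open>p\<close>-form with respect to the coordinate orientation, normalised by
  \<open>\<alpha> \<and> *\<beta> = \<langle>\<alpha>, \<beta>\<rangle> vol\<close>. The codifferential contains it twice, so it does not depend
  on the orientation.
\<close>

definition hodge_star :: "nat \<Rightarrow> metric \<Rightarrow> nat \<Rightarrow> local_form \<Rightarrow> local_form" where
  "hodge_star n g p \<omega> x J =
     sqrt (mat_det n (g x)) / fact p *
       (\<Sum>I\<in>multi_idx n p. levi_civita n (I @ J) * raise_idx n g \<omega> x I)"

definition codiff :: "nat \<Rightarrow> metric \<Rightarrow> nat \<Rightarrow> local_form \<Rightarrow> local_form" where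
  "codiff n g p \<omega> x I =
     (-1) ^ (n * (p + 1) + 1) *
       hodge_star n g (n - p + 1) (ext_d (hodge_star n g p \<omega>)) x I"

definition hodge_laplacian :: "nat \<Rightarrow> metric \<Rightarrow> nat \<Rightarrow> local_form \<Rightarrow> local_form" where
  "hodge_laplacian n g p \<omega> x I =
     ext_d (codiff n g p \<omega>) x I + codiff n g (p + 1) (ext_d \<omega>) x I"


section \<open>The Hodge spectrum\<close>

text \<open>
  A smooth form on an orbifold is a family of smooth forms on the chart domains that is invariant
  under all changes of charts, in particular under the local groups. For a quotient
  \<open>\<langle>\<tau>\<rangle>\<setminus>M\<close> these are the \<open>\<tau>\<close>-invariant smooth forms on \<open>M\<close>. Values off the
  chart domains or at other multi-indices carry no information and are set to \<open>0\<close>, so that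
  equality of forms is equality of functions.
\<close>

type_synonym 'p orbi_form = "'p orbi_chart \<Rightarrow> local_form"

definition smooth_forms :: "nat \<Rightarrow> 'p orbi_chart set \<Rightarrow> nat \<Rightarrow> 'p orbi_form set" where
  "smooth_forms n A p =
     {\<omega>. (\<forall>c\<in>A. smooth_form_on n p (chart_dom c) (\<omega> c)) \<and>
         (\<forall>c\<in>A. \<forall>d\<in>A. \<forall>V h. chart_change n c d V h \<longrightarrow>
            (\<forall>x\<in>V. \<forall>I\<in>multi_idx n p. \<omega> c x I = pullback n h (\<omega> d) x I)) \<and>
         (\<forall>c x I. \<not> (c \<in> A \<and> x \<in> chart_dom c \<and> I \<in> multi_idx n p) \<longrightarrow> \<omega> c x I = 0)}"

definition form_scale :: "real \<Rightarrow> 'p orbi_form \<Rightarrow> 'p orbi_form" where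
  "form_scale r \<omega> = (\<lambda>c x I. r * \<omega> c x I)"

global_interpretation orbi_form: vector_space form_scale
  by unfold_locales (auto simp: form_scale_def fun_eq_iff algebra_simps)

definition hodge_eigenspace ::
  "nat \<Rightarrow> 'p orbi_chart set \<Rightarrow> nat \<Rightarrow> real \<Rightarrow> 'p orbi_form set" where
  "hodge_eigenspace n A p l =
     {\<omega> \<in> smooth_forms n A p. \<forall>c\<in>A. \<forall>x\<in>chart_dom c. \<forall>I\<in>multi_idx n p.
        hodge_laplacian n (chart_met c) p (\<omega> c) x I = l * \<omega> c x I}"

text \<open>
  The spectrum assigns to each real number its multiplicity as an eigenvalue (\<open>0\<close> if it is not
  one). The case distinction is there because \<^const>\<open>orbi_form.dim\<close> is \<open>0\<close> on
  infinite-dimensional spaces.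
\<close>

definition hodge_spec :: "nat \<Rightarrow> 'p orbi_chart set \<Rightarrow> nat \<Rightarrow> real \<Rightarrow> enat" where
  "hodge_spec n A p l =
     (if \<exists>B. finite B \<and> hodge_eigenspace n A p l \<subseteq> orbi_form.span B
      then enat (orbi_form.dim (hodge_eigenspace n A p l)) else \<infinity>)"

end

(*
  Take the flat torus M = R^4 / Z^4 and two commuting orientation reversing isometric involutions:
  A(x0,x1,x2,x3) = (-x0,x1,x2,x3+1/2), which acts freely, and B(x0,x1,x2,x3) = (-x0,-x1,-x2,x3),
  whose fixed points form circles, of codimension three. On 2-forms the Hodge star S satisfies
  S S = 1, commutes with the Laplacian and anticommutes with the pullbacks by A and B. Hence S
  interchanges the (+,-) and the (-,+) part of each eigenspace of M under the two pullbacks, so that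
      w |-> (w + B^* w)/2 + S (w - B^* w)/2
  maps the A-invariant eigenforms linearly and bijectively onto the B-invariant ones; the inverse
  is the same formula with A in place of B.
*)
theory Submission
  imports Defs
begin

section \<open>Smooth functions on open subsets of Euclidean space\<close>

text \<open>At a fixed point, an orientation reversing isometric involution has an odd number of
  eigenvalues -1. Its fixed sets therefore have odd codimension, and once codimension one is
  excluded, four is the least even dimension with room for it. Commutation keeps the two parts of an
  A-invariant form under B inside the A-invariant forms, so A can sort them again on the way back.

  The torus itself is never formed. Both quotients are R^4 modulo the affine group generated by Z^4
  and the involution, and a form on a quotient becomes an invariant form on R^4. The obstacle is
  that a form must be invariant under every change of charts, that is, under every local isometry
  over the quotient, while the construction only controls the elements of the group. At points whose
  coordinates avoid the quarter integers such a local isometry coincides nearby with one group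
  element. Multiplicities are compared through linear maps that are inverse to each other on the
  eigenspaces, which settles finite and infinite ones alike.\<close>

definition cube :: "nat \<Rightarrow> (nat \<Rightarrow> real) \<Rightarrow> real \<Rightarrow> (nat \<Rightarrow> real) set" where
  "cube n x e = {z. (\<forall>i<n. \<bar>z i - x i\<bar> < e) \<and> (\<forall>i\<ge>n. z i = 0)}"

text \<open>Links the abstract topology to the type class one, whose facts on open sets and
  continuous functions then apply.\<close>

lemma Euclidean_space_eq_top_of_set:
  "Euclidean_space n = top_of_set (topspace (Euclidean_space n))"
  unfolding topspace_Euclidean_space
  by (simp add: Euclidean_space_def euclidean_product_topology)

lemma subtopology_Euclidean_space_eq_top_of_set:
  assumes "U \<subseteq> topspace (Euclidean_space n)"
  shows "subtopology (Euclidean_space n) U = top_of_set U"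
  using assms
  by (metis Euclidean_space_eq_top_of_set inf.absorb_iff2 subtopology_subtopology)

lemma cube_subset_topspace: "cube n x e \<subseteq> topspace (Euclidean_space n)"
  by (auto simp: cube_def topspace_Euclidean_space)

lemma openin_cube: "openin (Euclidean_space n) (cube n x e)"
proof -
  have "open {z :: nat \<Rightarrow> real. \<bar>z i - x i\<bar> < e}" for i
    by (intro open_Collect_less continuous_on_rabs continuous_on_diff continuous_on_const
        continuous_on_product_coordinates)
  then have "open (\<Inter>i\<in>{..<n}. {z :: nat \<Rightarrow> real. \<bar>z i - x i\<bar> < e})"
    by (intro open_INT) auto
  then have "openin (Euclidean_space n)
      (topspace (Euclidean_space n) \<inter> (\<Inter>i\<in>{..<n}. {z. \<bar>z i - x i\<bar> < e}))"
    unfolding Euclidean_space_eq_top_of_set[symmetric] using openin_open_Int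
    by (subst Euclidean_space_eq_top_of_set) blast
  also have "topspace (Euclidean_space n) \<inter> (\<Inter>i\<in>{..<n}. {z. \<bar>z i - x i\<bar> < e}) = cube n x e"
    by (auto simp: cube_def topspace_Euclidean_space)
  finally show ?thesis .
qed

lemma cube_mono: "d \<le> e \<Longrightarrow> cube n x d \<subseteq> cube n x e"
  by (force simp: cube_def)

lemma centre_in_cube: "x \<in> topspace (Euclidean_space n) \<Longrightarrow> 0 < e \<Longrightarrow> x \<in> cube n x e"
  by (auto simp: cube_def topspace_Euclidean_space)

lemma ex_min_pos:
  assumes "finite I" "\<And>i. i \<in> I \<Longrightarrow> 0 < (e i :: real)"
  shows "\<exists>d>0. \<forall>i\<in>I. d \<le> e i"
proof (cases "I = {}")
  case False
  then show ?thesis using assms by (intro exI[of _ "Min (e ` I)"]) auto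
qed (auto intro!: exI[of _ 1])

text \<open>A basic open set of the product topology restricts finitely many unknown coordinates.
  Only the first n of them matter, since all points in question vanish in the others, so the least
  gap among the first n coordinates works.\<close>

lemma openin_Euclidean_space_iff:
  "openin (Euclidean_space n) U \<longleftrightarrow>
     U \<subseteq> topspace (Euclidean_space n) \<and> (\<forall>x\<in>U. \<exists>e>0. cube n x e \<subseteq> U)"
proof
  assume U: "openin (Euclidean_space n) U"
  then obtain T where T: "openin (powertop_real UNIV) T" "U = T \<inter> {x. \<forall>i\<ge>n. x i = 0}"
    by (auto simp: Euclidean_space_def openin_subtopology)
  have "\<exists>e>0. cube n x e \<subseteq> U" if "x \<in> U" for x
  proof -
    from T that obtain W where W: "finite {i. W i \<noteq> UNIV}" "\<And>i. open (W i)"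
        "x \<in> PiE UNIV W" "PiE UNIV W \<subseteq> T"
      unfolding openin_product_topology_alt topspace_euclidean open_openin[symmetric]
      by (auto simp del: PiE_UNIV_domain)
    have "\<exists>d>0. \<forall>z. \<bar>z - x i\<bar> < d \<longrightarrow> z \<in> W i" for i
      using W(2)[of i] W(3) unfolding open_dist by (auto simp: dist_real_def PiE_iff)
    then obtain d where d: "\<And>i. d i > 0" "\<And>i z. \<bar>z - x i\<bar> < d i \<Longrightarrow> z \<in> W i"
      by metis
    obtain e where e: "e > 0" "\<forall>i\<in>{..<n}. e \<le> d i"
      using ex_min_pos[of "{..<n}" d] d(1) by auto
    have "z \<in> U" if z: "z \<in> cube n x e" for z
    proof -
      have xn: "\<forall>i\<ge>n. x i = 0" using \<open>x \<in> U\<close> T by auto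
      have "z i \<in> W i" for i
      proof (cases "i < n")
        case True
        then have "\<bar>z i - x i\<bar> < d i" using z bspec[OF e(2), of i] unfolding cube_def by (auto intro: order_less_le_trans)
        then show ?thesis by (rule d(2))
      next
        case False
        then have "z i = x i" using z xn unfolding cube_def by simp
        then show ?thesis using d(2)[of "x i" i] d(1)[of i] by simp
      qed
      then have "z \<in> T" using W(4) by (auto simp: PiE_iff)
      then show ?thesis using z T by (auto simp: cube_def)
    qed
    then show ?thesis using e by blast
  qed
  then show "U \<subseteq> topspace (Euclidean_space n) \<and> (\<forall>x\<in>U. \<exists>e>0. cube n x e \<subseteq> U)"
    using openin_subset[OF U] by blast
next
  assume U: "U \<subseteq> topspace (Euclidean_space n) \<and> (\<forall>x\<in>U. \<exists>e>0. cube n x e \<subseteq> U)"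
  show "openin (Euclidean_space n) U"
  proof (subst openin_subopen, intro ballI)
    fix x assume "x \<in> U"
    then obtain e where "e > 0" "cube n x e \<subseteq> U" using U by blast
    then show "\<exists>T. openin (Euclidean_space n) T \<and> x \<in> T \<and> T \<subseteq> U"
      using openin_cube[of n x e] centre_in_cube[of x n e] U \<open>x \<in> U\<close>
      by (intro exI[of _ "cube n x e"]) auto
  qed
qed

text \<open>A box is a product of n intervals and infinitely many copies of {0}, and products of
  connected sets are connected.\<close>

lemma connectedin_cube: "connectedin (Euclidean_space n) (cube n x e)"
proof -
  have "connectedin (powertop_real UNIV)
      (PiE UNIV (\<lambda>i. if i < n then {x i - e <..< x i + e} else {0}))"
    by (auto simp: connectedin_PiE)
  moreover have "PiE UNIV (\<lambda>i. if i < n then {x i - e <..< x i + e} else {0}) = cube n x e"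
    (is "?L = _")
  proof (intro Set.set_eqI)
    fix z
    have "z \<in> ?L \<longleftrightarrow> (\<forall>i. z i \<in> (if i < n then {x i - e <..< x i + e} else {0}))"
      by (simp only: PiE_iff extensional_UNIV) simp
    also have "\<dots> \<longleftrightarrow> z \<in> cube n x e"
    proof
      assume L: "\<forall>i. z i \<in> (if i < n then {x i - e <..< x i + e} else {0})"
      show "z \<in> cube n x e"
        unfolding cube_def mem_Collect_eq
      proof (intro conjI allI impI)
        show "\<bar>z i - x i\<bar> < e" if "i < n" for i
          using spec[OF L, of i] that by (simp add: abs_diff_less_iff)
        show "z i = 0" if "n \<le> i" for i
          using spec[OF L, of i] that by simp
      qed
    next
      assume "z \<in> cube n x e"
      then show "\<forall>i. z i \<in> (if i < n then {x i - e <..< x i + e} else {0})"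
        by (simp add: cube_def abs_diff_less_iff)
    qed
    finally show "z \<in> ?L \<longleftrightarrow> z \<in> cube n x e" .
  qed
  ultimately show ?thesis
    by (auto simp: Euclidean_space_def connectedin_subtopology cube_def)
qed

section \<open>Partial derivatives and C^k functions on open sets\<close>

lemma eventually_fun_upd_in_open:
  assumes "openin (Euclidean_space n) U" "x \<in> U" "i < n"
  shows "eventually (\<lambda>t. x(i := t) \<in> U) (nhds (x i))"
proof -
  obtain e where e: "e > 0" "cube n x e \<subseteq> U"
    using assms openin_Euclidean_space_iff by blast
  have "x(i := t) \<in> U" if "\<bar>t - x i\<bar> < e" for t
  proof -
    have "x \<in> topspace (Euclidean_space n)" using assms openin_subset by blast
    then have "x(i := t) \<in> cube n x e"
      using that e assms by (auto simp: cube_def topspace_Euclidean_space)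
    then show ?thesis using e by blast
  qed
  then show ?thesis
    unfolding eventually_nhds_metric using e by (auto simp: dist_real_def)
qed

text \<open>A partial derivative sees a function only along one coordinate line, and an open set
  contains a neighbourhood of the point on that line.\<close>

lemma pd_cong:
  assumes "openin (Euclidean_space n) U" "x \<in> U" "i < n" "\<And>z. z \<in> U \<Longrightarrow> f z = g z"
  shows "pd i f x = pd i g x"
  unfolding pd_def
  by (rule deriv_cong_ev[OF eventually_mono[OF eventually_fun_upd_in_open[OF assms(1-3)]] refl])
     (rule assms(4))

lemma partial_differentiable_cong:
  assumes "openin (Euclidean_space n) U" "x \<in> U" "i < n" "\<And>z. z \<in> U \<Longrightarrow> f z = g z"
    and "(\<lambda>t. f (x(i := t))) differentiable (at (x i))"
  shows "(\<lambda>t. g (x(i := t)) :: real) differentiable (at (x i))"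
proof -
  have "eventually (\<lambda>t. f (x(i := t)) = g (x(i := t))) (nhds (x i))"
    by (rule eventually_mono[OF eventually_fun_upd_in_open[OF assms(1-3)]]) (rule assms(4))
  moreover obtain D where "((\<lambda>t. f (x(i := t))) has_real_derivative D) (at (x i))"
    using assms(5) unfolding real_differentiable_def by blast
  ultimately have "((\<lambda>t. g (x(i := t))) has_real_derivative D) (at (x i))"
    using DERIV_cong_ev[OF refl _ refl] by metis
  then show ?thesis unfolding real_differentiable_def by blast
qed

lemma Ck_on_cong:
  assumes "openin (Euclidean_space n) U" "\<And>z. z \<in> U \<Longrightarrow> f z = g z" "Ck_on n k U f"
  shows "Ck_on n k U g"
  using assms(2,3)
proof (induction k arbitrary: f g)
  case 0
  from 0(2) have "continuous_map (subtopology (Euclidean_space n) U) euclideanreal f" by simp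
  then have "continuous_map (subtopology (Euclidean_space n) U) euclideanreal g"
    by (rule continuous_map_eq) (use 0(1) in simp)
  then show ?case by simp
next
  case (Suc k)
  from Suc.prems(2) have "continuous_map (subtopology (Euclidean_space n) U) euclideanreal f" by simp
  then have "continuous_map (subtopology (Euclidean_space n) U) euclideanreal g"
    by (rule continuous_map_eq) (use Suc.prems(1) in simp)
  moreover have "(\<lambda>t. g (x(i := t))) differentiable (at (x i))" if "i < n" "x \<in> U" for i x
    by (rule partial_differentiable_cong[OF assms(1) that(2,1), of f g]) (use Suc.prems that in auto)
  moreover have "Ck_on n k U (pd i g)" if "i < n" for i
  proof (rule Suc.IH[of "pd i f"])
    show "pd i f z = pd i g z" if "z \<in> U" for z
      by (rule pd_cong[OF assms(1) \<open>z \<in> U\<close> \<open>i < n\<close> Suc.prems(1)])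
    show "Ck_on n k U (pd i f)" using Suc.prems(2) that by simp
  qed
  ultimately show ?case by simp
qed

lemma Ck_on_subset:
  assumes "V \<subseteq> U" "Ck_on n k U f"
  shows "Ck_on n k V f"
  using assms(2)
proof (induction k arbitrary: f)
  case 0
  then show ?case using assms(1) by (simp add: continuous_map_from_subtopology_mono)
next
  case (Suc k)
  then show ?case using assms(1) continuous_map_from_subtopology_mono by auto
qed

text \<open>Continuity is local by the pasting lemma, and differentiability is a pointwise
  condition. This is what allows forms given chart by chart to be patched together.\<close>

lemma Ck_on_locally:
  assumes "\<And>x. x \<in> U \<Longrightarrow> \<exists>V. openin (Euclidean_space n) V \<and> x \<in> V \<and> V \<subseteq> U \<and> Ck_on n k V f"
  shows "Ck_on n k U f"
proof -
  obtain T where T: "\<And>x. x \<in> U \<Longrightarrow> openin (Euclidean_space n) (T x)" "\<And>x. x \<in> U \<Longrightarrow> x \<in> T x"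
      "\<And>x. x \<in> U \<Longrightarrow> T x \<subseteq> U" "\<And>x. x \<in> U \<Longrightarrow> Ck_on n k (T x) f"
    using assms by metis
  have cont: "continuous_map (subtopology (Euclidean_space n) U) euclideanreal f"
    if "\<And>x. x \<in> U \<Longrightarrow> continuous_map (subtopology (Euclidean_space n) (T x)) euclideanreal f" for f
  proof (rule pasting_lemma[where I = U and T = T and f = "\<lambda>_. f"])
    fix x assume x: "x \<in> U"
    then show "openin (subtopology (Euclidean_space n) U) (T x)"
      using T by (simp add: openin_open_subtopology openin_subset openin_subtopology_alt) blast
    show "continuous_map (subtopology (subtopology (Euclidean_space n) U) (T x)) euclideanreal f"
      using that[OF x] T(3)[OF x] by (simp add: subtopology_subtopology Int_absorb1)
  qed (use T(2) in auto)
  show ?thesis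
    using T(4)
  proof (induction k arbitrary: f)
    case 0
    then show ?case using cont by auto
  next
    case (Suc k)
    then show ?case using cont T(2) by simp
  qed
qed

lemma pd_const [simp]: "pd i (\<lambda>_. c) = (\<lambda>_. 0)"
  by (simp add: pd_def fun_eq_iff)

lemma Ck_on_const: "Ck_on n k U (\<lambda>_. c)"
  by (induction k arbitrary: c) auto

lemma pd_add:
  assumes "(\<lambda>t. f (x(i := t))) differentiable (at (x i))" "(\<lambda>t. g (x(i := t))) differentiable (at (x i))"
  shows "pd i (\<lambda>x. f x + g x) x = pd i f x + pd i g x"
  using assms unfolding pd_def real_differentiable_def
  by (auto intro!: deriv_add simp: field_differentiable_def)

lemma pd_cmult:
  assumes "(\<lambda>t. f (x(i := t))) differentiable (at (x i))"
  shows "pd i (\<lambda>x. c * f x) x = c * pd i f x"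
  using assms unfolding pd_def real_differentiable_def
  by (auto intro!: deriv_cmult simp: field_differentiable_def)

lemma Ck_on_add:
  assumes U: "openin (Euclidean_space n) U"
  shows "Ck_on n k U f \<Longrightarrow> Ck_on n k U g \<Longrightarrow> Ck_on n k U (\<lambda>x. f x + g x)"
proof (induction k arbitrary: f g)
  case 0
  then show ?case by (simp add: continuous_map_add)
next
  case (Suc k)
  have "Ck_on n k U (pd i (\<lambda>x. f x + g x))" if "i < n" for i
  proof (rule Ck_on_cong[OF U])
    show "Ck_on n k U (\<lambda>x. pd i f x + pd i g x)"
      by (rule Suc.IH) (use Suc.prems that in simp_all)
    show "pd i f z + pd i g z = pd i (\<lambda>x. f x + g x) z" if "z \<in> U" for z
      by (rule pd_add[symmetric]) (use Suc.prems \<open>i < n\<close> that in simp_all)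
  qed
  then show ?case using Suc.prems by (simp add: continuous_map_add)
qed

lemma Ck_on_cmult:
  assumes U: "openin (Euclidean_space n) U"
  shows "Ck_on n k U f \<Longrightarrow> Ck_on n k U (\<lambda>x. c * f x)"
proof (induction k arbitrary: f)
  case 0
  then show ?case by (simp add: continuous_map_real_mult_left)
next
  case (Suc k)
  have "Ck_on n k U (pd i (\<lambda>x. c * f x))" if "i < n" for i
  proof (rule Ck_on_cong[OF U])
    show "Ck_on n k U (\<lambda>x. c * pd i f x)"
      by (rule Suc.IH) (use Suc.prems that in simp_all)
    show "c * pd i f z = pd i (\<lambda>x. c * f x) z" if "z \<in> U" for z
      by (rule pd_cmult[symmetric]) (use Suc.prems \<open>i < n\<close> that in simp_all)
  qed
  then show ?case using Suc.prems by (simp add: continuous_map_real_mult_left)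
qed

section \<open>Affine maps with diagonal linear part\<close>

definition aff :: "nat \<Rightarrow> (nat \<Rightarrow> real) \<Rightarrow> (nat \<Rightarrow> real) \<Rightarrow> (nat \<Rightarrow> real) \<Rightarrow> nat \<Rightarrow> real" where
  "aff n s k x = (\<lambda>i. if i < n then s i * x i + k i else 0)"

lemma aff_in_topspace [simp]: "aff n s k x \<in> topspace (Euclidean_space n)"
  by (simp add: aff_def topspace_Euclidean_space)

lemma continuous_map_coordinate:
  "continuous_map (subtopology (Euclidean_space n) U) euclideanreal (\<lambda>x. x j)"
  unfolding Euclidean_space_def
  by (intro continuous_map_from_subtopology continuous_map_product_projection UNIV_I)

lemma continuous_map_aff: "continuous_map (Euclidean_space n) (Euclidean_space n) (aff n s k)"
  unfolding aff_def continuous_map_componentwise_Euclidean_space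
  using continuous_map_coordinate[of n UNIV]
  by (auto intro!: continuous_map_add continuous_map_real_mult_left)

lemma aff_fun_upd: "i < n \<Longrightarrow> aff n s k (x(i := t)) = (aff n s k x)(i := s i * t + k i)"
  by (auto simp: aff_def)

text \<open>Coordinate i of the image depends on coordinate i of the argument alone, so the chain
  rule in one variable suffices.\<close>

lemma DERIV_comp_aff:
  assumes "i < n" "(\<lambda>t. f ((aff n s k x)(i := t))) differentiable (at (aff n s k x i))"
  shows "((\<lambda>t. f (aff n s k (x(i := t)))) has_real_derivative s i * pd i f (aff n s k x)) (at (x i))"
proof -
  have i: "aff n s k x i = s i * x i + k i" using assms by (simp add: aff_def)
  have "((\<lambda>t. f ((aff n s k x)(i := t))) has_real_derivative pd i f (aff n s k x)) (at (s i * x i + k i))"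
    using assms(2) unfolding pd_def i
    by (metis DERIV_deriv_iff_real_differentiable)
  moreover have "((\<lambda>t. s i * t + k i) has_real_derivative s i) (at (x i))"
    by (auto intro!: derivative_eq_intros)
  ultimately have "((\<lambda>t. f ((aff n s k x)(i := s i * t + k i))) has_real_derivative
      pd i f (aff n s k x) * s i) (at (x i))"
    by (rule DERIV_chain2)
  then show ?thesis using assms(1) by (simp add: aff_fun_upd mult.commute)
qed

lemma pd_comp_aff:
  assumes "i < n" "(\<lambda>t. f ((aff n s k x)(i := t))) differentiable (at (aff n s k x i))"
  shows "pd i (\<lambda>x. f (aff n s k x)) x = s i * pd i f (aff n s k x)"
  unfolding pd_def[of i "\<lambda>x. f (aff n s k x)"] by (rule DERIV_imp_deriv[OF DERIV_comp_aff[OF assms]])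

lemma Ck_on_comp_aff:
  assumes U: "openin (Euclidean_space n) U" and V: "\<And>x. x \<in> U \<Longrightarrow> aff n s k x \<in> V"
  shows "Ck_on n l V f \<Longrightarrow> Ck_on n l U (\<lambda>x. f (aff n s k x))"
proof -
  have "continuous_map (subtopology (Euclidean_space n) U) (subtopology (Euclidean_space n) V) (aff n s k)"
    using V by (auto simp: continuous_map_in_subtopology intro: continuous_map_from_subtopology[OF continuous_map_aff])
  then have cont: "continuous_map (subtopology (Euclidean_space n) U) euclideanreal (\<lambda>x. f (aff n s k x))"
    if "continuous_map (subtopology (Euclidean_space n) V) euclideanreal f" for f
    using continuous_map_compose[OF _ that] by (auto simp: o_def)
  show "Ck_on n l V f \<Longrightarrow> Ck_on n l U (\<lambda>x. f (aff n s k x))"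
  proof (induction l arbitrary: f)
    case 0
    then show ?case using cont by simp
  next
    case (Suc l)
    have "Ck_on n l U (pd i (\<lambda>x. f (aff n s k x)))" if i: "i < n" for i
    proof (rule Ck_on_cong[OF U])
      show "Ck_on n l U (\<lambda>x. s i * pd i f (aff n s k x))"
        using Suc.IH[of "pd i f"] Suc.prems i by (intro Ck_on_cmult[OF U]) simp
      show "s i * pd i f (aff n s k z) = pd i (\<lambda>x. f (aff n s k x)) z" if "z \<in> U" for z
        using Suc.prems i V[OF that] by (simp add: pd_comp_aff)
    qed
    moreover have "(\<lambda>t. f (aff n s k (x(i := t)))) differentiable (at (x i))"
      if "i < n" "x \<in> U" for i x
    proof -
      have "(\<lambda>t. f ((aff n s k x)(i := t))) differentiable (at (aff n s k x i))"
        using Suc.prems that V by simp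
      from DERIV_comp_aff[OF that(1) this] show ?thesis
        unfolding real_differentiable_def by blast
    qed
    moreover have "continuous_map (subtopology (Euclidean_space n) U) euclideanreal (\<lambda>x. f (aff n s k x))"
      using cont Suc.prems by simp
    ultimately show ?case by simp
  qed
qed

lemma smooth_on_cong:
  "openin (Euclidean_space n) U \<Longrightarrow> (\<And>z. z \<in> U \<Longrightarrow> f z = g z) \<Longrightarrow> smooth_on n U f \<Longrightarrow> smooth_on n U g"
  unfolding smooth_on_def using Ck_on_cong[of n U f g] by simp

lemma smooth_on_subset: "V \<subseteq> U \<Longrightarrow> smooth_on n U f \<Longrightarrow> smooth_on n V f"
  unfolding smooth_on_def using Ck_on_subset[of V U n _ f] by simp

lemma smooth_on_locally:
  assumes "\<And>x. x \<in> U \<Longrightarrow> \<exists>V. openin (Euclidean_space n) V \<and> x \<in> V \<and> V \<subseteq> U \<and> smooth_on n V f"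
  shows "smooth_on n U f"
  unfolding smooth_on_def
proof
  fix k show "Ck_on n k U f"
    by (rule Ck_on_locally) (use assms in \<open>unfold smooth_on_def, meson\<close>)
qed

lemma smooth_on_imp_continuous:
  "smooth_on n U f \<Longrightarrow> continuous_map (subtopology (Euclidean_space n) U) euclideanreal f"
  unfolding smooth_on_def using Ck_on.simps(1)[of n U f] by blast

lemma smooth_on_differentiable:
  "smooth_on n U f \<Longrightarrow> i < n \<Longrightarrow> x \<in> U \<Longrightarrow> (\<lambda>t. f (x(i := t))) differentiable (at (x i))"
  unfolding smooth_on_def using Ck_on.simps(2)[of n 0 U f] by blast

lemma smooth_on_pd: "smooth_on n U f \<Longrightarrow> i < n \<Longrightarrow> smooth_on n U (pd i f)"
  unfolding smooth_on_def using Ck_on.simps(2)[of n _ U f] by blast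

lemma smooth_on_const: "smooth_on n U (\<lambda>_. c)"
  unfolding smooth_on_def by (simp add: Ck_on_const)

lemma smooth_on_add:
  "openin (Euclidean_space n) U \<Longrightarrow> smooth_on n U f \<Longrightarrow> smooth_on n U g \<Longrightarrow> smooth_on n U (\<lambda>x. f x + g x)"
  unfolding smooth_on_def by (simp add: Ck_on_add)

lemma smooth_on_cmult:
  "openin (Euclidean_space n) U \<Longrightarrow> smooth_on n U f \<Longrightarrow> smooth_on n U (\<lambda>x. c * f x)"
  unfolding smooth_on_def by (simp add: Ck_on_cmult)

lemma smooth_on_sum:
  assumes U: "openin (Euclidean_space n) U" and "finite I" "\<And>i. i \<in> I \<Longrightarrow> smooth_on n U (f i)"
  shows "smooth_on n U (\<lambda>x. \<Sum>i\<in>I. f i x)"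
  using assms(2,3)
  by (induction I rule: finite_induct) (auto intro: smooth_on_const smooth_on_add[OF U])

lemma smooth_on_comp_aff:
  "openin (Euclidean_space n) U \<Longrightarrow> (\<And>x. x \<in> U \<Longrightarrow> aff n s k x \<in> V) \<Longrightarrow> smooth_on n V f \<Longrightarrow>
     smooth_on n U (\<lambda>x. f (aff n s k x))"
  unfolding smooth_on_def using Ck_on_comp_aff[of n U s k V _ f] by blast

lemma pd_coordinate: "pd i (\<lambda>x. x j) x = (if i = j then 1 else 0)"
  by (simp add: pd_def)

lemma smooth_on_coordinate:
  "smooth_on n U (\<lambda>x. x j)"
proof -
  have "Ck_on n k U (\<lambda>x. x j)" for k
  proof (cases k)
    case 0
    then show ?thesis by (simp add: continuous_map_coordinate)
  next
    case (Suc k)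
    have "pd i (\<lambda>x. x j) = (\<lambda>_. if i = j then 1 else 0)" for i
      by (simp add: pd_coordinate fun_eq_iff)
    moreover have "(\<lambda>t. (x(i := t)) j) differentiable (at (x i :: real))" for x i
      by (cases "i = j") auto
    ultimately show ?thesis
      unfolding Suc by (auto simp: continuous_map_coordinate Ck_on_const)
  qed
  then show ?thesis by (simp add: smooth_on_def)
qed

lemma pd_aff_coordinate:
  assumes "i < n" "j < n" shows "pd i (\<lambda>x. aff n s k x j) x = (if i = j then s j else 0)"
  using pd_comp_aff[of i n "\<lambda>x. x j" s k x] assms smooth_on_differentiable[OF smooth_on_coordinate, of i n _ UNIV j]
  by (simp add: pd_coordinate)

section \<open>Quotients of the torus by an affine involution\<close>

text \<open>Half integers are discrete. The isolation of orbits, and with it the Hausdorff property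
  and the size of the charts, comes from here.\<close>

lemma ex_half_integer_gap:
  fixes r :: real
  shows "\<exists>d>0. \<forall>k. 2 * k \<in> \<int> \<longrightarrow> \<bar>r - k\<bar> < d \<longrightarrow> k = r"
proof -
  define f where "f = 2 * r - of_int \<lfloor>2 * r\<rfloor>"
  have f: "0 \<le> f" "f < 1" unfolding f_def by linarith+
  \<comment> \<open>Since f is the fractional part of 2 * r, this is the distance from r to the
    nearest half integer other than r.\<close>
  define d where "d = (if f = 0 then 1/2 else min f (1 - f) / 2)"
  have "d > 0" using f by (auto simp: d_def)
  moreover have "k = r" if k: "2 * k \<in> \<int>" "\<bar>r - k\<bar> < d" for k
  proof -
    obtain m :: int where m: "2 * k = of_int m" using k(1) by (auto elim: Ints_cases)
    have r: "2 * r = of_int \<lfloor>2 * r\<rfloor> + f" by (simp add: f_def)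
    have *: "\<bar>of_int (\<lfloor>2 * r\<rfloor> - m) + f\<bar> < 2 * d" using k(2) m r by (simp add: abs_less_iff)
    consider "\<lfloor>2 * r\<rfloor> = m" | "\<lfloor>2 * r\<rfloor> - m \<ge> 1" | "\<lfloor>2 * r\<rfloor> - m \<le> -1" by linarith
    then show ?thesis
    proof cases
      case 1
      then have "f < 2 * d" using * f by simp
      then have "f = 0" using f by (auto simp: d_def split: if_splits)
      then show ?thesis using 1 m r by simp
    next
      case 2
      then have "real_of_int (\<lfloor>2 * r\<rfloor> - m) \<ge> 1" by linarith
      then have "2 * d > 1 + f" using * by linarith
      then show ?thesis using f by (auto simp: d_def split: if_splits)
    next
      case 3
      then have "real_of_int (\<lfloor>2 * r\<rfloor> - m) \<le> -1" by linarith
      then have "2 * d > 1 - f" using * by linarith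
      then show ?thesis using f by (auto simp: d_def split: if_splits)
    qed
  qed
  ultimately show ?thesis by blast
qed

section \<open>Signed translations as bijections of R^n\<close>

lemma aff_aff: "aff n s k (aff n s' k' x) = aff n (\<lambda>i. s i * s' i) (\<lambda>i. s i * k' i + k i) x"
  by (auto simp: aff_def algebra_simps)

lemma aff_trivial: "x \<in> topspace (Euclidean_space n) \<Longrightarrow> aff n (\<lambda>_. 1) (\<lambda>_. 0) x = x"
  by (auto simp: aff_def topspace_Euclidean_space)

text \<open>Signs square to one, so the inverse has the same linear part and only the translation
  changes.\<close>

lemma aff_inverse:
  assumes "\<forall>i. s i = 1 \<or> s i = -1" "x \<in> topspace (Euclidean_space n)"
  shows "aff n s (\<lambda>i. - (s i * k i)) (aff n s k x) = x" "aff n s k (aff n s (\<lambda>i. - (s i * k i)) x) = x"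
proof -
  have "s i * s i = 1" for i using spec[OF assms(1), of i] by auto
  moreover have "s i * (s i * a) = a" for i a using spec[OF assms(1), of i] by auto
  ultimately show "aff n s (\<lambda>i. - (s i * k i)) (aff n s k x) = x" "aff n s k (aff n s (\<lambda>i. - (s i * k i)) x) = x"
    using assms(2) by (auto simp: aff_def topspace_Euclidean_space fun_eq_iff algebra_simps)
qed

text \<open>Sign changes and translations are isometries of the sup norm. This is why boxes serve as
  neighbourhoods: the group permutes them and preserves their size.\<close>

lemma aff_in_cube:
  assumes "\<forall>i. s i = 1 \<or> s i = -1" "z \<in> cube n x e"
  shows "aff n s k z \<in> cube n (aff n s k x) e"
proof -
  have "\<bar>s i * z i + k i - (s i * x i + k i)\<bar> = \<bar>z i - x i\<bar>" for i
    using spec[OF assms(1), of i] by auto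
  then show ?thesis using assms(2) by (auto simp: cube_def aff_def)
qed

lemma openin_aff_vimage:
  assumes "openin (Euclidean_space n) U"
  shows "openin (Euclidean_space n) {x \<in> topspace (Euclidean_space n). aff n s k x \<in> U}"
  by (rule openin_continuous_map_preimage[OF continuous_map_aff assms])

lemma aff_image_eq:
  assumes "\<forall>i. s i = 1 \<or> s i = -1" "U \<subseteq> topspace (Euclidean_space n)"
  shows "aff n s k ` U = {x \<in> topspace (Euclidean_space n). aff n s (\<lambda>i. - (s i * k i)) x \<in> U}"
proof (intro Set.set_eqI iffI)
  fix y assume "y \<in> aff n s k ` U"
  then obtain x where "x \<in> U" "y = aff n s k x" by blast
  then show "y \<in> {x \<in> topspace (Euclidean_space n). aff n s (\<lambda>i. - (s i * k i)) x \<in> U}"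
    using aff_inverse(1)[of s x n k] assms by auto
next
  fix y assume "y \<in> {x \<in> topspace (Euclidean_space n). aff n s (\<lambda>i. - (s i * k i)) x \<in> U}"
  then show "y \<in> aff n s k ` U"
    using aff_inverse(2)[of s y n k] assms(1) by (intro image_eqI[of _ _ "aff n s (\<lambda>i. - (s i * k i)) y"]) auto
qed

lemma openin_aff_image:
  assumes "\<forall>i. s i = 1 \<or> s i = -1" "openin (Euclidean_space n) U"
  shows "openin (Euclidean_space n) (aff n s k ` U)"
  using openin_aff_vimage[OF assms(2)] aff_image_eq[OF assms(1) openin_subset[OF assms(2)]] by simp

lemma inj_on_aff:
  assumes "\<forall>i. s i = 1 \<or> s i = -1" "U \<subseteq> topspace (Euclidean_space n)"
  shows "inj_on (aff n s k) U"
  by (rule inj_on_inverseI[of _ "aff n s (\<lambda>i. - (s i * k i))"]) (use aff_inverse(1)[OF assms(1)] assms(2) in auto)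

lemma smooth_on_aff_coordinate: "openin (Euclidean_space n) U \<Longrightarrow> smooth_on n U (\<lambda>x. aff n s k x j)"
  by (rule smooth_on_comp_aff[of n U s k UNIV "\<lambda>x. x j"]) (auto simp: smooth_on_coordinate)

section \<open>The flat metric and its isometries\<close>

definition flat :: metric where "flat = (\<lambda>x i j. if i = j then 1 else 0)"

lemma riemannian_metric_on_flat: "riemannian_metric_on n U flat"
  unfolding riemannian_metric_on_def
proof (intro conjI allI ballI impI)
  fix i j show "smooth_on n U (\<lambda>x. flat x i j)" by (simp add: flat_def smooth_on_const)
next
  fix x :: "nat \<Rightarrow> real" and v :: "nat \<Rightarrow> real" assume "\<exists>i<n. v i \<noteq> 0"
  then obtain i where i: "i < n" "v i \<noteq> 0" by blast
  have "(\<Sum>i<n. \<Sum>j<n. flat x i j * v i * v j) = (\<Sum>i<n. (v i)\<^sup>2)"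
  proof (rule sum.cong)
    fix i assume i: "i \<in> {..<n}"
    have "(\<Sum>j<n. flat x i j * v i * v j) = (\<Sum>j<n. if i = j then v i * v j else 0)"
      by (rule sum.cong) (auto simp: flat_def)
    then show "(\<Sum>j<n. flat x i j * v i * v j) = (v i)\<^sup>2" using i by (simp add: power2_eq_square)
  qed simp
  moreover have "(\<Sum>i<n. (v i)\<^sup>2) > 0"
    by (rule sum_pos2[of _ i]) (use i in auto)
  ultimately show "0 < (\<Sum>i<n. \<Sum>j<n. flat x i j * v i * v j)" by simp
qed (auto simp: flat_def)

text \<open>The Jacobian is the diagonal matrix of signs, which is orthogonal. The map h need only
  agree with the affine one on V, because elements of a local group are undefined off their
  domain.\<close>

lemma isometric_diffeo_aff:
  assumes s: "\<forall>i. s i = 1 \<or> s i = -1" and V: "openin (Euclidean_space n) V"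
    and h: "\<And>x. x \<in> V \<Longrightarrow> h x = aff n s k x" and W: "aff n s k ` V = W"
  shows "isometric_diffeo n V flat W flat h"
proof -
  have VE: "V \<subseteq> topspace (Euclidean_space n)" using V openin_subset by blast
  have W': "openin (Euclidean_space n) W" using openin_aff_image[OF s V, of k] unfolding W .
  have bij: "bij_betw h V W"
    using inj_on_aff[OF s VE] W bij_betw_cong[of V h "aff n s k" W] h by (simp add: bij_betw_def)
  have inv: "aff n s (\<lambda>i. - (s i * k i)) y = inv_into V h y" if y: "y \<in> W" for y
  proof -
    obtain x where x: "x \<in> V" "y = aff n s k x" using y W by blast
    then have "inv_into V h y = x"
      using h bij inv_into_f_f[of h V x] by (simp add: bij_betw_def)
    then show ?thesis using aff_inverse(1)[OF s, of x n k] x VE by auto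
  qed
  have sm: "smooth_on n V (\<lambda>x. h x j)" for j
    by (rule smooth_on_cong[OF V, of "\<lambda>x. aff n s k x j"]) (simp_all add: h smooth_on_aff_coordinate V)
  have sm': "smooth_on n W (\<lambda>x. inv_into V h x j)" for j
    by (rule smooth_on_cong[OF W', of "\<lambda>x. aff n s (\<lambda>i. - (s i * k i)) x j"]) (simp_all add: inv smooth_on_aff_coordinate W')
  have pd: "pd a (\<lambda>y. h y i) x = (if a = i then s i else 0)" if "x \<in> V" "a < n" "i < n" for x a i
    using pd_cong[OF V that(1,2), of "\<lambda>y. h y i" "\<lambda>y. aff n s k y i"] h pd_aff_coordinate[OF that(2,3)] by simp
  have "flat x a b = (\<Sum>i<n. \<Sum>j<n. pd a (\<lambda>y. h y i) x * pd b (\<lambda>y. h y j) x * flat (h x) i j)"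
    if x: "x \<in> V" and ab: "a < n" "b < n" for x a b
  proof -
    have "(\<Sum>j<n. pd a (\<lambda>y. h y i) x * pd b (\<lambda>y. h y j) x * flat (h x) i j) =
        (if i = a then (if a = b then 1 else 0) else 0)" if i: "i < n" for i
    proof -
      have "(\<Sum>j<n. pd a (\<lambda>y. h y i) x * pd b (\<lambda>y. h y j) x * flat (h x) i j) =
        (\<Sum>j<n. if j = b then (if a = i then s i else 0) * s b * flat (h x) i b else 0)"
        by (rule sum.cong) (use pd x ab i in auto)
      also have "\<dots> = (if a = i then s i else 0) * s b * flat (h x) i b" using ab by simp
      also have "\<dots> = (if i = a then (if a = b then 1 else 0) else 0)"
        using spec[OF s, of a] by (auto simp: flat_def)
      finally show ?thesis .
    qed
    then have "(\<Sum>i<n. \<Sum>j<n. pd a (\<lambda>y. h y i) x * pd b (\<lambda>y. h y j) x * flat (h x) i j) =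
        (\<Sum>i<n. if i = a then (if a = b then 1 else 0) else 0)"
      by (intro sum.cong) auto
    also have "\<dots> = (if a = b then 1 else 0)" using ab by simp
    finally show ?thesis by (simp add: flat_def)
  qed
  then show ?thesis
    unfolding isometric_diffeo_def smooth_map_on_def using bij sm sm' by blast
qed

section \<open>The group generated by the integer lattice and the involution\<close>

lemma Ints_sgn_mult: "(s :: real) = 1 \<or> s = -1 \<Longrightarrow> x \<in> \<int> \<Longrightarrow> s * x \<in> \<int>"
  by auto

text \<open>Signs preserve Z^n, so x -> \<sigma> x + \<kappa> descends to the torus. By
  \<open>half\<close> its square is a lattice translation, so on the torus it squares to the
  identity.\<close>

locale torus_involution =
  fixes n :: nat and \<sigma> \<kappa> :: "nat \<Rightarrow> real"
  assumes sgn: "\<sigma> i = 1 \<or> \<sigma> i = -1" and half: "2 * \<kappa> i \<in> \<int>"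
begin

text \<open>The quotient of the torus by the involution is R^n modulo this group. Its elements are
  kept as pairs of signs and translation, because the arguments below inspect the two parts
  separately.\<close>

definition G :: "((nat \<Rightarrow> real) \<times> (nat \<Rightarrow> real)) set" where
  "G = {(s, k). (s = (\<lambda>_. 1) \<and> (\<forall>i. k i \<in> \<int>)) \<or> (s = \<sigma> \<and> (\<forall>i. k i - \<kappa> i \<in> \<int>))}"

lemma G_sgn: "(s, k) \<in> G \<Longrightarrow> \<forall>i. s i = 1 \<or> s i = -1"
  using sgn by (auto simp: G_def)

lemma G_half:
  assumes "(s, k) \<in> G" shows "2 * k i \<in> \<int>"
proof -
  consider "k i \<in> \<int>" | "k i - \<kappa> i \<in> \<int>" using assms by (auto simp: G_def)
  then show ?thesis
  proof cases
    case 1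
    then show ?thesis by simp
  next
    case 2
    have "2 * k i = 2 * (k i - \<kappa> i) + 2 * \<kappa> i" by simp
    moreover have "2 * (k i - \<kappa> i) \<in> \<int>" using 2 by (intro Ints_mult) auto
    ultimately show ?thesis using half[of i] Ints_add by metis
  qed
qed

lemma G_trivial: "(\<lambda>_. 1, \<lambda>_. 0) \<in> G"
  by (simp add: G_def)

text \<open>This number is the translation part of the square of the involution; it is 0 or 2 *
  \<kappa> i according to the sign.\<close>

lemma sgn_kappa: "\<sigma> i * \<kappa> i + \<kappa> i \<in> \<int>"
  using sgn[of i] half[of i] by auto

lemma G_comp:
  assumes "(s, k) \<in> G" "(s', k') \<in> G"
  shows "(\<lambda>i. s i * s' i, \<lambda>i. s i * k' i + k i) \<in> G"
proof -
  have ss: "\<sigma> i * \<sigma> i = 1" for i using sgn[of i] by auto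
  consider "s = (\<lambda>_. 1)" "\<And>i. k i \<in> \<int>" "s' = (\<lambda>_. 1)" "\<And>i. k' i \<in> \<int>"
    | "s = (\<lambda>_. 1)" "\<And>i. k i \<in> \<int>" "s' = \<sigma>" "\<And>i. k' i - \<kappa> i \<in> \<int>"
    | "s = \<sigma>" "\<And>i. k i - \<kappa> i \<in> \<int>" "s' = (\<lambda>_. 1)" "\<And>i. k' i \<in> \<int>"
    | "s = \<sigma>" "\<And>i. k i - \<kappa> i \<in> \<int>" "s' = \<sigma>" "\<And>i. k' i - \<kappa> i \<in> \<int>"
    using assms unfolding G_def by blast
  then show ?thesis
  proof cases
    case 1
    then show ?thesis by (simp add: G_def)
  next
    case 2
    have "k' i + k i - \<kappa> i = (k' i - \<kappa> i) + k i" for i by simp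
    then have "k' i + k i - \<kappa> i \<in> \<int>" for i using 2 Ints_add by metis
    then show ?thesis using 2 by (simp add: G_def)
  next
    case 3
    have "\<sigma> i * k' i + k i - \<kappa> i = \<sigma> i * k' i + (k i - \<kappa> i)" for i by simp
    then have "\<sigma> i * k' i + k i - \<kappa> i \<in> \<int>" for i using 3 Ints_add Ints_sgn_mult[OF sgn] by metis
    then show ?thesis using 3 by (simp add: G_def)
  next
    case 4
    \<comment> \<open>Two elements over the involution compose to its square up to lattice vectors;
      the last summand is the translation of that square.\<close>
    have "\<sigma> i * k' i + k i = \<sigma> i * (k' i - \<kappa> i) + (k i - \<kappa> i) + (\<sigma> i * \<kappa> i + \<kappa> i)" for i
      by (simp add: algebra_simps)
    then have "\<sigma> i * k' i + k i \<in> \<int>" for i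
      using 4 Ints_add Ints_sgn_mult[OF sgn] sgn_kappa by metis
    then show ?thesis using 4 ss by (simp add: G_def)
  qed
qed

lemma G_inv:
  assumes "(s, k) \<in> G"
  shows "(s, \<lambda>i. - (s i * k i)) \<in> G"
proof (cases "s = (\<lambda>_. 1) \<and> (\<forall>i. k i \<in> \<int>)")
  case True
  then show ?thesis by (simp add: G_def)
next
  case False
  then have s: "s = \<sigma>" "\<And>i. k i - \<kappa> i \<in> \<int>" using assms by (auto simp: G_def)
  \<comment> \<open>The inverse of the involution differs from the involution itself by the lattice
    vector of \<open>sgn_kappa\<close>.\<close>
  have "- (\<sigma> i * k i) - \<kappa> i = - (\<sigma> i * (k i - \<kappa> i)) - (\<sigma> i * \<kappa> i + \<kappa> i)" for i
    by (simp add: algebra_simps)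
  then have "- (\<sigma> i * k i) - \<kappa> i \<in> \<int>" for i
    using s(2) Ints_diff Ints_minus Ints_sgn_mult[OF sgn] sgn_kappa by metis
  then show ?thesis using s by (simp add: G_def)
qed

section \<open>Orbits and the quotient topology\<close>

abbreviation "E \<equiv> topspace (Euclidean_space n)"

definition orb :: "(nat \<Rightarrow> real) \<Rightarrow> (nat \<Rightarrow> real) set" where
  "orb x = {aff n s k x | s k. (s, k) \<in> G}"

lemma orb_aff:
  assumes "(s, k) \<in> G" "x \<in> E" shows "orb (aff n s k x) = orb x"
proof -
  have *: "orb (aff n s k x) \<subseteq> orb x" if sk: "(s, k) \<in> G" for s k x
  proof
    fix y assume "y \<in> orb (aff n s k x)"
    then obtain s' k' where "(s', k') \<in> G" "y = aff n s' k' (aff n s k x)" by (auto simp: orb_def)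
    then show "y \<in> orb x" using G_comp[OF _ sk] unfolding orb_def aff_aff by blast
  qed
  have "orb x \<subseteq> orb (aff n s k x)"
    using *[OF G_inv[OF assms(1)], of "aff n s k x"] aff_inverse(1)[OF G_sgn[OF assms(1)] assms(2)] by simp
  then show ?thesis using *[OF assms(1)] by blast
qed

lemma orb_eq_iff:
  assumes "x \<in> E" "y \<in> E"
  shows "orb x = orb y \<longleftrightarrow> (\<exists>s k. (s, k) \<in> G \<and> aff n s k x = y)"
proof
  assume "orb x = orb y"
  moreover have "aff n (\<lambda>_. 1) (\<lambda>_. 0) y \<in> orb y" unfolding orb_def using G_trivial by blast
  ultimately have "y \<in> orb x" using aff_trivial[OF assms(2)] by simp
  then show "\<exists>s k. (s, k) \<in> G \<and> aff n s k x = y" by (auto simp: orb_def)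
next
  assume "\<exists>s k. (s, k) \<in> G \<and> aff n s k x = y"
  then show "orb x = orb y" using orb_aff assms(1) by blast
qed

text \<open>In coordinate i the orbit of x stays in the half integer translates of x i and - x i.
  Keeping d below the gaps for both signs forces each coordinate to match. With y = x this bounds
  the charts; with y in another orbit it separates points.\<close>

lemma orbit_isolated:
  assumes "y \<in> E"
  shows "\<exists>d>0. \<forall>s k. (s, k) \<in> G \<longrightarrow> aff n s k x \<in> cube n y d \<longrightarrow> aff n s k x = y"
proof -
  have "\<exists>g. \<forall>r. g r > 0 \<and> (\<forall>k :: real. 2 * k \<in> \<int> \<longrightarrow> \<bar>r - k\<bar> < g r \<longrightarrow> k = r)"
    by (intro choice allI ex_half_integer_gap)
  then obtain g where g: "\<And>r. g r > 0" "\<And>r k :: real. 2 * k \<in> \<int> \<Longrightarrow> \<bar>r - k\<bar> < g r \<Longrightarrow> k = r"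
    by blast
  obtain d where d: "d > 0" "\<forall>i\<in>{..<n}. d \<le> min (g (y i - x i)) (g (y i + x i))"
    using ex_min_pos[of "{..<n}" "\<lambda>i. min (g (y i - x i)) (g (y i + x i))"] g(1) by auto
  have coord: "aff n s k x i = y i" if sk: "(s, k) \<in> G" "\<bar>aff n s k x i - y i\<bar> < d" "i < n" for s k i
  proof -
    have di: "d \<le> g (y i - x i)" "d \<le> g (y i + x i)" using d(2) that(3) by auto
    have a: "aff n s k x i = s i * x i + k i" using that by (simp add: aff_def)
    have k: "2 * k i \<in> \<int>" using G_half[OF sk(1)] .
    from spec[OF G_sgn[OF sk(1)], of i] show ?thesis
    proof
      assume s: "s i = 1"
      have "\<bar>(y i - x i) - k i\<bar> < g (y i - x i)" using sk(2) di(1) unfolding a s by linarith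
      then have "k i = y i - x i" by (rule g(2)[OF k])
      then show ?thesis unfolding a s by simp
    next
      assume s: "s i = -1"
      have "\<bar>(y i + x i) - k i\<bar> < g (y i + x i)" using sk(2) di(2) unfolding a s by linarith
      then have "k i = y i + x i" by (rule g(2)[OF k])
      then show ?thesis unfolding a s by simp
    qed
  qed
  have "aff n s k x = y" if sk: "(s, k) \<in> G" and c: "aff n s k x \<in> cube n y d" for s k
  proof
    fix i
    show "aff n s k x i = y i"
    proof (cases "i < n")
      case True
      then have "\<bar>aff n s k x i - y i\<bar> < d" using c unfolding cube_def by blast
      then show ?thesis by (rule coord[OF sk _ True])
    next
      case False
      then show ?thesis using assms by (simp add: aff_def topspace_Euclidean_space)
    qed
  qed
  then show ?thesis using d(1) by (intro exI[of _ d] conjI allI impI)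
qed

text \<open>The quotient topology of R^n, with orbits as points; the first clause makes
  \<open>topspace\<close> consist of orbits only.\<close>

definition qtop :: "(nat \<Rightarrow> real) set topology" where
  "qtop = topology (\<lambda>U. U \<subseteq> orb ` E \<and> openin (Euclidean_space n) {x \<in> E. orb x \<in> U})"

lemma openin_qtop: "openin qtop U \<longleftrightarrow> U \<subseteq> orb ` E \<and> openin (Euclidean_space n) {x \<in> E. orb x \<in> U}"
proof -
  have "istopology (\<lambda>U. U \<subseteq> orb ` E \<and> openin (Euclidean_space n) {x \<in> E. orb x \<in> U})"
    unfolding istopology_def
  proof (intro conjI allI impI)
    fix S T assume S: "S \<subseteq> orb ` E \<and> openin (Euclidean_space n) {x \<in> E. orb x \<in> S}"
      and T: "T \<subseteq> orb ` E \<and> openin (Euclidean_space n) {x \<in> E. orb x \<in> T}"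
    have eq: "{x \<in> E. orb x \<in> S \<inter> T} = {x \<in> E. orb x \<in> S} \<inter> {x \<in> E. orb x \<in> T}" by blast
    show "openin (Euclidean_space n) {x \<in> E. orb x \<in> S \<inter> T}"
      unfolding eq by (rule openin_Int[OF conjunct2[OF S] conjunct2[OF T]])
    show "S \<inter> T \<subseteq> orb ` E" using S by blast
  next
    fix K assume K: "\<forall>S\<in>K. S \<subseteq> orb ` E \<and> openin (Euclidean_space n) {x \<in> E. orb x \<in> S}"
    have eq: "{x \<in> E. orb x \<in> \<Union> K} = (\<Union>S\<in>K. {x \<in> E. orb x \<in> S})" by blast
    show "openin (Euclidean_space n) {x \<in> E. orb x \<in> \<Union> K}"
      unfolding eq using K by (intro openin_Union ballI) (auto simp del: mem_Collect_eq)
    show "\<Union> K \<subseteq> orb ` E" using K by blast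
  qed
  then show ?thesis unfolding qtop_def by simp
qed

lemma topspace_qtop: "topspace qtop = orb ` E"
proof
  show "topspace qtop \<subseteq> orb ` E" using openin_qtop[of "topspace qtop"] by simp
  have "{x \<in> E. orb x \<in> orb ` E} = E" by blast
  then have "openin qtop (orb ` E)" unfolding openin_qtop by simp
  then show "orb ` E \<subseteq> topspace qtop" by (rule openin_subset)
qed

lemma continuous_map_orb: "continuous_map (Euclidean_space n) qtop orb"
  by (simp add: continuous_map_def topspace_qtop openin_qtop)

text \<open>The saturation of an open set is the union of its preimages under the group, each of
  which is open.\<close>

lemma openin_orb_image:
  assumes U: "openin (Euclidean_space n) U" shows "openin qtop (orb ` U)"
proof -
  have UE: "U \<subseteq> E" using U openin_subset by blast
  have "{x \<in> E. orb x \<in> orb ` U} = (\<Union>(s, k)\<in>G. {x \<in> E. aff n s k x \<in> U})"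
  proof (intro Set.set_eqI iffI)
    fix x assume "x \<in> {x \<in> E. orb x \<in> orb ` U}"
    then obtain y where y: "x \<in> E" "y \<in> U" "orb x = orb y" by blast
    then obtain s k where "(s, k) \<in> G" "aff n s k x = y" using orb_eq_iff[of x y] UE by auto
    then show "x \<in> (\<Union>(s, k)\<in>G. {x \<in> E. aff n s k x \<in> U})" using y by (intro UN_I[of "(s, k)"]) auto
  next
    fix x assume "x \<in> (\<Union>(s, k)\<in>G. {x \<in> E. aff n s k x \<in> U})"
    then obtain s k where sk: "(s, k) \<in> G" "x \<in> E" "aff n s k x \<in> U" by (auto simp del: aff_in_topspace)
    then have "orb x \<in> orb ` U" using orb_aff[OF sk(1,2)] by (metis imageI)
    then show "x \<in> {x \<in> E. orb x \<in> orb ` U}" using sk(2) by simp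
  qed
  moreover have "openin (Euclidean_space n) (\<Union>(s, k)\<in>G. {x \<in> E. aff n s k x \<in> U})"
    by (rule openin_Union) (use openin_aff_vimage[OF U] in auto)
  ultimately show ?thesis unfolding openin_qtop using UE by auto
qed

text \<open>If boxes of radius d/2 about x and y met a common orbit, the group element joining the
  two points would carry x to within d of y, hence onto y by \<open>orbit_isolated\<close>.\<close>

lemma Hausdorff_qtop: "Hausdorff_space qtop"
  unfolding Hausdorff_space_def topspace_qtop
proof (intro allI impI)
  fix p q assume "p \<in> orb ` E \<and> q \<in> orb ` E \<and> p \<noteq> q"
  then obtain x y where xy: "x \<in> E" "y \<in> E" "p = orb x" "q = orb y" "orb x \<noteq> orb y" by blast
  obtain d where d: "d > 0" "\<And>s k. (s, k) \<in> G \<Longrightarrow> aff n s k x \<in> cube n y d \<Longrightarrow> aff n s k x = y"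
    using orbit_isolated[OF xy(2)] by blast
  have "disjnt (orb ` cube n x (d/2)) (orb ` cube n y (d/2))"
  proof (rule ccontr)
    assume "\<not> ?thesis"
    then obtain z w where z: "z \<in> cube n x (d/2)" and w: "w \<in> cube n y (d/2)" and "orb z = orb w"
      unfolding disjnt_iff by blast
    moreover have "z \<in> E" "w \<in> E" using z w cube_subset_topspace by blast+
    ultimately obtain s k where sk: "(s, k) \<in> G" "aff n s k z = w" using orb_eq_iff[of z w] by blast
    have "w \<in> cube n (aff n s k x) (d/2)" using aff_in_cube[OF G_sgn[OF sk(1)] z] sk(2) by blast
    then have "\<bar>aff n s k x i - y i\<bar> < d" if "i < n" for i
    proof -
      have "\<bar>w i - y i\<bar> < d/2" "\<bar>w i - aff n s k x i\<bar> < d/2"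
        using w that \<open>w \<in> cube n (aff n s k x) (d/2)\<close> unfolding cube_def by blast+
      then show ?thesis by linarith
    qed
    then have "aff n s k x \<in> cube n y d" by (auto simp: cube_def aff_def)
    then have "aff n s k x = y" by (rule d(2)[OF sk(1)])
    then have "orb x = orb y" using orb_aff[OF sk(1) xy(1)] by simp
    then show False using xy by simp
  qed
  moreover have "openin qtop (orb ` cube n x (d/2))" "openin qtop (orb ` cube n y (d/2))"
    by (simp_all add: openin_orb_image openin_cube)
  moreover have "p \<in> orb ` cube n x (d/2)" "q \<in> orb ` cube n y (d/2)"
    using xy d(1) centre_in_cube by auto
  ultimately show "\<exists>U V. openin qtop U \<and> openin qtop V \<and> p \<in> U \<and> q \<in> V \<and> disjnt U V" by blast
qed

lemma second_countable_qtop: "second_countable qtop"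
proof (rule second_countable_open_map_image[OF continuous_map_orb])
  show "open_map (Euclidean_space n) qtop orb" unfolding open_map_def using openin_orb_image by blast
  show "orb ` E = topspace qtop" by (simp add: topspace_qtop)
  obtain B :: "(nat \<Rightarrow> real) set set" where B: "countable B" "topological_basis B"
    using ex_countable_basis by blast
  have "second_countable (euclidean :: (nat \<Rightarrow> real) topology)"
    unfolding second_countable_def
  proof (intro exI conjI ballI allI impI)
    show "openin euclidean V" if "V \<in> B" for V
      using topological_basis_open[OF B(2) that] by simp
    show "\<exists>V\<in>B. x \<in> V \<and> V \<subseteq> U" if "openin euclidean U \<and> x \<in> U" for U x
    proof -
      have "open U" "x \<in> U" using that by simp_all
      from topological_basisE[OF B(2) this] show ?thesis by metis
    qed
  qed (fact B(1))
  then show "second_countable (Euclidean_space n)"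
    unfolding Euclidean_space_def euclidean_product_topology by (rule second_countable_subtopology)
qed

text \<open>The closed unit cube is compact and meets every orbit.\<close>

lemma compact_qtop: "compact_space qtop"
proof -
  let ?C = "PiE UNIV (\<lambda>i. if i < n then {0..1::real} else {0})"
  have "compactin (powertop_real UNIV) ?C" by (auto simp: compactin_PiE)
  moreover have C: "?C \<subseteq> E"
  proof
    fix x assume x: "x \<in> ?C"
    have "x i = 0" if "n \<le> i" for i using PiE_mem[OF x, of i] that by simp
    then show "x \<in> E" by (simp add: topspace_Euclidean_space)
  qed
  ultimately have "compactin (Euclidean_space n) ?C"
    unfolding Euclidean_space_def compactin_subtopology topspace_Euclidean_space by simp
  then have "compactin qtop (orb ` ?C)" using image_compactin continuous_map_orb by blast
  moreover have "orb ` ?C = orb ` E"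
  proof
    show "orb ` ?C \<subseteq> orb ` E" using C by blast
    show "orb ` E \<subseteq> orb ` ?C"
    proof
      fix p assume "p \<in> orb ` E"
      then obtain x where x: "x \<in> E" "p = orb x" by blast
      \<comment> \<open>Translating by minus the integer parts moves any point into the unit
        cube.\<close>
      define k where "k i = - real_of_int \<lfloor>x i\<rfloor>" for i
      have k: "(\<lambda>_. 1, k) \<in> G" by (simp add: G_def k_def)
      have "aff n (\<lambda>_. 1) k x \<in> ?C"
        unfolding PiE_iff extensional_UNIV
      proof (intro conjI ballI UNIV_I)
        fix i
        have "x i - of_int \<lfloor>x i\<rfloor> \<in> {0..1}" unfolding atLeastAtMost_iff by linarith
        then show "aff n (\<lambda>_. 1) k x i \<in> (if i < n then {0..1} else {0})"
          by (simp add: aff_def k_def)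
      qed
      then show "p \<in> orb ` ?C" using orb_aff[OF k x(1)] x(2) by (metis image_eqI)
    qed
  qed
  ultimately show ?thesis by (simp add: compact_space_def topspace_qtop)
qed

end

section \<open>The orbifold atlas of the quotient\<close>

context torus_involution begin

text \<open>The local group is the isotropy group of the centre. Its elements are cut off by
  \<open>restrict\<close> because \<open>BijGroup\<close> consists of functions that are undefined
  off the set.\<close>

definition chart :: "(nat \<Rightarrow> real) \<Rightarrow> real \<Rightarrow> (nat \<Rightarrow> real) set orbi_chart" where
  "chart x e =
     \<lparr>chart_dom = cube n x e,
      chart_grp = {restrict (aff n s k) (cube n x e) | s k. (s, k) \<in> G \<and> aff n s k x = x},
      chart_map = orb, chart_met = flat\<rparr>"

text \<open>A group element joining two points of the box of radius e moves the centre by less than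
  2 * e. The condition then makes it fix the centre, so the isotropy group accounts for all
  identifications inside the box.\<close>

definition atlas :: "(nat \<Rightarrow> real) set orbi_chart set" where
  "atlas = {chart x e | x e. x \<in> E \<and> 0 < e \<and>
     (\<forall>s k. (s, k) \<in> G \<longrightarrow> aff n s k x \<in> cube n x (2 * e) \<longrightarrow> aff n s k x = x)}"

lemma chart_simps [simp]:
  "chart_dom (chart x e) = cube n x e" "chart_map (chart x e) = orb" "chart_met (chart x e) = flat"
  by (simp_all add: chart_def)

lemma mem_chart_grp:
  "\<gamma> \<in> chart_grp (chart x e) \<longleftrightarrow>
     (\<exists>s k. \<gamma> = restrict (aff n s k) (cube n x e) \<and> (s, k) \<in> G \<and> aff n s k x = x)"
  by (simp add: chart_def)

lemma atlasE:
  assumes "c \<in> atlas"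
  obtains x e where "c = chart x e" "x \<in> E" "0 < e"
    "\<And>s k. (s, k) \<in> G \<Longrightarrow> aff n s k x \<in> cube n x (2 * e) \<Longrightarrow> aff n s k x = x"
proof -
  from assms have "\<exists>x e. c = chart x e \<and> x \<in> E \<and> 0 < e \<and>
     (\<forall>s k. (s, k) \<in> G \<longrightarrow> aff n s k x \<in> cube n x (2 * e) \<longrightarrow> aff n s k x = x)"
    by (simp only: atlas_def mem_Collect_eq)
  then obtain x where "\<exists>e. c = chart x e \<and> x \<in> E \<and> 0 < e \<and>
     (\<forall>s k. (s, k) \<in> G \<longrightarrow> aff n s k x \<in> cube n x (2 * e) \<longrightarrow> aff n s k x = x)"
    by (rule exE)
  then obtain e where xe: "c = chart x e \<and> x \<in> E \<and> 0 < e \<and>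
     (\<forall>s k. (s, k) \<in> G \<longrightarrow> aff n s k x \<in> cube n x (2 * e) \<longrightarrow> aff n s k x = x)"
    by (rule exE)
  show thesis
  proof (rule that)
    show "c = chart x e" "x \<in> E" "0 < e" using xe by simp_all
    show "aff n s k x = x" if "(s, k) \<in> G" "aff n s k x \<in> cube n x (2 * e)" for s k
      using xe that by blast
  qed
qed

lemma ex_chart:
  assumes x: "x \<in> E" shows "\<exists>e>0. chart x e \<in> atlas"
proof -
  from orbit_isolated[OF x, of x] obtain d
    where d: "d > 0 \<and> (\<forall>s k. (s, k) \<in> G \<longrightarrow> aff n s k x \<in> cube n x d \<longrightarrow> aff n s k x = x)"
    by (rule exE)
  have two: "2 * (d / 2) = d" by simp
  have "chart x (d / 2) \<in> atlas"
    unfolding atlas_def mem_Collect_eq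
    by (rule exI[of _ x], rule exI[of _ "d / 2"], unfold two)
      (rule conjI[OF refl conjI[OF x conjI[OF half_gt_zero[OF conjunct1[OF d]] conjunct2[OF d]]]])
  then show ?thesis using half_gt_zero[OF conjunct1[OF d]] by blast
qed

lemma chart_dom_subset: "c \<in> atlas \<Longrightarrow> chart_dom c \<subseteq> E"
  by (erule atlasE) (simp add: cube_subset_topspace)

lemma openin_chart_dom: "c \<in> atlas \<Longrightarrow> openin (Euclidean_space n) (chart_dom c)"
  by (erule atlasE) (simp add: openin_cube)

lemma chart_met_atlas: "c \<in> atlas \<Longrightarrow> chart_met c = flat"
  by (erule atlasE) simp

lemma chart_map_atlas: "c \<in> atlas \<Longrightarrow> chart_map c = orb"
  by (erule atlasE) simp

section \<open>Local groups, chart maps and changes of charts\<close>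

lemma aff_image_cube:
  assumes "\<forall>i. s i = 1 \<or> s i = -1" "x \<in> E"
  shows "aff n s k ` cube n x e = cube n (aff n s k x) e"
proof
  show "aff n s k ` cube n x e \<subseteq> cube n (aff n s k x) e"
    by (rule image_subsetI) (rule aff_in_cube[OF assms(1)])
  show "cube n (aff n s k x) e \<subseteq> aff n s k ` cube n x e"
  proof
    fix y assume y: "y \<in> cube n (aff n s k x) e"
    then have "aff n s (\<lambda>i. - (s i * k i)) y \<in> cube n x e"
      using aff_in_cube[OF assms(1) y, of "\<lambda>i. - (s i * k i)"] aff_inverse(1)[OF assms] by simp
    moreover have "y \<in> E" using y cube_subset_topspace by blast
    ultimately show "y \<in> aff n s k ` cube n x e"
      by (intro image_eqI[of _ _ "aff n s (\<lambda>i. - (s i * k i)) y"]) (simp_all add: aff_inverse(2)[OF assms(1)])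
  qed
qed

text \<open>All charts share the projection \<open>orb\<close> and the flat metric, so a group
  element is a change of charts wherever it maps one domain into another. These changes suffice for
  the orbifold axioms.\<close>

lemma chart_change_aff:
  assumes c: "c \<in> atlas" and d: "d \<in> atlas" and sk: "(s, k) \<in> G"
    and V: "openin (Euclidean_space n) V" "V \<subseteq> chart_dom c" "aff n s k ` V \<subseteq> chart_dom d"
  shows "chart_change n c d V (aff n s k)"
proof -
  have VE: "V \<subseteq> E" using V(1) openin_subset by blast
  show ?thesis
    unfolding chart_change_def chart_met_atlas[OF c] chart_met_atlas[OF d]
      chart_map_atlas[OF c] chart_map_atlas[OF d]
  proof (intro conjI ballI)
    show "openin (Euclidean_space n) (aff n s k ` V)"
      by (rule openin_aff_image[OF G_sgn[OF sk] V(1)])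
    show "isometric_diffeo n V flat (aff n s k ` V) flat (aff n s k)"
      by (rule isometric_diffeo_aff[OF G_sgn[OF sk] V(1) refl refl])
    show "orb (aff n s k z) = orb z" if "z \<in> V" for z
      using orb_aff[OF sk] that VE by blast
  qed (use V in simp_all)
qed

text \<open>An element of the group that fixes the centre maps the box onto itself, so its
  restriction is a bijection; composites and inverses fix the centre again.\<close>

lemma subgroup_chart_grp:
  assumes "x \<in> E"
  shows "subgroup (chart_grp (chart x e)) (BijGroup (cube n x e))"
proof -
  let ?C = "cube n x e"
  have CE: "?C \<subseteq> E" by (rule cube_subset_topspace)
  have image: "aff n s k ` ?C = ?C" if "(s, k) \<in> G" "aff n s k x = x" for s k
    using aff_image_cube[OF G_sgn[OF that(1)] assms, of k e] that(2) by simp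
  have Bij: "restrict (aff n s k) ?C \<in> Bij ?C" if "(s, k) \<in> G" "aff n s k x = x" for s k
  proof -
    have "bij_betw (aff n s k) ?C ?C"
      using inj_on_aff[OF G_sgn[OF that(1)] CE] image[OF that] by (simp add: bij_betw_def)
    then have "bij_betw (restrict (aff n s k) ?C) ?C ?C"
      by (subst bij_betw_cong[of _ _ "aff n s k"]) auto
    then show ?thesis by (simp add: Bij_def)
  qed
  show ?thesis
  proof (rule subgroup.intro)
    show "chart_grp (chart x e) \<subseteq> carrier (BijGroup ?C)"
      using Bij by (auto simp: mem_chart_grp BijGroup_def)
  next
    fix f g assume f: "f \<in> chart_grp (chart x e)" and g: "g \<in> chart_grp (chart x e)"
    from f obtain s k where f': "f = restrict (aff n s k) ?C" "(s, k) \<in> G" "aff n s k x = x"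
      by (auto simp: mem_chart_grp)
    from g obtain s' k' where g': "g = restrict (aff n s' k') ?C" "(s', k') \<in> G" "aff n s' k' x = x"
      by (auto simp: mem_chart_grp)
    have "f \<otimes>\<^bsub>BijGroup ?C\<^esub> g = compose ?C f g"
      using Bij f' g' by (simp add: BijGroup_def)
    also have "\<dots> = restrict (aff n (\<lambda>i. s i * s' i) (\<lambda>i. s i * k' i + k i)) ?C"
    proof
      fix z
      show "compose ?C f g z = restrict (aff n (\<lambda>i. s i * s' i) (\<lambda>i. s i * k' i + k i)) ?C z"
      proof (cases "z \<in> ?C")
        case True
        then have "aff n s' k' z \<in> ?C" using image[OF g'(2,3)] by blast
        then show ?thesis using True by (simp add: compose_def f'(1) g'(1) aff_aff)
      qed (simp add: compose_def)
    qed
    also have "\<dots> \<in> chart_grp (chart x e)"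
      unfolding mem_chart_grp using G_comp[OF f'(2) g'(2)] f'(3) g'(3) aff_aff[of n s k s' k' x]
      by metis
    finally show "f \<otimes>\<^bsub>BijGroup ?C\<^esub> g \<in> chart_grp (chart x e)" .
  next
    have "\<one>\<^bsub>BijGroup ?C\<^esub> = restrict (aff n (\<lambda>_. 1) (\<lambda>_. 0)) ?C"
      unfolding BijGroup_def monoid.simps
      by (rule restrict_ext) (use CE aff_trivial in auto)
    then show "\<one>\<^bsub>BijGroup ?C\<^esub> \<in> chart_grp (chart x e)"
      unfolding mem_chart_grp using G_trivial aff_trivial[OF assms] by metis
  next
    fix f assume "f \<in> chart_grp (chart x e)"
    then obtain s k where f: "f = restrict (aff n s k) ?C" "(s, k) \<in> G" "aff n s k x = x"
      by (auto simp: mem_chart_grp)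
    let ?k = "\<lambda>i. - (s i * k i)"
    have "inv\<^bsub>BijGroup ?C\<^esub> f = restrict (inv_into ?C f) ?C"
      using inv_BijGroup Bij[OF f(2,3)] f(1) by blast
    also have "\<dots> = restrict (aff n s ?k) ?C"
    proof (rule restrict_ext)
      fix z assume z: "z \<in> ?C"
      then obtain y where y: "y \<in> ?C" "z = aff n s k y" using image[OF f(2,3)] by blast
      have "inj_on f ?C" using Bij[OF f(2,3)] f(1) by (simp add: Bij_def bij_betw_def)
      moreover have "z = f y" using y f(1) by simp
      ultimately have "inv_into ?C f z = y" using y(1) by simp
      then show "inv_into ?C f z = aff n s ?k z"
        using aff_inverse(1)[OF G_sgn[OF f(2)], of y n k] y CE by auto
    qed
    also have "\<dots> \<in> chart_grp (chart x e)"
      unfolding mem_chart_grp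
      using G_inv[OF f(2)] aff_inverse(1)[OF G_sgn[OF f(2)] assms, of k] f(3) by metis
    finally show "inv\<^bsub>BijGroup ?C\<^esub> f \<in> chart_grp (chart x e)" .
  qed
qed

text \<open>An element fixing x has translation x - s x in the first n coordinates, so it is
  determined by s, for which there are at most two choices.\<close>

lemma finite_chart_grp: "finite (chart_grp (chart x e))"
proof (rule finite_subset)
  show "chart_grp (chart x e) \<subseteq>
      (\<lambda>s. restrict (aff n s (\<lambda>i. x i - s i * x i)) (cube n x e)) ` {\<lambda>_. 1, \<sigma>}"
  proof
    fix f assume "f \<in> chart_grp (chart x e)"
    then obtain s k where f: "f = restrict (aff n s k) (cube n x e)" "(s, k) \<in> G" "aff n s k x = x"
      by (auto simp: mem_chart_grp)
    have "k i = x i - s i * x i" if "i < n" for i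
      using fun_cong[OF f(3), of i] that by (simp add: aff_def)
    then have "aff n s k = aff n s (\<lambda>i. x i - s i * x i)"
      by (simp add: aff_def fun_eq_iff)
    moreover have "s \<in> {\<lambda>_. 1, \<sigma>}" using f(2) by (auto simp: G_def)
    ultimately show "f \<in> (\<lambda>s. restrict (aff n s (\<lambda>i. x i - s i * x i)) (cube n x e)) ` {\<lambda>_. 1, \<sigma>}"
      using f(1) by (intro image_eqI[of _ _ s]) simp_all
  qed
qed simp

lemma quotient_map_orb:
  assumes U: "openin (Euclidean_space n) U"
  shows "quotient_map (subtopology (Euclidean_space n) U) (subtopology qtop (orb ` U)) orb"
proof (rule continuous_open_imp_quotient_map)
  have UE: "U \<subseteq> E" using U openin_subset by blast
  show "continuous_map (subtopology (Euclidean_space n) U) (subtopology qtop (orb ` U)) orb"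
    unfolding continuous_map_in_subtopology using continuous_map_orb
    by (auto intro: continuous_map_from_subtopology)
  show "open_map (subtopology (Euclidean_space n) U) (subtopology qtop (orb ` U)) orb"
    unfolding open_map_def
  proof (intro allI impI)
    fix W assume "openin (subtopology (Euclidean_space n) U) W"
    then have "openin (Euclidean_space n) W" "W \<subseteq> U" using U by (simp_all add: openin_open_subtopology)
    then show "openin (subtopology qtop (orb ` U)) (orb ` W)"
      using openin_orb_image U by (simp add: openin_open_subtopology image_mono)
  qed
  show "orb ` topspace (subtopology (Euclidean_space n) U) = topspace (subtopology qtop (orb ` U))"
    using UE by (simp add: topspace_qtop Int_absorb1 image_mono)
qed

lemma riemannian_orbi_chart_atlas:
  assumes "c \<in> atlas" shows "riemannian_orbi_chart n qtop c"
proof -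
  obtain x e where c: "c = chart x e" "x \<in> E" "0 < e"
    "\<And>s k. (s, k) \<in> G \<Longrightarrow> aff n s k x \<in> cube n x (2 * e) \<Longrightarrow> aff n s k x = x"
    using atlasE[OF assms] by metis
  let ?C = "cube n x e"
  have CE: "?C \<subseteq> E" by (rule cube_subset_topspace)
  show ?thesis
    unfolding riemannian_orbi_chart_def c(1) chart_simps
  proof (intro conjI ballI)
    fix \<gamma> assume "\<gamma> \<in> chart_grp (chart x e)"
    then obtain s k where g: "\<gamma> = restrict (aff n s k) ?C" "(s, k) \<in> G" "aff n s k x = x"
      by (auto simp: mem_chart_grp)
    show "isometric_diffeo n ?C flat ?C flat \<gamma>"
    proof (rule isometric_diffeo_aff[OF G_sgn[OF g(2)] openin_cube])
      show "aff n s k ` ?C = ?C" using aff_image_cube[OF G_sgn[OF g(2)] c(2), of k e] g(3) by simp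
      show "\<gamma> z = aff n s k z" if "z \<in> ?C" for z using g(1) that by simp
    qed
  next
    fix y z assume y: "y \<in> ?C" and z: "z \<in> ?C"
    have yz: "y \<in> E" "z \<in> E" using y z CE by blast+
    show "orb y = orb z \<longleftrightarrow> (\<exists>\<gamma>\<in>chart_grp (chart x e). \<gamma> y = z)"
    proof
      assume "orb y = orb z"
      then obtain s k where sk: "(s, k) \<in> G" "aff n s k y = z" using orb_eq_iff[OF yz] by metis
      \<comment> \<open>Both the image of the centre and the centre itself lie within e of z; this
        is the source of the factor 2 in \<open>atlas\<close>.\<close>
      have "\<bar>aff n s k x i - x i\<bar> < 2 * e" if "i < n" for i
      proof -
        have "z \<in> cube n (aff n s k x) e" using aff_in_cube[OF G_sgn[OF sk(1)] y, of k] sk(2) by simp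
        then have "\<bar>z i - aff n s k x i\<bar> < e" "\<bar>z i - x i\<bar> < e" using z that unfolding cube_def by blast+
        then show ?thesis by linarith
      qed
      then have "aff n s k x \<in> cube n x (2 * e)" by (simp add: cube_def aff_def)
      then have "aff n s k x = x" by (rule c(4)[OF sk(1)])
      then have "restrict (aff n s k) ?C \<in> chart_grp (chart x e)"
        unfolding mem_chart_grp using sk(1) by metis
      then show "\<exists>\<gamma>\<in>chart_grp (chart x e). \<gamma> y = z" using sk(2) y by (metis restrict_apply')
    next
      assume "\<exists>\<gamma>\<in>chart_grp (chart x e). \<gamma> y = z"
      then obtain s k where "(s, k) \<in> G" "aff n s k y = z" using y by (auto simp: mem_chart_grp)
      then show "orb y = orb z" using orb_eq_iff[OF yz] by metis
    qed
  qed (simp_all add: openin_cube connectedin_cube riemannian_metric_on_flat finite_chart_grp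
      subgroup_chart_grp[OF c(2)] openin_orb_image quotient_map_orb)
qed

lemma ex_chart_change:
  assumes c: "c \<in> atlas" and d: "d \<in> atlas" and sk: "(s, k) \<in> G"
    and x: "x \<in> chart_dom c" "aff n s k x \<in> chart_dom d"
  shows "\<exists>e>0. chart_change n c d (cube n x e) (aff n s k)"
proof -
  have xE: "x \<in> E" using x(1) chart_dom_subset[OF c] by blast
  obtain e1 where e1: "e1 > 0" "cube n x e1 \<subseteq> chart_dom c"
    using openin_chart_dom[OF c] x(1) unfolding openin_Euclidean_space_iff by blast
  obtain e2 where e2: "e2 > 0" "cube n (aff n s k x) e2 \<subseteq> chart_dom d"
    using openin_chart_dom[OF d] x(2) unfolding openin_Euclidean_space_iff by blast
  let ?e = "min e1 e2"
  have "chart_change n c d (cube n x ?e) (aff n s k)"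
  proof (rule chart_change_aff[OF c d sk openin_cube])
    show "cube n x ?e \<subseteq> chart_dom c" using e1(2) cube_mono[of ?e e1 n x] by simp
    show "aff n s k ` cube n x ?e \<subseteq> chart_dom d"
      unfolding aff_image_cube[OF G_sgn[OF sk] xE] using e2(2) cube_mono[of ?e e2 n "aff n s k x"] by simp
  qed
  then show ?thesis using e1(1) e2(1) by (intro exI[of _ ?e]) simp
qed

lemma riemannian_orbifold_atlas: "riemannian_orbifold n qtop atlas"
  unfolding riemannian_orbifold_def
proof (intro conjI ballI impI)
  show "topspace qtop = (\<Union>c\<in>atlas. chart_map c ` chart_dom c)"
  proof
    show "topspace qtop \<subseteq> (\<Union>c\<in>atlas. chart_map c ` chart_dom c)"
    proof
      fix p assume "p \<in> topspace qtop"
      then obtain x where x: "x \<in> E" "p = orb x" unfolding topspace_qtop by blast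
      obtain e where e: "e > 0" "chart x e \<in> atlas" using ex_chart[OF x(1)] by blast
      have "x \<in> cube n x e" by (rule centre_in_cube[OF x(1) e(1)])
      then have "p \<in> chart_map (chart x e) ` chart_dom (chart x e)" using x(2) by simp
      then show "p \<in> (\<Union>c\<in>atlas. chart_map c ` chart_dom c)" using e(2) by (rule UN_I[rotated])
    qed
    show "(\<Union>c\<in>atlas. chart_map c ` chart_dom c) \<subseteq> topspace qtop"
    proof (rule UN_least)
      fix c assume "c \<in> atlas"
      then show "chart_map c ` chart_dom c \<subseteq> topspace qtop"
        unfolding chart_map_atlas[OF \<open>c \<in> atlas\<close>] topspace_qtop
        by (intro image_mono chart_dom_subset)
    qed
  qed
next
  fix c d x y assume c: "c \<in> atlas" and d: "d \<in> atlas" and x: "x \<in> chart_dom c" and y: "y \<in> chart_dom d"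
    and eq: "chart_map c x = chart_map d y"
  have xy: "x \<in> E" "y \<in> E" using x y chart_dom_subset c d by blast+
  have "orb x = orb y" using eq chart_map_atlas c d by simp
  then obtain s k where sk: "(s, k) \<in> G" "aff n s k x = y" using orb_eq_iff[OF xy] by metis
  then obtain e where "e > 0" "chart_change n c d (cube n x e) (aff n s k)"
    using ex_chart_change[OF c d sk(1) x] y by blast
  then show "\<exists>V h. chart_change n c d V h \<and> x \<in> V \<and> h x = y"
    using sk(2) centre_in_cube[OF xy(1)] by blast
qed (simp_all add: Hausdorff_qtop second_countable_qtop riemannian_orbi_chart_atlas)

lemma compact_riemannian_orbifold_atlas: "compact_riemannian_orbifold n qtop atlas"
  by (simp add: compact_riemannian_orbifold_def riemannian_orbifold_atlas compact_qtop)

text \<open>In coordinate i every element over the involution is a translation by a non-integer, so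
  none has a fixed point and all isotropy groups are trivial.\<close>

lemma closed_riemannian_manifold_atlas:
  assumes i: "i < n" "\<sigma> i = 1" "\<kappa> i \<notin> \<int>"
  shows "closed_riemannian_manifold n qtop atlas"
  unfolding closed_riemannian_manifold_def
proof (intro conjI ballI)
  fix c assume "c \<in> atlas"
  then obtain x e where c: "c = chart x e" "x \<in> E" by (metis atlasE)
  have "aff n s k = aff n (\<lambda>_. 1) (\<lambda>_. 0)" if sk: "(s, k) \<in> G" "aff n s k x = x" for s k
  proof -
    have fixed: "s j * x j + k j = x j" if "j < n" for j
      using fun_cong[OF sk(2), of j] that by (simp add: aff_def)
    have "s = (\<lambda>_. 1)"
    proof (rule ccontr)
      assume "s \<noteq> (\<lambda>_. 1)"
      then have "s = \<sigma>" "k i - \<kappa> i \<in> \<int>" using sk(1) by (auto simp: G_def)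
      \<comment> \<open>A fixed point forces zero translation in coordinate i, whereas k i is
        congruent to \<kappa> i modulo the integers.\<close>
      moreover have "k i = 0" using fixed[OF i(1)] i(2) \<open>s = \<sigma>\<close> by simp
      ultimately show False using i(3) by simp
    qed
    then show ?thesis using fixed by (simp add: aff_def fun_eq_iff)
  qed
  then have "chart_grp c \<subseteq> {restrict (aff n (\<lambda>_. 1) (\<lambda>_. 0)) (cube n x e)}"
    unfolding c(1) by (auto simp: mem_chart_grp)
  moreover have "restrict (aff n (\<lambda>_. 1) (\<lambda>_. 0)) (cube n x e) \<in> chart_grp c"
    unfolding c(1) mem_chart_grp using G_trivial aff_trivial[OF c(2)] by metis
  moreover have "restrict (aff n (\<lambda>_. 1) (\<lambda>_. 0)) (cube n x e) = \<one>\<^bsub>BijGroup (chart_dom c)\<^esub>"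
    unfolding BijGroup_def monoid.simps c(1) chart_simps
    by (rule restrict_ext) (use aff_trivial cube_subset_topspace in blast)
  ultimately show "chart_grp c = {\<one>\<^bsub>BijGroup (chart_dom c)\<^esub>}" by auto
qed (simp_all add: riemannian_orbifold_atlas compact_qtop)

end

section \<open>Hodge theory of the flat metric\<close>

lemma finite_multi_idx: "finite (multi_idx n p)"
proof -
  have "multi_idx n p = {I. set I \<subseteq> {..<n} \<and> length I = p}" by (auto simp: multi_idx_def)
  then show ?thesis by (simp add: finite_lists_length_eq)
qed

lemma nth_multi_idx: "I \<in> multi_idx n p \<Longrightarrow> k < p \<Longrightarrow> I ! k < n"
  by (auto simp: multi_idx_def subset_iff)

lemma length_multi_idx: "I \<in> multi_idx n p \<Longrightarrow> length I = p"
  by (simp add: multi_idx_def)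

lemma multi_idx_remove:
  assumes "I \<in> multi_idx n (Suc p)" "k < Suc p"
  shows "take k I @ drop (Suc k) I \<in> multi_idx n p"
  using assms by (auto simp: multi_idx_def dest: in_set_takeD in_set_dropD)

text \<open>The definite description asks for uniqueness at all pairs of indices; the prescribed
  zeros outside the n by n block provide it there.\<close>

lemma mat_inverse_flat:
  "mat_inverse n (flat x) = (\<lambda>i j. if i < n \<and> j < n \<and> i = j then 1 else 0)"
  unfolding mat_inverse_def
proof (rule the_equality)
  have "(\<Sum>k<n. flat x i k * (if k < n \<and> j < n \<and> k = j then 1 else 0)) = (if i = j then 1 else 0)"
    if "i < n" "j < n" for i j
  proof -
    have "(\<Sum>k<n. flat x i k * (if k < n \<and> j < n \<and> k = j then 1 else 0)) =
        (\<Sum>k<n. if k = j then flat x i j else 0)"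
      by (rule sum.cong) (use that in auto)
    then show ?thesis using that by (simp add: flat_def)
  qed
  then show "(\<forall>i j. \<not> (i < n \<and> j < n) \<longrightarrow> (if i < n \<and> j < n \<and> i = j then 1 else (0::real)) = 0) \<and>
    (\<forall>i<n. \<forall>j<n. (\<Sum>k<n. flat x i k * (if k < n \<and> j < n \<and> k = j then 1 else 0)) = (if i = j then 1 else 0))"
    by simp
next
  fix H :: "nat \<Rightarrow> nat \<Rightarrow> real"
  assume H: "(\<forall>i j. \<not> (i < n \<and> j < n) \<longrightarrow> H i j = 0) \<and>
    (\<forall>i<n. \<forall>j<n. (\<Sum>k<n. flat x i k * H k j) = (if i = j then 1 else 0))"
  have "H i j = (if i < n \<and> j < n \<and> i = j then 1 else 0)" for i j
  proof (cases "i < n \<and> j < n")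
    case True
    have "(\<Sum>k<n. flat x i k * H k j) = (\<Sum>k<n. if k = i then H i j else 0)"
      by (rule sum.cong) (auto simp: flat_def)
    also have "\<dots> = H i j" using True by simp
    finally have "(\<Sum>k<n. flat x i k * H k j) = H i j" .
    moreover have "(\<Sum>k<n. flat x i k * H k j) = (if i = j then 1 else 0)" using H True by blast
    ultimately show ?thesis using True by simp
  next
    case False
    then have "H i j = 0" using H by blast
    then show ?thesis using False by auto
  qed
  then show "H = (\<lambda>i j. if i < n \<and> j < n \<and> i = j then 1 else 0)" by (simp add: fun_eq_iff)
qed

text \<open>A permutation other than the identity moves some index and so contributes an
  off-diagonal zero.\<close>

lemma mat_det_flat: "mat_det n (flat x) = 1"
proof -
  let ?P = "{p. p permutes {..<n}}"
  have "(\<Prod>i<n. flat x i (p i)) = (if p = id then 1 else 0)" if p: "p permutes {..<n}" for p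
  proof (cases "p = id")
    case False
    then obtain i where i: "p i \<noteq> i" by (auto simp: fun_eq_iff)
    then have "i < n" using permutes_not_in[OF p, of i] by auto
    then have "(\<Prod>i<n. flat x i (p i)) = 0"
      by (intro prod_zero bexI[of _ i]) (use i in \<open>auto simp: flat_def\<close>)
    then show ?thesis using False by simp
  qed (simp add: flat_def)
  then have "mat_det n (flat x) = (\<Sum>p\<in>?P. if p = id then 1 else 0)"
    unfolding mat_det_def by (intro sum.cong) (auto simp: sign_id)
  also have "\<dots> = 1" using permutes_id[of "{..<n}"] by (simp add: finite_permutations sum.delta)
  finally show ?thesis .
qed

lemma raise_idx_flat:
  assumes I: "I \<in> multi_idx n p" shows "raise_idx n flat \<omega> x I = \<omega> x I"
proof -
  have len: "length I = p" using I by (rule length_multi_idx)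
  have "(\<Prod>k<p. mat_inverse n (flat x) (I ! k) (J ! k)) = (if J = I then 1 else 0)"
    if J: "J \<in> multi_idx n p" for J
  proof (cases "J = I")
    case True
    then show ?thesis using nth_multi_idx[OF I] by (simp add: mat_inverse_flat)
  next
    case False
    then obtain k where k: "k < p" "I ! k \<noteq> J ! k"
      using nth_equalityI[of J I] len length_multi_idx[OF J] by metis
    then have "(\<Prod>k<p. mat_inverse n (flat x) (I ! k) (J ! k)) = 0"
      by (intro prod_zero bexI[of _ k]) (auto simp: mat_inverse_flat)
    then show ?thesis using False by simp
  qed
  then have "raise_idx n flat \<omega> x I = (\<Sum>J\<in>multi_idx n p. if J = I then \<omega> x I else 0)"
    unfolding raise_idx_def len by (intro sum.cong) auto
  then show ?thesis using I by (simp add: finite_multi_idx)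
qed

lemma hodge_star_flat:
  "hodge_star n flat p \<omega> x J = (\<Sum>I\<in>multi_idx n p. levi_civita n (I @ J) * \<omega> x I) / fact p"
  by (simp add: hodge_star_def mat_det_flat raise_idx_flat cong: sum.cong)

section \<open>Linear combinations, pullback, star and exterior derivative of component
  families\<close>

definition smooth_comps :: "nat \<Rightarrow> nat \<Rightarrow> (nat \<Rightarrow> real) set \<Rightarrow> local_form \<Rightarrow> bool" where
  "smooth_comps n p U \<omega> \<longleftrightarrow> (\<forall>I\<in>multi_idx n p. smooth_on n U (\<lambda>x. \<omega> x I))"

text \<open>Forms are functions on all points and all lists, but the operators are controlled only
  over U and at proper multi-indices. This relation replaces equality.\<close>

definition agree :: "nat \<Rightarrow> nat \<Rightarrow> (nat \<Rightarrow> real) set \<Rightarrow> local_form \<Rightarrow> local_form \<Rightarrow> bool" where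
  "agree n p U \<omega> \<eta> \<longleftrightarrow> (\<forall>x\<in>U. \<forall>I\<in>multi_idx n p. \<omega> x I = \<eta> x I)"

lemma agreeI: "(\<And>x I. x \<in> U \<Longrightarrow> I \<in> multi_idx n p \<Longrightarrow> \<omega> x I = \<eta> x I) \<Longrightarrow> agree n p U \<omega> \<eta>"
  by (simp add: agree_def)

lemma agreeD: "agree n p U \<omega> \<eta> \<Longrightarrow> x \<in> U \<Longrightarrow> I \<in> multi_idx n p \<Longrightarrow> \<omega> x I = \<eta> x I"
  by (simp add: agree_def)

lemma agree_trans [trans]: "agree n p U \<omega> \<eta> \<Longrightarrow> agree n p U \<eta> \<zeta> \<Longrightarrow> agree n p U \<omega> \<zeta>"
  by (simp add: agree_def)

text \<open>Also used for scalar multiples, with second coefficient 0 and an arbitrary second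
  form.\<close>

definition lin :: "real \<Rightarrow> local_form \<Rightarrow> real \<Rightarrow> local_form \<Rightarrow> local_form" where
  "lin a \<omega> b \<eta> = (\<lambda>x I. a * \<omega> x I + b * \<eta> x I)"

text \<open>The pullback by \<open>aff n s k\<close>: its Jacobian is diagonal, so each component is
  only multiplied by the signs of its indices. The link to \<open>pullback\<close> is
  \<open>pullback_aff\<close>.\<close>

definition twist :: "nat \<Rightarrow> (nat \<Rightarrow> real) \<Rightarrow> (nat \<Rightarrow> real) \<Rightarrow> local_form \<Rightarrow> local_form" where
  "twist n s k \<omega> = (\<lambda>x I. prod_list (map s I) * \<omega> (aff n s k x) I)"

abbreviation star :: "nat \<Rightarrow> nat \<Rightarrow> local_form \<Rightarrow> local_form" where
  "star n p \<equiv> hodge_star n flat p"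

lemma star_cong:
  assumes "agree n p U \<omega> \<eta>" "x \<in> U" shows "star n p \<omega> x J = star n p \<eta> x J"
  unfolding hodge_star_flat using agreeD[OF assms] by (simp cong: sum.cong)

lemma star_lin: "star n p (lin a \<omega> b \<eta>) = lin a (star n p \<omega>) b (star n p \<eta>)"
  by (simp add: hodge_star_flat lin_def fun_eq_iff sum.distrib algebra_simps sum_distrib_left
      add_divide_distrib sum_divide_distrib)

lemma smooth_comps_star:
  assumes "openin (Euclidean_space n) U" "smooth_comps n p U \<omega>"
  shows "smooth_comps n q U (star n p \<omega>)"
  unfolding smooth_comps_def
proof
  fix J assume "J \<in> multi_idx n q"
  have "smooth_on n U (\<lambda>x. \<Sum>I\<in>multi_idx n p. (levi_civita n (I @ J) / fact p) * \<omega> x I)"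
    by (rule smooth_on_sum[OF assms(1) finite_multi_idx], rule smooth_on_cmult[OF assms(1)])
       (use assms(2) in \<open>simp add: smooth_comps_def\<close>)
  then show "smooth_on n U (\<lambda>x. star n p \<omega> x J)"
    by (simp add: hodge_star_flat sum_divide_distrib)
qed

lemma prod_list_sgn_square:
  assumes "\<forall>i. s i = 1 \<or> s i = (-1::real)" shows "prod_list (map s I) * prod_list (map s I) = 1"
proof (induction I)
  case (Cons i I)
  have "s i * s i = 1" using spec[OF assms, of i] by auto
  have "prod_list (map s (i # I)) * prod_list (map s (i # I)) =
      (s i * s i) * (prod_list (map s I) * prod_list (map s I))"
    by (simp add: mult_ac)
  then show ?case using Cons \<open>s i * s i = 1\<close> by simp
qed simp

text \<open>The symbol is supported on arrangements of 0, ..., n-1, so the product meets every index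
  exactly once.\<close>

lemma levi_civita_prod_list:
  assumes "levi_civita n I \<noteq> 0" shows "prod_list (map s I) = (\<Prod>i<n. s i :: real)"
proof -
  have I: "I \<in> multi_idx n n" "distinct I" using assms by (auto simp: levi_civita_def split: if_splits)
  have "set I = {..<n}"
    by (rule card_subset_eq) (use I in \<open>auto simp: multi_idx_def distinct_card\<close>)
  then show ?thesis using prod.distinct_set_conv_list[OF I(2), of s] by simp
qed

text \<open>The map changes the volume form by its determinant. In components: where the symbol is
  nonzero, the signs over I times those over J give the determinant, and signs can be moved across
  because they square to one.\<close>

lemma star_twist:
  assumes s: "\<forall>i. s i = 1 \<or> s i = -1"
  shows "star n p (twist n s k \<omega>) = lin (\<Prod>i<n. s i) (twist n s k (star n p \<omega>)) 0 \<omega>"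
proof (intro ext)
  fix x J
  let ?d = "\<Prod>i<n. s i"
  have *: "levi_civita n (I @ J) * (prod_list (map s I) * \<omega> (aff n s k x) I) =
      ?d * prod_list (map s J) * (levi_civita n (I @ J) * \<omega> (aff n s k x) I)" for I
  proof (cases "levi_civita n (I @ J) = 0")
    case False
    then have "?d = prod_list (map s I) * prod_list (map s J)"
      using levi_civita_prod_list[of n "I @ J" s] by simp
    then have "?d * prod_list (map s J) = prod_list (map s I) * (prod_list (map s J) * prod_list (map s J))"
      by simp
    then have "?d * prod_list (map s J) = prod_list (map s I)"
      using prod_list_sgn_square[OF s, of J] by simp
    then show ?thesis by (simp add: mult_ac)
  qed simp
  have "(\<Sum>I\<in>multi_idx n p. levi_civita n (I @ J) * (prod_list (map s I) * \<omega> (aff n s k x) I)) =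
      ?d * prod_list (map s J) * (\<Sum>I\<in>multi_idx n p. levi_civita n (I @ J) * \<omega> (aff n s k x) I)"
    by (simp only: sum_distrib_left *)
  then show "star n p (twist n s k \<omega>) x J = lin ?d (twist n s k (star n p \<omega>)) 0 \<omega> x J"
    by (simp add: hodge_star_flat twist_def lin_def)
qed

lemma smooth_comps_lin:
  assumes "openin (Euclidean_space n) U" "smooth_comps n p U \<omega>" "smooth_comps n p U \<eta>"
  shows "smooth_comps n p U (lin a \<omega> b \<eta>)"
  unfolding smooth_comps_def lin_def
proof
  fix I assume I: "I \<in> multi_idx n p"
  show "smooth_on n U (\<lambda>x. a * \<omega> x I + b * \<eta> x I)"
    by (rule smooth_on_add[OF assms(1)]; rule smooth_on_cmult[OF assms(1)])
       (use assms(2,3) I in \<open>simp_all add: smooth_comps_def\<close>)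
qed

lemma smooth_comps_twist:
  assumes "smooth_comps n p (topspace (Euclidean_space n)) \<omega>"
  shows "smooth_comps n p (topspace (Euclidean_space n)) (twist n s k \<omega>)"
  unfolding smooth_comps_def twist_def
proof
  fix I assume I: "I \<in> multi_idx n p"
  show "smooth_on n (topspace (Euclidean_space n)) (\<lambda>x. prod_list (map s I) * \<omega> (aff n s k x) I)"
    by (rule smooth_on_cmult[OF openin_topspace], rule smooth_on_comp_aff[OF openin_topspace aff_in_topspace])
       (use assms I in \<open>simp add: smooth_comps_def\<close>)
qed

lemma ext_d_cong:
  assumes U: "openin (Euclidean_space n) U" and "agree n p U \<omega> \<eta>"
  shows "agree n (Suc p) U (ext_d \<omega>) (ext_d \<eta>)"
proof (rule agreeI)
  fix x I assume x: "x \<in> U" and I: "I \<in> multi_idx n (Suc p)"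
  show "ext_d \<omega> x I = ext_d \<eta> x I"
    unfolding ext_d_def length_multi_idx[OF I]
  proof (rule sum.cong)
    fix k assume k: "k \<in> {..<Suc p}"
    have "pd (I ! k) (\<lambda>y. \<omega> y (take k I @ drop (Suc k) I)) x = pd (I ! k) (\<lambda>y. \<eta> y (take k I @ drop (Suc k) I)) x"
      by (rule pd_cong[OF U x]) (use k nth_multi_idx[OF I] multi_idx_remove[OF I] agreeD[OF assms(2)] in auto)
    then show "(- 1) ^ k * pd (I ! k) (\<lambda>y. \<omega> y (take k I @ drop (Suc k) I)) x =
        (- 1) ^ k * pd (I ! k) (\<lambda>y. \<eta> y (take k I @ drop (Suc k) I)) x" by simp
  qed simp
qed

lemma smooth_comps_ext_d:
  assumes U: "openin (Euclidean_space n) U" and "smooth_comps n p U \<omega>"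
  shows "smooth_comps n (Suc p) U (ext_d \<omega>)"
  unfolding smooth_comps_def
proof
  fix I assume I: "I \<in> multi_idx n (Suc p)"
  show "smooth_on n U (\<lambda>x. ext_d \<omega> x I)"
    unfolding ext_d_def length_multi_idx[OF I]
  proof (rule smooth_on_sum[OF U], simp, rule smooth_on_cmult[OF U], rule smooth_on_pd)
    fix k assume k: "k \<in> {..<Suc p}"
    show "smooth_on n U (\<lambda>y. \<omega> y (take k I @ drop (Suc k) I))"
      using assms(2) multi_idx_remove[OF I] k by (simp add: smooth_comps_def)
    show "I ! k < n" using nth_multi_idx[OF I] k by simp
  qed
qed

lemma smooth_comps_differentiable:
  assumes "smooth_comps n p U \<omega>" "I \<in> multi_idx n (Suc p)" "k < Suc p" "x \<in> U"
  shows "(\<lambda>t. \<omega> (x(I ! k := t)) (take k I @ drop (Suc k) I)) differentiable (at (x (I ! k)))"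
proof (rule smooth_on_differentiable[OF _ _ assms(4)])
  show "smooth_on n U (\<lambda>y. \<omega> y (take k I @ drop (Suc k) I))"
    using assms(1) multi_idx_remove[OF assms(2,3)] by (simp add: smooth_comps_def)
  show "I ! k < n" by (rule nth_multi_idx[OF assms(2,3)])
qed

lemma ext_d_lin:
  assumes "smooth_comps n p U \<omega>" "smooth_comps n p U \<eta>"
  shows "agree n (Suc p) U (ext_d (lin a \<omega> b \<eta>)) (lin a (ext_d \<omega>) b (ext_d \<eta>))"
proof (rule agreeI)
  fix x I assume x: "x \<in> U" and I: "I \<in> multi_idx n (Suc p)"
  have "pd (I ! k) (\<lambda>y. a * \<omega> y (take k I @ drop (Suc k) I) + b * \<eta> y (take k I @ drop (Suc k) I)) x =
      a * pd (I ! k) (\<lambda>y. \<omega> y (take k I @ drop (Suc k) I)) x +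
      b * pd (I ! k) (\<lambda>y. \<eta> y (take k I @ drop (Suc k) I)) x" if k: "k < Suc p" for k
  proof -
    have 1: "(\<lambda>t. \<omega> (x(I ! k := t)) (take k I @ drop (Suc k) I)) differentiable (at (x (I ! k)))"
      by (rule smooth_comps_differentiable[OF assms(1) I k x])
    have 2: "(\<lambda>t. \<eta> (x(I ! k := t)) (take k I @ drop (Suc k) I)) differentiable (at (x (I ! k)))"
      by (rule smooth_comps_differentiable[OF assms(2) I k x])
    have 3: "(\<lambda>t. c * f t) differentiable (at z)" if "f differentiable (at z)" for c z and f :: "real \<Rightarrow> real"
      using that by (intro differentiable_mult differentiable_const)
    show ?thesis
      by (subst pd_add) (use 3[OF 1] 3[OF 2] in \<open>simp_all add: pd_cmult[OF 1] pd_cmult[OF 2]\<close>)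
  qed
  then show "ext_d (lin a \<omega> b \<eta>) x I = lin a (ext_d \<omega>) b (ext_d \<eta>) x I"
    unfolding ext_d_def lin_def length_multi_idx[OF I]
    by (simp add: sum.distrib sum_distrib_left algebra_simps)
qed

text \<open>Differentiating in direction \<open>I ! l\<close> produces exactly the sign that is
  missing from the product over the remaining indices.\<close>

lemma ext_d_twist:
  assumes "smooth_comps n p (topspace (Euclidean_space n)) \<omega>"
  shows "agree n (Suc p) (topspace (Euclidean_space n)) (ext_d (twist n s k \<omega>)) (twist n s k (ext_d \<omega>))"
proof (rule agreeI)
  fix x I assume x: "x \<in> topspace (Euclidean_space n)" and I: "I \<in> multi_idx n (Suc p)"
  let ?r = "\<lambda>l. take l I @ drop (Suc l) I"
  have *: "pd (I ! l) (\<lambda>y. prod_list (map s (?r l)) * \<omega> (aff n s k y) (?r l)) x =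
      prod_list (map s I) * pd (I ! l) (\<lambda>y. \<omega> y (?r l)) (aff n s k x)" if l: "l < Suc p" for l
  proof -
    have n: "I ! l < n" by (rule nth_multi_idx[OF I l])
    have 1: "(\<lambda>t. \<omega> ((aff n s k x)(I ! l := t)) (?r l)) differentiable (at (aff n s k x (I ! l)))"
      by (rule smooth_comps_differentiable[OF assms I l aff_in_topspace])
    have 2: "(\<lambda>t. \<omega> (aff n s k (x(I ! l := t))) (?r l)) differentiable (at (x (I ! l)))"
      using DERIV_comp_aff[OF n, of "\<lambda>y. \<omega> y (?r l)", OF 1] unfolding real_differentiable_def by (rule exI)
    have "l < length I" using l length_multi_idx[OF I] by simp
    then have "I = take l I @ I ! l # drop (Suc l) I" by (rule id_take_nth_drop)
    then have "prod_list (map s I) = prod_list (map s (take l I @ I ! l # drop (Suc l) I))" by simp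
    then have 3: "prod_list (map s I) = prod_list (map s (?r l)) * s (I ! l)" by (simp add: mult_ac)
    show ?thesis
      using pd_cmult[of "\<lambda>y. \<omega> (aff n s k y) (?r l)", OF 2, of "prod_list (map s (?r l))"]
        pd_comp_aff[OF n, of "\<lambda>y. \<omega> y (?r l)", OF 1]
      unfolding 3 by (simp add: mult_ac)
  qed
  show "ext_d (twist n s k \<omega>) x I = twist n s k (ext_d \<omega>) x I"
    unfolding ext_d_def twist_def length_multi_idx[OF I] sum_distrib_left
  proof (rule sum.cong[OF refl])
    fix l assume "l \<in> {..<Suc p}"
    then have l: "l < Suc p" by simp
    show "(- 1) ^ l * pd (I ! l) (\<lambda>y. prod_list (map s (?r l)) * \<omega> (aff n s k y) (?r l)) x =
        prod_list (map s I) * ((- 1) ^ l * pd (I ! l) (\<lambda>y. \<omega> y (?r l)) (aff n s k x))"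
      unfolding *[OF l] by (rule mult.left_commute)
  qed
qed

section \<open>The Levi-Civita symbol and the star operator in dimension four\<close>

lemma levi_civita_swap:
  assumes "length I = n" "i < n" "j < n" "i \<noteq> j"
  shows "levi_civita n (I[i := I ! j, j := I ! i]) = - levi_civita n I"
proof -
  let ?I = "I[i := I ! j, j := I ! i]"
  have set: "set ?I = set I" using assms by (simp add: set_swap)
  have dist: "distinct ?I = distinct I" using assms by (simp add: distinct_swap)
  have mem: "?I \<in> multi_idx n n \<longleftrightarrow> I \<in> multi_idx n n" using set by (simp add: multi_idx_def)
  show ?thesis
  proof (cases "I \<in> multi_idx n n \<and> distinct I")
    case True
    let ?f = "\<lambda>k. if k < n then I ! k else k"
    have inj: "inj_on ?f {..<n}"
      using True assms(1) by (auto simp: inj_on_def nth_eq_iff_index_eq)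
    have "?f ` {..<n} \<subseteq> {..<n}" using nth_multi_idx True by auto
    then have "?f ` {..<n} = {..<n}" by (rule endo_inj_surj[OF finite_lessThan _ inj])
    then have "bij_betw ?f {..<n} {..<n}" using inj by (simp only: bij_betw_def simp_thms)
    then have "?f permutes {..<n}" by (rule bij_imp_permutes) simp
    then have f: "permutation ?f" by (auto simp: permutation_permutes)
    \<comment> \<open>Exchanging two entries of the list precomposes its permutation with a
      transposition, which reverses the sign.\<close>
    have "(\<lambda>k. if k < n then ?I ! k else k) = ?f \<circ> Transposition.transpose i j"
      using assms by (auto simp: fun_eq_iff transpose_def nth_list_update)
    then have "sign (\<lambda>k. if k < n then ?I ! k else k) = sign ?f * sign (Transposition.transpose i j)"
      using sign_compose[OF f permutation_swap_id] by simp
    then show ?thesis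
      using True dist mem assms(4) by (simp add: levi_civita_def sign_swap_id)
  next
    case False
    then have "levi_civita n ?I = 0" using dist mem by (simp add: levi_civita_def del: One_nat_def)
    moreover have "levi_civita n I = 0" using False by (simp add: levi_civita_def)
    ultimately show ?thesis by simp
  qed
qed

lemma levi_civita_4_swap:
  "levi_civita 4 [b, a, c, d] = - levi_civita 4 [a, b, c, d]"
  "levi_civita 4 [a, c, b, d] = - levi_civita 4 [a, b, c, d]"
  "levi_civita 4 [a, b, d, c] = - levi_civita 4 [a, b, c, d]"
  using levi_civita_swap[of "[a, b, c, d]" 4 0 1] levi_civita_swap[of "[a, b, c, d]" 4 1 2]
    levi_civita_swap[of "[a, b, c, d]" 4 2 3]
  by (simp_all add: numeral_2_eq_2 numeral_3_eq_3)

text \<open>The side conditions orient the exchanges: used as rewrite rules they sort the index list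
  and terminate.\<close>

lemma levi_civita_4_sort:
  "a < b \<Longrightarrow> levi_civita 4 [b, a, c, d] = - levi_civita 4 [a, b, c, d]"
  "b < c \<Longrightarrow> levi_civita 4 [a, c, b, d] = - levi_civita 4 [a, b, c, d]"
  "c < d \<Longrightarrow> levi_civita 4 [a, b, d, c] = - levi_civita 4 [a, b, c, d]"
  by (rule levi_civita_4_swap)+

lemma levi_civita_not_distinct: "\<not> distinct I \<Longrightarrow> levi_civita n I = 0"
  by (simp add: levi_civita_def)

lemma levi_civita_4_sorted: "levi_civita 4 [0, 1, 2, 3] = 1"
proof -
  have eq: "(\<lambda>k. if k < 4 then [0, 1, 2, 3] ! k else k) = (id :: nat \<Rightarrow> nat)"
    by (auto simp: fun_eq_iff less_Suc_eq numeral_eq_Suc)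
  have "[0, 1, 2, 3] \<in> multi_idx 4 4 \<and> distinct [0, 1, 2, 3 :: nat]" by (simp add: multi_idx_def)
  then show ?thesis unfolding levi_civita_def eq by (simp only: if_True simp_thms sign_id of_int_1)
qed

lemma multi_idx_2: "multi_idx n 2 = (\<lambda>(a, b). [a, b]) ` ({..<n} \<times> {..<n})"
proof (intro Set.set_eqI iffI)
  fix I assume I: "I \<in> multi_idx n 2"
  then obtain a b where "I = [a, b]" by (auto simp: multi_idx_def length_Suc_conv numeral_2_eq_2)
  then show "I \<in> (\<lambda>(a, b). [a, b]) ` ({..<n} \<times> {..<n})"
    using I by (auto simp: multi_idx_def)
qed (auto simp: multi_idx_def)

lemma sum_multi_idx_2: "(\<Sum>I\<in>multi_idx n 2. f I) = (\<Sum>a<n. \<Sum>b<n. f [a, b])"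
  unfolding multi_idx_2
  by (subst sum.reindex) (auto simp: inj_on_def sum.cartesian_product case_prod_unfold)

lemma star_4_2:
  "star 4 2 \<omega> x [c, d] = (\<Sum>a<4. \<Sum>b<4. levi_civita 4 [a, b, c, d] * \<omega> x [a, b]) / 2"
  by (simp add: hodge_star_flat sum_multi_idx_2)

lemma star_4_2_alternating: "star 4 2 \<omega> x [d, c] = - star 4 2 \<omega> x [c, d]"
  unfolding star_4_2 levi_civita_4_swap(3)[of _ _ d c] by (simp add: sum_negf)

text \<open>Of the sixteen terms only two survive, those whose summation indices are the complement
  of the given pair, in either order.\<close>

lemma star_4_2_values:
  "star 4 2 \<omega> x [0, 1] = (\<omega> x [2, 3] - \<omega> x [3, 2]) / 2"
  "star 4 2 \<omega> x [0, 2] = (\<omega> x [3, 1] - \<omega> x [1, 3]) / 2"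
  "star 4 2 \<omega> x [0, 3] = (\<omega> x [1, 2] - \<omega> x [2, 1]) / 2"
  "star 4 2 \<omega> x [1, 2] = (\<omega> x [0, 3] - \<omega> x [3, 0]) / 2"
  "star 4 2 \<omega> x [1, 3] = (\<omega> x [2, 0] - \<omega> x [0, 2]) / 2"
  "star 4 2 \<omega> x [2, 3] = (\<omega> x [0, 1] - \<omega> x [1, 0]) / 2"
proof -
  have sum4: "(\<Sum>a<4. f a) = f 0 + f 1 + f 2 + f (3::nat)" for f :: "nat \<Rightarrow> real"
    by (simp add: numeral_eq_Suc)
  note [simp] = levi_civita_not_distinct levi_civita_4_sort levi_civita_4_sorted[unfolded One_nat_def]
  show
    "star 4 2 \<omega> x [0, 1] = (\<omega> x [2, 3] - \<omega> x [3, 2]) / 2"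
    "star 4 2 \<omega> x [0, 2] = (\<omega> x [3, 1] - \<omega> x [1, 3]) / 2"
    "star 4 2 \<omega> x [0, 3] = (\<omega> x [1, 2] - \<omega> x [2, 1]) / 2"
    "star 4 2 \<omega> x [1, 2] = (\<omega> x [0, 3] - \<omega> x [3, 0]) / 2"
    "star 4 2 \<omega> x [1, 3] = (\<omega> x [2, 0] - \<omega> x [0, 2]) / 2"
    "star 4 2 \<omega> x [2, 3] = (\<omega> x [0, 1] - \<omega> x [1, 0]) / 2"
    unfolding star_4_2 sum4 by simp_all
qed

text \<open>The general sign is (-1)^(p(n-p)), which is +1 here. It is computed on the six
  increasing pairs, and alternation gives the other components; alternation of the given family is
  essential, since every value of star is alternating.\<close>

lemma star_star_4_2:
  assumes alt: "\<And>a b. a < 4 \<Longrightarrow> b < 4 \<Longrightarrow> \<omega> x [b, a] = - \<omega> x [a, b]" and I: "I \<in> multi_idx 4 2"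
  shows "star 4 2 (star 4 2 \<omega>) x I = \<omega> x I"
proof -
  have less: "star 4 2 (star 4 2 \<omega>) x [c, d] = \<omega> x [c, d]" if "c < d" "d < 4" for c d
  proof -
    have "c = 0 \<and> d = 1 \<or> c = 0 \<and> d = 2 \<or> c = 0 \<and> d = 3 \<or> c = 1 \<and> d = 2 \<or> c = 1 \<and> d = 3 \<or> c = 2 \<and> d = 3"
      using that by presburger
    moreover note star_4_2_alternating[of \<omega> x 3 2] star_4_2_alternating[of \<omega> x 3 1] star_4_2_alternating[of \<omega> x 2 1]
      star_4_2_alternating[of \<omega> x 3 0] star_4_2_alternating[of \<omega> x 2 0] star_4_2_alternating[of \<omega> x 1 0]
      alt[of 2 3] alt[of 1 3] alt[of 1 2] alt[of 0 3] alt[of 0 2] alt[of 0 1]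
    ultimately show ?thesis
      by (elim disjE conjE) (simp_all add: star_4_2_values[of "star 4 2 \<omega>"] star_4_2_values[of \<omega>] del: One_nat_def)
  qed
  obtain c d where cd: "I = [c, d]" "c < 4" "d < 4" using I unfolding multi_idx_2 by auto
  consider "c < d" | "c = d" | "d < c" by linarith
  then show ?thesis
  proof cases
    case 1
    then show ?thesis using less cd by simp
  next
    case 2
    have "star 4 2 (star 4 2 \<omega>) x [c, c] = 0" using star_4_2_alternating[of "star 4 2 \<omega>" x c c] by simp
    moreover have "\<omega> x [c, c] = 0" using alt[of c c] cd by simp
    ultimately show ?thesis using cd 2 by simp
  next
    case 3
    have "star 4 2 (star 4 2 \<omega>) x [c, d] = - star 4 2 (star 4 2 \<omega>) x [d, c]"
      by (rule star_4_2_alternating)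
    also have "\<dots> = - \<omega> x [d, c]" using less[OF 3 cd(2)] by simp
    also have "\<dots> = \<omega> x [c, d]" using alt[OF cd(3,2)] by simp
    finally show ?thesis using cd by simp
  qed
qed

definition alt2 :: "(nat \<Rightarrow> real) set \<Rightarrow> local_form \<Rightarrow> bool" where
  "alt2 U \<omega> \<longleftrightarrow> (\<forall>x\<in>U. \<forall>a<4. \<forall>b<4. \<omega> x [b, a] = - \<omega> x [a, b])"

lemma alt2D: "alt2 U \<omega> \<Longrightarrow> x \<in> U \<Longrightarrow> a < 4 \<Longrightarrow> b < 4 \<Longrightarrow> \<omega> x [b, a] = - \<omega> x [a, b]"
  unfolding alt2_def by blast

lemma star_star:
  assumes "alt2 U \<omega>" shows "agree 4 2 U (star 4 2 (star 4 2 \<omega>)) \<omega>"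
  by (rule agreeI, rule star_star_4_2) (rule alt2D[OF assms])

lemma alt2_star: "alt2 U (star 4 2 \<omega>)"
  unfolding alt2_def by (intro ballI allI impI star_4_2_alternating)

text \<open>At [a, b] the derivative is the difference of two terms that exchange places under
  swapping a and b.\<close>

lemma alt2_ext_d: "alt2 U (ext_d \<omega>)"
  by (simp add: alt2_def ext_d_def)

lemma alt2_lin:
  assumes "alt2 U \<omega>" "alt2 U \<eta>" shows "alt2 U (lin a \<omega> b \<eta>)"
  unfolding alt2_def lin_def
proof (intro ballI allI impI)
  fix x c d :: "nat \<Rightarrow> real" and i j :: nat assume "x \<in> U" "i < 4" "j < 4"
  from alt2D[OF assms(1) this] alt2D[OF assms(2) this]
  show "a * \<omega> x [j, i] + b * \<eta> x [j, i] = - (a * \<omega> x [i, j] + b * \<eta> x [i, j])"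
    by simp
qed

lemma alt2_twist:
  assumes "alt2 (topspace (Euclidean_space 4)) \<omega>"
  shows "alt2 (topspace (Euclidean_space 4)) (twist 4 s k \<omega>)"
  unfolding alt2_def twist_def
proof (intro ballI allI impI)
  fix x :: "nat \<Rightarrow> real" and i j :: nat assume "i < 4" "j < 4"
  from alt2D[OF assms aff_in_topspace this, of s k x]
  show "prod_list (map s [j, i]) * \<omega> (aff 4 s k x) [j, i] = - (prod_list (map s [i, j]) * \<omega> (aff 4 s k x) [i, j])"
    by simp
qed

section \<open>The flat Laplacian on two-forms and its symmetries\<close>

definition dsd :: "local_form \<Rightarrow> local_form" where
  "dsd \<omega> = ext_d (star 4 3 (ext_d \<omega>))"

abbreviation lap :: "local_form \<Rightarrow> local_form" where
  "lap \<equiv> hodge_laplacian 4 flat 2"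

lemma smooth_comps_d: "openin (Euclidean_space 4) U \<Longrightarrow> smooth_comps 4 2 U \<omega> \<Longrightarrow> smooth_comps 4 3 U (ext_d \<omega>)"
  "openin (Euclidean_space 4) U \<Longrightarrow> smooth_comps 4 1 U \<omega> \<Longrightarrow> smooth_comps 4 2 U (ext_d \<omega>)"
  using smooth_comps_ext_d[of 4 U 2 \<omega>] smooth_comps_ext_d[of 4 U 1 \<omega>] by (simp_all add: numeral_eq_Suc)

lemma agree_star: "agree n p U \<omega> \<eta> \<Longrightarrow> agree n q U (star n p \<omega>) (star n p \<eta>)"
  by (rule agreeI) (rule star_cong)

lemma dsd_cong:
  assumes U: "openin (Euclidean_space 4) U" and "agree 4 2 U \<omega> \<eta>"
  shows "agree 4 2 U (dsd \<omega>) (dsd \<eta>)"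
proof -
  have "agree 4 3 U (ext_d \<omega>) (ext_d \<eta>)" using ext_d_cong[OF assms] by (simp add: numeral_eq_Suc)
  then have "agree 4 1 U (star 4 3 (ext_d \<omega>)) (star 4 3 (ext_d \<eta>))" by (rule agree_star)
  from ext_d_cong[OF U this] show ?thesis by (simp add: dsd_def numeral_eq_Suc)
qed

lemma dsd_lin:
  assumes U: "openin (Euclidean_space 4) U" and s: "smooth_comps 4 2 U \<omega>" "smooth_comps 4 2 U \<eta>"
  shows "agree 4 2 U (dsd (lin a \<omega> b \<eta>)) (lin a (dsd \<omega>) b (dsd \<eta>))"
proof -
  have "agree 4 3 U (ext_d (lin a \<omega> b \<eta>)) (lin a (ext_d \<omega>) b (ext_d \<eta>))"
    using ext_d_lin[OF s] by (simp add: numeral_eq_Suc)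
  then have "agree 4 1 U (star 4 3 (ext_d (lin a \<omega> b \<eta>))) (lin a (star 4 3 (ext_d \<omega>)) b (star 4 3 (ext_d \<eta>)))"
    unfolding star_lin[symmetric] by (rule agree_star)
  from ext_d_cong[OF U this]
  have "agree 4 2 U (dsd (lin a \<omega> b \<eta>)) (ext_d (lin a (star 4 3 (ext_d \<omega>)) b (star 4 3 (ext_d \<eta>))))"
    by (simp add: dsd_def numeral_eq_Suc)
  also have "agree 4 2 U (ext_d (lin a (star 4 3 (ext_d \<omega>)) b (star 4 3 (ext_d \<eta>)))) (lin a (dsd \<omega>) b (dsd \<eta>))"
  proof -
    have 1: "smooth_comps 4 1 U (star 4 3 (ext_d \<omega>))" "smooth_comps 4 1 U (star 4 3 (ext_d \<eta>))"
      by (rule smooth_comps_star[OF U smooth_comps_d(1)[OF U s(1)]],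
          rule smooth_comps_star[OF U smooth_comps_d(1)[OF U s(2)]])
    show ?thesis using ext_d_lin[OF 1, of a b] by (simp add: dsd_def numeral_eq_Suc)
  qed
  finally show ?thesis .
qed

text \<open>The operator contains a single star, so exactly one factor of the determinant
  appears.\<close>

lemma dsd_twist:
  assumes s: "\<forall>i. s i = 1 \<or> s i = -1" and sm: "smooth_comps 4 2 (topspace (Euclidean_space 4)) \<omega>"
  shows "agree 4 2 (topspace (Euclidean_space 4)) (dsd (twist 4 s k \<omega>)) (lin (\<Prod>i<4. s i) (twist 4 s k (dsd \<omega>)) 0 \<omega>)"
proof -
  let ?E = "topspace (Euclidean_space 4)" and ?d = "\<Prod>i<4. s i"
  let ?\<eta> = "star 4 3 (ext_d \<omega>)"
  have \<eta>: "smooth_comps 4 1 ?E ?\<eta>"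
    by (rule smooth_comps_star[OF openin_topspace smooth_comps_d(1)[OF openin_topspace sm]])
  have z: "smooth_comps 4 1 ?E (\<lambda>_ _. 0)" by (simp add: smooth_comps_def smooth_on_const)
  have "agree 4 3 ?E (ext_d (twist 4 s k \<omega>)) (twist 4 s k (ext_d \<omega>))"
    using ext_d_twist[OF sm] by (simp add: numeral_eq_Suc)
  then have "agree 4 1 ?E (star 4 3 (ext_d (twist 4 s k \<omega>))) (star 4 3 (twist 4 s k (ext_d \<omega>)))"
    by (rule agree_star)
  moreover have "star 4 3 (twist 4 s k (ext_d \<omega>)) = lin ?d (twist 4 s k ?\<eta>) 0 (\<lambda>_ _. 0)"
    unfolding star_twist[OF s] by (simp add: lin_def)
  ultimately have "agree 4 1 ?E (star 4 3 (ext_d (twist 4 s k \<omega>))) (lin ?d (twist 4 s k ?\<eta>) 0 (\<lambda>_ _. 0))"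
    by simp
  from ext_d_cong[OF openin_topspace this]
  have "agree 4 2 ?E (dsd (twist 4 s k \<omega>)) (ext_d (lin ?d (twist 4 s k ?\<eta>) 0 (\<lambda>_ _. 0)))"
    by (simp add: dsd_def numeral_eq_Suc)
  also have "agree 4 2 ?E (ext_d (lin ?d (twist 4 s k ?\<eta>) 0 (\<lambda>_ _. 0))) (lin ?d (ext_d (twist 4 s k ?\<eta>)) 0 (ext_d (\<lambda>_ _. 0)))"
    using ext_d_lin[OF smooth_comps_twist[OF \<eta>] z, of ?d s k 0] by (simp add: numeral_eq_Suc)
  also have "agree 4 2 ?E (lin ?d (ext_d (twist 4 s k ?\<eta>)) 0 (ext_d (\<lambda>_ _. 0))) (lin ?d (twist 4 s k (dsd \<omega>)) 0 \<omega>)"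
    using ext_d_twist[OF \<eta>, of s k] by (simp add: agree_def lin_def dsd_def numeral_eq_Suc)
  finally show ?thesis .
qed

text \<open>Both codifferentials carry the sign -1 in dimension four, so the Laplacian is -(D * + *
  D) with D = \<open>dsd\<close>. In this form it is symmetric under star.\<close>

lemma lap_eq:
  assumes U: "openin (Euclidean_space 4) U" and s: "smooth_comps 4 2 U \<omega>"
  shows "agree 4 2 U (lap \<omega>) (lin (-1) (dsd (star 4 2 \<omega>)) (-1) (star 4 2 (dsd \<omega>)))"
proof (rule agreeI)
  fix x I assume x: "x \<in> U" and I: "I \<in> multi_idx 4 2"
  let ?\<eta> = "star 4 3 (ext_d (star 4 2 \<omega>))"
  have \<eta>: "smooth_comps 4 1 U ?\<eta>"
    by (rule smooth_comps_star[OF U smooth_comps_d(1)[OF U smooth_comps_star[OF U s]]])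
  have 1: "codiff 4 flat 2 \<omega> = lin (-1) ?\<eta> 0 ?\<eta>"
    by (simp add: codiff_def lin_def fun_eq_iff)
  have 2: "codiff 4 flat (2 + 1) (ext_d \<omega>) = lin (-1) (star 4 2 (dsd \<omega>)) 0 \<omega>"
    by (simp add: codiff_def lin_def fun_eq_iff dsd_def numeral_eq_Suc)
  have "agree 4 2 U (ext_d (lin (-1) ?\<eta> 0 ?\<eta>)) (lin (-1) (ext_d ?\<eta>) 0 (ext_d ?\<eta>))"
    using ext_d_lin[OF \<eta> \<eta>, of "-1" 0] by (simp add: numeral_eq_Suc)
  from agreeD[OF this x I] show "lap \<omega> x I = lin (-1) (dsd (star 4 2 \<omega>)) (-1) (star 4 2 (dsd \<omega>)) x I"
    unfolding hodge_laplacian_def 1 2 by (simp add: lin_def dsd_def)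
qed

lemma lap_cong:
  assumes U: "openin (Euclidean_space 4) U" and s: "smooth_comps 4 2 U \<omega>" "smooth_comps 4 2 U \<eta>"
    and a: "agree 4 2 U \<omega> \<eta>"
  shows "agree 4 2 U (lap \<omega>) (lap \<eta>)"
proof -
  have "agree 4 2 U (dsd (star 4 2 \<omega>)) (dsd (star 4 2 \<eta>))"
    by (rule dsd_cong[OF U agree_star[OF a]])
  moreover have "agree 4 2 U (star 4 2 (dsd \<omega>)) (star 4 2 (dsd \<eta>))"
    by (rule agree_star[OF dsd_cong[OF U a]])
  ultimately show ?thesis
    using lap_eq[OF U s(1)] lap_eq[OF U s(2)] by (simp add: agree_def lin_def)
qed

lemma lap_lin:
  assumes U: "openin (Euclidean_space 4) U" and s: "smooth_comps 4 2 U \<omega>" "smooth_comps 4 2 U \<eta>"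
  shows "agree 4 2 U (lap (lin a \<omega> b \<eta>)) (lin a (lap \<omega>) b (lap \<eta>))"
proof -
  have "agree 4 2 U (dsd (star 4 2 (lin a \<omega> b \<eta>))) (lin a (dsd (star 4 2 \<omega>)) b (dsd (star 4 2 \<eta>)))"
    unfolding star_lin by (rule dsd_lin[OF U smooth_comps_star[OF U s(1)] smooth_comps_star[OF U s(2)]])
  moreover have "agree 4 2 U (star 4 2 (dsd (lin a \<omega> b \<eta>))) (lin a (star 4 2 (dsd \<omega>)) b (star 4 2 (dsd \<eta>)))"
    unfolding star_lin[symmetric] by (rule agree_star[OF dsd_lin[OF U s]])
  moreover note lap_eq[OF U smooth_comps_lin[OF U s, of a b]] lap_eq[OF U s(1)] lap_eq[OF U s(2)]
  ultimately show ?thesis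
  proof (intro agreeI)
    fix x I assume x: "x \<in> U" "I \<in> multi_idx 4 2"
      and "agree 4 2 U (dsd (star 4 2 (lin a \<omega> b \<eta>))) (lin a (dsd (star 4 2 \<omega>)) b (dsd (star 4 2 \<eta>)))"
        "agree 4 2 U (star 4 2 (dsd (lin a \<omega> b \<eta>))) (lin a (star 4 2 (dsd \<omega>)) b (star 4 2 (dsd \<eta>)))"
        "agree 4 2 U (lap (lin a \<omega> b \<eta>)) (lin (- 1) (dsd (star 4 2 (lin a \<omega> b \<eta>))) (- 1) (star 4 2 (dsd (lin a \<omega> b \<eta>))))"
        "agree 4 2 U (lap \<omega>) (lin (- 1) (dsd (star 4 2 \<omega>)) (- 1) (star 4 2 (dsd \<omega>)))"
        "agree 4 2 U (lap \<eta>) (lin (- 1) (dsd (star 4 2 \<eta>)) (- 1) (star 4 2 (dsd \<eta>)))"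
    note e = this(3-)[THEN agreeD, OF x]
    show "lap (lin a \<omega> b \<eta>) x I = lin a (lap \<omega>) b (lap \<eta>) x I"
      unfolding e(3) unfolding lin_def[of "-1"] e(1,2) unfolding lin_def e(4,5)
      by (simp add: algebra_simps)
  qed
qed

lemma lap_star:
  assumes U: "openin (Euclidean_space 4) U" and s: "smooth_comps 4 2 U \<omega>" and alt: "alt2 U \<omega>"
  shows "agree 4 2 U (lap (star 4 2 \<omega>)) (star 4 2 (lap \<omega>))"
proof -
  have "agree 4 2 U (dsd (star 4 2 (star 4 2 \<omega>))) (dsd \<omega>)"
    by (rule dsd_cong[OF U star_star[OF alt]])
  moreover have "agree 4 2 U (star 4 2 (star 4 2 (dsd \<omega>))) (dsd \<omega>)"
    unfolding dsd_def by (rule star_star[OF alt2_ext_d])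
  moreover have "agree 4 2 U (star 4 2 (lap \<omega>))
      (lin (-1) (star 4 2 (dsd (star 4 2 \<omega>))) (-1) (star 4 2 (star 4 2 (dsd \<omega>))))"
    unfolding star_lin[symmetric] by (rule agree_star[OF lap_eq[OF U s]])
  ultimately show ?thesis
    using lap_eq[OF U smooth_comps_star[OF U s, of 2]] by (simp add: agree_def lin_def)
qed

text \<open>Each term of the Laplacian contains two stars, so the determinant enters squared and
  reversal of orientation leaves no trace.\<close>

lemma lap_twist:
  assumes sg: "\<forall>i. s i = 1 \<or> s i = -1" and s: "smooth_comps 4 2 (topspace (Euclidean_space 4)) \<omega>"
  shows "agree 4 2 (topspace (Euclidean_space 4)) (lap (twist 4 s k \<omega>)) (twist 4 s k (lap \<omega>))"
proof -
  let ?E = "topspace (Euclidean_space 4)" and ?d = "\<Prod>i<4. s i"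
  have dd: "?d * ?d = 1"
    using prod_list_sgn_square[OF sg, of "[0, 1, 2, 3]"] by (simp add: numeral_eq_Suc mult_ac)
  have dd': "?d * (?d * a) = a" for a using dd by (simp add: mult.assoc[symmetric])
  have st: "star 4 2 (twist 4 s k \<eta>) = lin ?d (twist 4 s k (star 4 2 \<eta>)) 0 (\<lambda>_ _. 0)" for \<eta>
    unfolding star_twist[OF sg] by (simp add: lin_def)
  have z: "smooth_comps 4 2 ?E (\<lambda>_ _. 0)" by (simp add: smooth_comps_def smooth_on_const)
  have s2: "smooth_comps 4 2 ?E (star 4 2 \<omega>)" by (rule smooth_comps_star[OF openin_topspace s])
  have "agree 4 2 ?E (dsd (star 4 2 (twist 4 s k \<omega>)))
      (lin ?d (dsd (twist 4 s k (star 4 2 \<omega>))) 0 (dsd (\<lambda>_ _. 0)))"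
    unfolding st by (rule dsd_lin[OF openin_topspace smooth_comps_twist[OF s2] z])
  then have 1: "agree 4 2 ?E (dsd (star 4 2 (twist 4 s k \<omega>))) (twist 4 s k (dsd (star 4 2 \<omega>)))"
    using dsd_twist[OF sg s2, of k] by (simp add: agree_def lin_def dd')
  have "agree 4 2 ?E (star 4 2 (dsd (twist 4 s k \<omega>))) (star 4 2 (lin ?d (twist 4 s k (dsd \<omega>)) 0 \<omega>))"
    by (rule agree_star[OF dsd_twist[OF sg s]])
  then have 2: "agree 4 2 ?E (star 4 2 (dsd (twist 4 s k \<omega>))) (twist 4 s k (star 4 2 (dsd \<omega>)))"
    unfolding star_lin st by (simp add: agree_def lin_def dd')
  show ?thesis
  proof (rule agreeI)
    fix x I assume x: "x \<in> ?E" "I \<in> multi_idx 4 2"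
    show "lap (twist 4 s k \<omega>) x I = twist 4 s k (lap \<omega>) x I"
      unfolding agreeD[OF lap_eq[OF openin_topspace smooth_comps_twist[OF s]] x]
      unfolding twist_def[of 4 s k "lap \<omega>"] agreeD[OF lap_eq[OF openin_topspace s] aff_in_topspace x(2)]
      unfolding lin_def agreeD[OF 1 x] agreeD[OF 2 x]
      by (simp add: twist_def algebra_simps)
  qed
qed

section \<open>Forms on the quotient as invariant forms on Euclidean space\<close>

text \<open>Only the Jacobian at the single point x enters, so this also applies to a change of
  charts that is known to be affine merely near x.\<close>

lemma pullback_diagonal:
  assumes J: "\<And>i j. i < n \<Longrightarrow> j < n \<Longrightarrow> pd i (\<lambda>y. h y j) x = (if i = j then s j else 0)"
    and I: "I \<in> multi_idx n p"
  shows "pullback n h \<omega> x I = prod_list (map s I) * \<omega> (h x) I"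
proof -
  have len: "length I = p" using I by (rule length_multi_idx)
  have "(\<Prod>k<p. pd (I ! k) (\<lambda>y. h y (K ! k)) x) = (if K = I then prod_list (map s I) else 0)"
    if K: "K \<in> multi_idx n p" for K
  proof (cases "K = I")
    case True
    have "(\<Prod>k<p. pd (I ! k) (\<lambda>y. h y (I ! k)) x) = (\<Prod>k<p. s (I ! k))"
      by (rule prod.cong) (use J nth_multi_idx[OF I] in auto)
    also have "\<dots> = prod_list (map s I)"
      using prod.list_conv_set_nth[of "map s I"] len by (simp add: atLeast0LessThan)
    finally show ?thesis using True by simp
  next
    case False
    then obtain k where k: "k < p" "I ! k \<noteq> K ! k"
      using nth_equalityI[of K I] len length_multi_idx[OF K] by metis
    then have "(\<Prod>k<p. pd (I ! k) (\<lambda>y. h y (K ! k)) x) = 0"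
      by (intro prod_zero bexI[of _ k]) (use J nth_multi_idx[OF I] nth_multi_idx[OF K] in auto)
    then show ?thesis using False by simp
  qed
  then have "pullback n h \<omega> x I = (\<Sum>K\<in>multi_idx n p. if K = I then prod_list (map s I) * \<omega> (h x) I else 0)"
    unfolding pullback_def len by (intro sum.cong) auto
  then show ?thesis using I by (simp add: finite_multi_idx)
qed

lemma pullback_aff:
  "I \<in> multi_idx n p \<Longrightarrow> pullback n (aff n s k) \<omega> x I = twist n s k \<omega> x I"
  unfolding twist_def by (rule pullback_diagonal) (simp_all add: pd_aff_coordinate)

section \<open>Changes of charts at generic points\<close>

lemma continuous_map_cube:
  assumes V: "openin (Euclidean_space n) V"
    and f: "continuous_map (subtopology (Euclidean_space n) V) euclideanreal f"
    and z: "z \<in> V" and d: "d > 0"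
  shows "\<exists>e>0. cube n z e \<subseteq> V \<and> (\<forall>y\<in>cube n z e. \<bar>f y - f z\<bar> < d)"
proof -
  let ?W = "{y \<in> topspace (subtopology (Euclidean_space n) V). f y \<in> ball (f z) d}"
  have "openin (subtopology (Euclidean_space n) V) ?W"
    by (rule openin_continuous_map_preimage[OF f]) simp
  then have "openin (Euclidean_space n) ?W" by (rule openin_trans_full[OF _ V])
  moreover have "z \<in> ?W" using z d openin_subset[OF V] by auto
  ultimately obtain e where e: "e > 0" "cube n z e \<subseteq> ?W"
    unfolding openin_Euclidean_space_iff by blast
  have "cube n z e \<subseteq> V" using e(2) by auto
  moreover have "\<forall>y\<in>cube n z e. \<bar>f y - f z\<bar> < d"
    using e(2) by (auto simp: dist_real_def abs_minus_commute)
  ultimately show ?thesis using e(1) by blast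
qed

text \<open>Such points are dense, and at them the value of a group element determines its signs and
  its translation in the first n coordinates.\<close>

lemma ex_generic_in_cube:
  assumes "z \<in> topspace (Euclidean_space n)" "e > 0"
  shows "\<exists>y\<in>cube n z e. \<forall>i<n. 4 * y i \<notin> \<int>"
proof -
  \<comment> \<open>The shift is at most 1/8, so four times it lies strictly between 0 and 1 and
    destroys integrality.\<close>
  define t where "t i = (if 4 * z i \<in> \<int> then z i + min (e / 2) (1 / 8) else z i)" for i
  have t: "4 * t i \<notin> \<int>" for i
  proof (cases "4 * z i \<in> \<int>")
    case True
    show ?thesis
    proof
      assume "4 * t i \<in> \<int>"
      then have "4 * t i - 4 * z i \<in> \<int>" using True by (rule Ints_diff)
      then have "4 * min (e / 2) (1 / 8) \<in> \<int>" using True by (simp add: t_def algebra_simps)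
      then obtain m :: int where m: "4 * min (e / 2) (1 / 8) = of_int m" by (rule Ints_cases)
      have "0 < 4 * min (e / 2) (1 / 8)" "4 * min (e / 2) (1 / 8) < 1" using assms(2) by (auto simp: min_def)
      then have "0 < m" "m < 1" unfolding m by linarith+
      then show False by simp
    qed
  qed (simp add: t_def)
  have "(\<lambda>i. if i < n then t i else 0) \<in> cube n z e"
    using assms(2) by (auto simp: cube_def t_def min_def)
  moreover have "\<forall>i<n. 4 * (if i < n then t i else 0) \<notin> \<int>" using t by simp
  ultimately show ?thesis by (intro bexI[of _ "\<lambda>i. if i < n then t i else 0"])
qed

context torus_involution begin

text \<open>At every point h agrees with some group element, which might vary with the point. Near
  z, continuity of h makes each such element carry z close to h z, hence onto h z by isolation;
  genericity of z then fixes its signs and translation.\<close>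

lemma chart_change_generic:
  assumes c: "c \<in> atlas" and d: "d \<in> atlas" and ch: "chart_change n c d V h"
    and z: "z \<in> V" and gen: "\<forall>i<n. 4 * z i \<notin> \<int>"
  shows "\<exists>s k e. (s, k) \<in> G \<and> e > 0 \<and> cube n z e \<subseteq> V \<and> (\<forall>y\<in>cube n z e. h y = aff n s k y)"
proof -
  have V: "openin (Euclidean_space n) V" and hV: "h ` V \<subseteq> chart_dom d"
    and sm: "smooth_map_on n V h" and orb: "\<And>y. y \<in> V \<Longrightarrow> orb (h y) = orb y"
    using ch chart_map_atlas[OF c] chart_map_atlas[OF d] unfolding chart_change_def isometric_diffeo_def by auto
  have VE: "V \<subseteq> E" using V openin_subset by blast
  have hE: "h y \<in> E" if "y \<in> V" for y using hV chart_dom_subset[OF d] that by blast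
  have ex: "\<exists>s k. (s, k) \<in> G \<and> aff n s k y = h y" if y: "y \<in> V" for y
    using orb_eq_iff[of y "h y"] orb[OF y] hE[OF y] VE y by auto
  obtain s k where sk: "(s, k) \<in> G" "aff n s k z = h z" using ex[OF z] by auto
  from orbit_isolated[OF hE[OF z], of z] obtain r
    where r: "r > 0 \<and> (\<forall>s k. (s, k) \<in> G \<longrightarrow> aff n s k z \<in> cube n (h z) r \<longrightarrow> aff n s k z = h z)"
    by (rule exE)
  have r0: "r / 2 > 0" using r by simp
  have "\<exists>e>0. cube n z e \<subseteq> V \<and> (\<forall>y\<in>cube n z e. \<bar>h y j - h z j\<bar> < r / 2)" if "j < n" for j
    by (rule continuous_map_cube[OF V _ z r0], rule smooth_on_imp_continuous)
       (use sm that in \<open>simp add: smooth_map_on_def\<close>)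
  then have "\<forall>j. \<exists>e. j < n \<longrightarrow> e > 0 \<and> cube n z e \<subseteq> V \<and> (\<forall>y\<in>cube n z e. \<bar>h y j - h z j\<bar> < r / 2)"
    by blast
  from choice[OF this] obtain g where g: "\<And>j. j < n \<Longrightarrow> g j > 0"
    "\<And>j y. j < n \<Longrightarrow> y \<in> cube n z (g j) \<Longrightarrow> \<bar>h y j - h z j\<bar> < r / 2"
    by blast
  obtain e1 where e1: "e1 > 0" "\<forall>j\<in>{..<n}. e1 \<le> g j" using ex_min_pos[of "{..<n}" g] g(1) by auto
  obtain e2 where e2: "e2 > 0" "cube n z e2 \<subseteq> V" using V z unfolding openin_Euclidean_space_iff by blast
  \<comment> \<open>The bound e2 keeps the box in V, e1 keeps h y within r/2 of h z, and r/2 bounds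
    the displacement under the group element; together they stay below r.\<close>
  let ?e = "min (min e1 e2) (r / 2)"
  have "?e \<le> e2" by simp
  then have sub: "cube n z ?e \<subseteq> V" by (rule subset_trans[OF cube_mono e2(2)])
  have "h y = aff n s k y" if y: "y \<in> cube n z ?e" for y
  proof -
    obtain s' k' where s': "(s', k') \<in> G" "aff n s' k' y = h y" using ex y sub by blast
    have "\<bar>aff n s' k' z i - h z i\<bar> < r" if i: "i < n" for i
    proof -
      have "aff n s' k' y \<in> cube n (aff n s' k' z) ?e" by (rule aff_in_cube[OF G_sgn[OF s'(1)] y])
      then have "\<bar>h y i - aff n s' k' z i\<bar> < ?e" using i unfolding s'(2) cube_def by blast
      moreover have "e1 \<le> g i" using e1(2) i by simp
      then have "?e \<le> g i" by simp
      then have "y \<in> cube n z (g i)" by (rule subsetD[OF cube_mono y])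
      then have "\<bar>h y i - h z i\<bar> < r / 2" by (rule g(2)[OF i])
      ultimately show ?thesis by linarith
    qed
    then have "aff n s' k' z \<in> cube n (h z) r" by (simp add: cube_def aff_def)
    then have eq: "aff n s' k' z = aff n s k z" using r s'(1) sk(2) by simp
    have "s' i = s i \<and> k' i = k i" if i: "i < n" for i
    proof -
      have e: "s' i * z i + k' i = s i * z i + k i" using fun_cong[OF eq, of i] i by (simp add: aff_def)
      have kk: "2 * k' i - 2 * k i \<in> \<int>" by (rule Ints_diff[OF G_half[OF s'(1)] G_half[OF sk(1)]])
      have "s' i = s i"
      proof (rule ccontr)
        assume ne: "s' i \<noteq> s i"
        have "s i = 1 \<and> s' i = -1 \<or> s i = -1 \<and> s' i = 1"
          using ne spec[OF G_sgn[OF s'(1)], of i] spec[OF G_sgn[OF sk(1)], of i] by auto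
        \<comment> \<open>With opposite signs, 2 * z i is up to sign the difference of two
          half-integral translations; doubling gives an integer. This is the origin of the
          4.\<close>
        then have "4 * z i = 2 * k' i - 2 * k i \<or> 4 * z i = - (2 * k' i - 2 * k i)" using e by auto
        then have "4 * z i \<in> \<int>" using kk Ints_minus[OF kk] by auto
        then show False using gen i by simp
      qed
      then show ?thesis using e by simp
    qed
    then have "aff n s' k' y = aff n s k y" by (auto simp: aff_def)
    then show ?thesis using s'(2) by simp
  qed
  moreover have "?e > 0" using e1(1) e2(1) r0 by simp
  ultimately show ?thesis using sk(1) sub by (intro exI[of _ s] exI[of _ k] exI[of _ ?e]) simp
qed

definition invariant :: "nat \<Rightarrow> local_form \<Rightarrow> bool" where
  "invariant p \<Omega> \<longleftrightarrow> (\<forall>s k. (s, k) \<in> G \<longrightarrow> agree n p E (twist n s k \<Omega>) \<Omega>)"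

lemma invariantD: "invariant p \<Omega> \<Longrightarrow> (s, k) \<in> G \<Longrightarrow> agree n p E (twist n s k \<Omega>) \<Omega>"
  unfolding invariant_def by blast

text \<open>
  At a point with trivial isotropy a change of charts is locally an element of the group; such
  points are dense, so invariance under arbitrary changes of charts follows by continuity.
\<close>

lemma chart_change_invariant:
  assumes c: "c \<in> atlas" and d: "d \<in> atlas" and ch: "chart_change n c d V h"
    and sm: "smooth_comps n p E \<Omega>" and inv: "invariant p \<Omega>"
    and z: "z \<in> V" and I: "I \<in> multi_idx n p"
  shows "pullback n h \<Omega> z I = \<Omega> z I"
proof -
  let ?X = "subtopology (Euclidean_space n) V"
  have V: "openin (Euclidean_space n) V" and hV: "h ` V \<subseteq> chart_dom d" and smh: "smooth_map_on n V h"
    using ch unfolding chart_change_def isometric_diffeo_def by auto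
  have VE: "V \<subseteq> E" using V openin_subset by blast
  have hE: "h y \<in> E" if "y \<in> V" for y using hV chart_dom_subset[OF d] that by blast
  have len: "length I = p" using I by (rule length_multi_idx)
  \<comment> \<open>Smoothness of h speaks of its first n components only; the others vanish because
    h takes values in a chart domain.\<close>
  have "continuous_map ?X (Euclidean_space n) (\<lambda>x i. if i < n then h x i else 0)"
    unfolding continuous_map_componentwise_Euclidean_space
    using smh smooth_on_imp_continuous unfolding smooth_map_on_def by blast
  then have conth: "continuous_map ?X (Euclidean_space n) h"
  proof (rule continuous_map_eq)
    fix x assume "x \<in> topspace ?X"
    then have "h x \<in> E" using hE by simp
    then show "(\<lambda>i. if i < n then h x i else 0) = h x" by (auto simp: topspace_Euclidean_space)
  qed
  have contO: "continuous_map (Euclidean_space n) euclideanreal (\<lambda>x. \<Omega> x J)" if "J \<in> multi_idx n p" for J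
    using smooth_on_imp_continuous[of n E "\<lambda>x. \<Omega> x J"] sm that by (simp add: smooth_comps_def)
  have "continuous_map ?X euclideanreal (\<lambda>x. \<Sum>J\<in>multi_idx n p.
      (\<Prod>k<p. pd (I ! k) (\<lambda>y. h y (J ! k)) x) * \<Omega> (h x) J)"
  proof (intro continuous_map_sum finite_multi_idx continuous_map_real_mult continuous_map_prod finite_lessThan)
    fix J k assume J: "J \<in> multi_idx n p" and k: "k \<in> {..<p}"
    have "smooth_on n V (pd (I ! k) (\<lambda>y. h y (J ! k)))"
      by (rule smooth_on_pd) (use smh nth_multi_idx[OF J] nth_multi_idx[OF I] k in \<open>auto simp: smooth_map_on_def\<close>)
    then show "continuous_map ?X euclideanreal (\<lambda>x. pd (I ! k) (\<lambda>y. h y (J ! k)) x)"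
      by (rule smooth_on_imp_continuous)
  next
    fix J assume J: "J \<in> multi_idx n p"
    show "continuous_map ?X euclideanreal (\<lambda>x. \<Omega> (h x) J)"
      using continuous_map_compose[OF conth contO[OF J]] by (simp add: o_def)
  qed
  then have "continuous_map ?X euclideanreal (\<lambda>x. pullback n h \<Omega> x I)" by (simp add: pullback_def len)
  moreover have "continuous_map ?X euclideanreal (\<lambda>x. \<Omega> x I)"
    by (rule continuous_map_from_subtopology[OF contO[OF I]])
  ultimately have cont: "continuous_map ?X euclideanreal (\<lambda>x. pullback n h \<Omega> x I - \<Omega> x I)"
    by (rule continuous_map_diff)
  have gen: "pullback n h \<Omega> y I - \<Omega> y I = 0" if y: "y \<in> V" "\<forall>i<n. 4 * y i \<notin> \<int>" for y
  proof -
    obtain s k e where ske: "(s, k) \<in> G" "e > 0" "cube n y e \<subseteq> V" "\<forall>w\<in>cube n y e. h w = aff n s k w"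
      using chart_change_generic[OF c d ch y] by auto
    have yc: "y \<in> cube n y e" using centre_in_cube ske(2) y(1) VE by blast
    have "pd i (\<lambda>w. h w j) y = (if i = j then s j else 0)" if "i < n" "j < n" for i j
      using pd_cong[OF openin_cube yc that(1), of "\<lambda>w. h w j" "\<lambda>w. aff n s k w j"] ske(4)
        pd_aff_coordinate[OF that] by simp
    then have "pullback n h \<Omega> y I = prod_list (map s I) * \<Omega> (h y) I" by (rule pullback_diagonal[OF _ I])
    also have "\<dots> = twist n s k \<Omega> y I" using ske(4) yc by (simp add: twist_def)
    also have "\<dots> = \<Omega> y I" using agreeD[OF invariantD[OF inv ske(1)] _ I] y(1) VE by blast
    finally show ?thesis by simp
  qed
  show ?thesis
  proof (rule ccontr)
    assume "\<not> ?thesis"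
    \<comment> \<open>A nonzero difference at z would remain nonzero on a whole box about z, and
      that box contains a generic point.\<close>
    then have "\<bar>pullback n h \<Omega> z I - \<Omega> z I\<bar> > 0" by simp
    from continuous_map_cube[OF V cont z this] obtain e where e: "e > 0" "cube n z e \<subseteq> V"
      "\<forall>y\<in>cube n z e. \<bar>pullback n h \<Omega> y I - \<Omega> y I - (pullback n h \<Omega> z I - \<Omega> z I)\<bar> < \<bar>pullback n h \<Omega> z I - \<Omega> z I\<bar>"
      by auto
    obtain y where y: "y \<in> cube n z e" "\<forall>i<n. 4 * y i \<notin> \<int>"
      using ex_generic_in_cube[of z n e] e(1) z VE by auto
    have "pullback n h \<Omega> y I - \<Omega> y I = 0" by (rule gen) (use y e(2) in auto)
    then show False using bspec[OF e(3) y(1)] by simp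
  qed
qed

section \<open>From forms on the charts to one form on R^n and back\<close>

definition chart_at :: "(nat \<Rightarrow> real) \<Rightarrow> (nat \<Rightarrow> real) set orbi_chart" where
  "chart_at x = chart x (SOME e. e > 0 \<and> chart x e \<in> atlas)"

lemma chart_at:
  assumes "x \<in> E" shows "chart_at x \<in> atlas" "x \<in> chart_dom (chart_at x)"
proof -
  have "\<exists>e. e > 0 \<and> chart x e \<in> atlas" using ex_chart[OF assms] .
  then have *: "(SOME e. e > 0 \<and> chart x e \<in> atlas) > 0 \<and> chart x (SOME e. e > 0 \<and> chart x e \<in> atlas) \<in> atlas"
    by (rule someI_ex)
  then show "chart_at x \<in> atlas" by (simp add: chart_at_def)
  show "x \<in> chart_dom (chart_at x)" unfolding chart_at_def chart_simps
    by (rule centre_in_cube[OF assms]) (use * in simp)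
qed

text \<open>The value at x is read off in a chart centred at x; by
  \<open>smooth_forms_eq_glue\<close> every other chart around x gives the same value.\<close>

definition glue :: "(nat \<Rightarrow> real) set orbi_form \<Rightarrow> local_form" where
  "glue \<omega> = (\<lambda>x I. \<omega> (chart_at x) x I)"

definition restr :: "nat \<Rightarrow> local_form \<Rightarrow> (nat \<Rightarrow> real) set orbi_form" where
  "restr p \<Omega> = (\<lambda>c x I. if c \<in> atlas \<and> x \<in> chart_dom c \<and> I \<in> multi_idx n p then \<Omega> x I else 0)"

lemma smooth_forms_transition:
  assumes \<omega>: "\<omega> \<in> smooth_forms n atlas p" and c: "c \<in> atlas" and d: "d \<in> atlas" and sk: "(s, k) \<in> G"
    and x: "x \<in> chart_dom c" "aff n s k x \<in> chart_dom d" and I: "I \<in> multi_idx n p"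
  shows "\<omega> c x I = twist n s k (\<omega> d) x I"
proof -
  obtain e where e: "e > 0" "chart_change n c d (cube n x e) (aff n s k)"
    using ex_chart_change[OF c d sk x] by blast
  have "x \<in> cube n x e" using centre_in_cube[of x n e] e(1) x(1) chart_dom_subset[OF c] by blast
  then have "\<omega> c x I = pullback n (aff n s k) (\<omega> d) x I"
    using \<omega> c d e(2) I unfolding smooth_forms_def by blast
  then show ?thesis by (simp add: pullback_aff[OF I])
qed

text \<open>The chart domains are subsets of the same R^n, and the identity is a change of charts
  wherever two of them overlap.\<close>

lemma smooth_forms_eq_glue:
  assumes \<omega>: "\<omega> \<in> smooth_forms n atlas p" and c: "c \<in> atlas" and x: "x \<in> chart_dom c"
    and I: "I \<in> multi_idx n p"
  shows "\<omega> c x I = glue \<omega> x I"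
proof -
  have xE: "x \<in> E" using x chart_dom_subset[OF c] by blast
  have "prod_list (map (\<lambda>_. 1 :: real) I) = 1" by (induction I) simp_all
  then show ?thesis
    using smooth_forms_transition[OF \<omega> c chart_at(1)[OF xE] G_trivial x _ I] aff_trivial[OF xE]
      chart_at(2)[OF xE] by (simp add: twist_def glue_def)
qed

lemma invariant_glue:
  assumes \<omega>: "\<omega> \<in> smooth_forms n atlas p" shows "invariant p (glue \<omega>)"
  unfolding invariant_def
proof (intro allI impI agreeI)
  fix s k x I assume sk: "(s, k) \<in> G" and x: "x \<in> E" and I: "I \<in> multi_idx n p"
  show "twist n s k (glue \<omega>) x I = glue \<omega> x I"
    using smooth_forms_transition[OF \<omega> chart_at(1)[OF x] chart_at(1)[OF aff_in_topspace] sk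
        chart_at(2)[OF x] chart_at(2)[OF aff_in_topspace] I]
    by (simp add: twist_def glue_def)
qed

text \<open>The chart used by \<open>glue\<close> jumps from point to point, but on any one chart
  domain the result equals the form of that chart, and smoothness is local.\<close>

lemma smooth_form_on_glue:
  assumes \<omega>: "\<omega> \<in> smooth_forms n atlas p" shows "smooth_form_on n p E (glue \<omega>)"
proof -
  have sf: "smooth_form_on n p (chart_dom c) (\<omega> c)" if "c \<in> atlas" for c
    using \<omega> that unfolding smooth_forms_def by blast
  have "smooth_on n E (\<lambda>x. glue \<omega> x I)" if I: "I \<in> multi_idx n p" for I
  proof (rule smooth_on_locally)
    fix x assume x: "x \<in> E"
    note c = chart_at[OF x]
    have "smooth_on n (chart_dom (chart_at x)) (\<lambda>y. glue \<omega> y I)"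
    proof (rule smooth_on_cong[OF openin_chart_dom[OF c(1)]])
      show "smooth_on n (chart_dom (chart_at x)) (\<lambda>y. \<omega> (chart_at x) y I)"
        using sf[OF c(1)] I by (simp add: smooth_form_on_def)
      show "\<omega> (chart_at x) y I = glue \<omega> y I" if "y \<in> chart_dom (chart_at x)" for y
        by (rule smooth_forms_eq_glue[OF \<omega> c(1) that I])
    qed
    then show "\<exists>V. openin (Euclidean_space n) V \<and> x \<in> V \<and> V \<subseteq> E \<and> smooth_on n V (\<lambda>x. glue \<omega> x I)"
      using openin_chart_dom[OF c(1)] c(2) chart_dom_subset[OF c(1)] by blast
  qed
  moreover have "glue \<omega> x (I[i := I ! j, j := I ! i]) = - glue \<omega> x I"
    if "x \<in> E" "I \<in> multi_idx n p" "i < p" "j < p" "i \<noteq> j" for x I i j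
    using sf[OF chart_at(1)[OF that(1)]] chart_at(2)[OF that(1)] that
    unfolding smooth_form_on_def glue_def by blast
  ultimately show ?thesis unfolding smooth_form_on_def by blast
qed

lemma glue_restr: "agree n p E (glue (restr p \<Omega>)) \<Omega>"
  by (rule agreeI) (simp add: glue_def restr_def chart_at)

lemma restr_cong:
  assumes "agree n p E \<Omega> \<Omega>'" shows "restr p \<Omega> = restr p \<Omega>'"
proof (intro ext)
  fix c x I
  show "restr p \<Omega> c x I = restr p \<Omega>' c x I"
    using agreeD[OF assms, of x I] chart_dom_subset[of c] by (auto simp: restr_def)
qed

lemma restr_glue:
  assumes \<omega>: "\<omega> \<in> smooth_forms n atlas p" shows "restr p (glue \<omega>) = \<omega>"
proof (intro ext)
  fix c x I
  have "\<omega> c x I = 0" if "\<not> (c \<in> atlas \<and> x \<in> chart_dom c \<and> I \<in> multi_idx n p)"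
    using \<omega> that unfolding smooth_forms_def by blast
  then show "restr p (glue \<omega>) c x I = \<omega> c x I"
    using smooth_forms_eq_glue[OF \<omega>, of c x I] by (auto simp: restr_def)
qed

lemma restr_in_smooth_forms:
  assumes sm: "smooth_form_on n p E \<Omega>" and inv: "invariant p \<Omega>"
  shows "restr p \<Omega> \<in> smooth_forms n atlas p"
  unfolding smooth_forms_def mem_Collect_eq
proof (intro conjI ballI allI impI)
  fix c assume c: "c \<in> atlas"
  have "smooth_on n (chart_dom c) (\<lambda>x. restr p \<Omega> c x I)" if I: "I \<in> multi_idx n p" for I
  proof (rule smooth_on_cong[OF openin_chart_dom[OF c]])
    show "smooth_on n (chart_dom c) (\<lambda>x. \<Omega> x I)"
      by (rule smooth_on_subset[OF chart_dom_subset[OF c]]) (use sm I in \<open>simp add: smooth_form_on_def\<close>)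
    show "\<Omega> x I = restr p \<Omega> c x I" if "x \<in> chart_dom c" for x using that c I by (simp add: restr_def)
  qed
  moreover have "restr p \<Omega> c x (I[i := I ! j, j := I ! i]) = - restr p \<Omega> c x I"
    if h: "x \<in> chart_dom c" "I \<in> multi_idx n p" "i < p" "j < p" "i \<noteq> j" for x I i j
  proof -
    have "x \<in> E" using h(1) chart_dom_subset[OF c] by blast
    then have "\<Omega> x (I[i := I ! j, j := I ! i]) = - \<Omega> x I" using sm h unfolding smooth_form_on_def by blast
    moreover have "I[i := I ! j, j := I ! i] \<in> multi_idx n p"
      using h(2-4) by (simp add: multi_idx_def set_swap)
    ultimately show ?thesis using h c by (simp add: restr_def)
  qed
  ultimately show "smooth_form_on n p (chart_dom c) (restr p \<Omega> c)" unfolding smooth_form_on_def by blast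
next
  fix c d V h x I assume c: "c \<in> atlas" and d: "d \<in> atlas" and ch: "chart_change n c d V h"
    and x: "x \<in> V" and I: "I \<in> multi_idx n p"
  have V: "V \<subseteq> chart_dom c" "h ` V \<subseteq> chart_dom d" using ch unfolding chart_change_def by auto
  have smc: "smooth_comps n p E \<Omega>" using sm by (simp add: smooth_comps_def smooth_form_on_def)
  have len: "length I = p" using I by (rule length_multi_idx)
  \<comment> \<open>The image of h lies in the domain of d, where the restricted form has not been
    set to zero.\<close>
  have "pullback n h (restr p \<Omega> d) x I = pullback n h \<Omega> x I"
    unfolding pullback_def len by (rule sum.cong) (use V x d in \<open>auto simp: restr_def\<close>)
  also have "\<dots> = \<Omega> x I" by (rule chart_change_invariant[OF c d ch smc inv x I])
  also have "\<dots> = restr p \<Omega> c x I" using V x c I by (auto simp: restr_def)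
  finally show "restr p \<Omega> c x I = pullback n h (restr p \<Omega> d) x I" by simp
qed (auto simp: restr_def)

end

section \<open>Orientation reversing involutions of the four-torus\<close>

lemma smooth_form_on_4_2_iff: "smooth_form_on 4 2 U \<omega> \<longleftrightarrow> smooth_comps 4 2 U \<omega> \<and> alt2 U \<omega>"
proof -
  have "(\<forall>I\<in>multi_idx 4 2. \<forall>i<2. \<forall>j<2. i \<noteq> j \<longrightarrow> \<omega> x (I[i := I ! j, j := I ! i]) = - \<omega> x I) \<longleftrightarrow>
      (\<forall>a<4. \<forall>b<4. \<omega> x [b, a] = - \<omega> x [a, b])" (is "?L \<longleftrightarrow> ?R") for x
  proof
    assume L: ?L
    show ?R
    proof (intro allI impI)
      fix a b :: nat assume "a < 4" "b < 4"
      then have "[a, b] \<in> multi_idx 4 2" by (simp add: multi_idx_def)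
      from bspec[OF L this] have "0 < (2::nat) \<longrightarrow> (\<forall>j<2. 0 \<noteq> j \<longrightarrow>
          \<omega> x ([a, b][0 := [a, b] ! j, j := [a, b] ! 0]) = - \<omega> x [a, b])"
        by (rule spec)
      then have "\<forall>j<2. 0 \<noteq> j \<longrightarrow> \<omega> x ([a, b][0 := [a, b] ! j, j := [a, b] ! 0]) = - \<omega> x [a, b]" by simp
      from spec[OF this, of 1] show "\<omega> x [b, a] = - \<omega> x [a, b]" by simp
    qed
  next
    assume R: ?R
    show ?L
    proof (intro ballI allI impI)
      fix I and i j :: nat assume "I \<in> multi_idx 4 2" and ij: "i < 2" "j < 2" "i \<noteq> j"
      then obtain a b where ab: "I = [a, b]" "a < 4" "b < 4" unfolding multi_idx_2 by auto
      have "\<omega> x [b, a] = - \<omega> x [a, b]" using R ab by blast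
      moreover have "i = 0 \<and> j = 1 \<or> i = 1 \<and> j = 0" using ij by linarith
      ultimately show "\<omega> x (I[i := I ! j, j := I ! i]) = - \<omega> x I" using ab(1) by auto
    qed
  qed
  then show ?thesis by (simp only: smooth_form_on_def smooth_comps_def alt2_def)
qed

section \<open>Eigenforms and lattice periodicity on R^4\<close>

definition eigen :: "real \<Rightarrow> local_form \<Rightarrow> bool" where
  "eigen l \<Omega> \<longleftrightarrow> smooth_comps 4 2 (topspace (Euclidean_space 4)) \<Omega> \<and>
     alt2 (topspace (Euclidean_space 4)) \<Omega> \<and>
     agree 4 2 (topspace (Euclidean_space 4)) (lap \<Omega>) (lin l \<Omega> 0 \<Omega>)"

lemma eigen_lin:
  assumes "eigen l \<Omega>" "eigen l \<Omega>'" shows "eigen l (lin a \<Omega> b \<Omega>')"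
proof -
  have s: "smooth_comps 4 2 (topspace (Euclidean_space 4)) \<Omega>" "smooth_comps 4 2 (topspace (Euclidean_space 4)) \<Omega>'"
    and t: "alt2 (topspace (Euclidean_space 4)) \<Omega>" "alt2 (topspace (Euclidean_space 4)) \<Omega>'"
    and e: "agree 4 2 (topspace (Euclidean_space 4)) (lap \<Omega>) (lin l \<Omega> 0 \<Omega>)"
      "agree 4 2 (topspace (Euclidean_space 4)) (lap \<Omega>') (lin l \<Omega>' 0 \<Omega>')"
    using assms by (simp_all add: eigen_def)
  have "agree 4 2 (topspace (Euclidean_space 4)) (lap (lin a \<Omega> b \<Omega>')) (lin l (lin a \<Omega> b \<Omega>') 0 (lin a \<Omega> b \<Omega>'))"
  proof (rule agreeI)
    fix x I assume x: "x \<in> topspace (Euclidean_space 4)" "I \<in> multi_idx 4 2"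
    show "lap (lin a \<Omega> b \<Omega>') x I = lin l (lin a \<Omega> b \<Omega>') 0 (lin a \<Omega> b \<Omega>') x I"
      unfolding agreeD[OF lap_lin[OF openin_topspace s] x] unfolding lin_def[of a "lap \<Omega>"] agreeD[OF e(1) x] agreeD[OF e(2) x]
      by (simp add: lin_def algebra_simps)
  qed
  then show ?thesis
    unfolding eigen_def using smooth_comps_lin[OF openin_topspace s] alt2_lin[OF t] by blast
qed

lemma eigen_star:
  assumes "eigen l \<Omega>" shows "eigen l (star 4 2 \<Omega>)"
proof -
  have s: "smooth_comps 4 2 (topspace (Euclidean_space 4)) \<Omega>"
    and t: "alt2 (topspace (Euclidean_space 4)) \<Omega>"
    and e: "agree 4 2 (topspace (Euclidean_space 4)) (lap \<Omega>) (lin l \<Omega> 0 \<Omega>)"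
    using assms by (simp_all add: eigen_def)
  have "agree 4 2 (topspace (Euclidean_space 4)) (lap (star 4 2 \<Omega>)) (star 4 2 (lap \<Omega>))"
    by (rule lap_star[OF openin_topspace s t])
  also have "agree 4 2 (topspace (Euclidean_space 4)) (star 4 2 (lap \<Omega>)) (star 4 2 (lin l \<Omega> 0 \<Omega>))"
    by (rule agree_star[OF e])
  finally show ?thesis
    unfolding eigen_def star_lin using smooth_comps_star[OF openin_topspace s] alt2_star by blast
qed

lemma eigen_twist:
  assumes "eigen l \<Omega>" and sg: "\<forall>i. s i = 1 \<or> s i = -1" shows "eigen l (twist 4 s k \<Omega>)"
proof -
  have s: "smooth_comps 4 2 (topspace (Euclidean_space 4)) \<Omega>"
    and t: "alt2 (topspace (Euclidean_space 4)) \<Omega>"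
    and e: "agree 4 2 (topspace (Euclidean_space 4)) (lap \<Omega>) (lin l \<Omega> 0 \<Omega>)"
    using assms by (simp_all add: eigen_def)
  have "agree 4 2 (topspace (Euclidean_space 4)) (lap (twist 4 s k \<Omega>)) (lin l (twist 4 s k \<Omega>) 0 (twist 4 s k \<Omega>))"
  proof (rule agreeI)
    fix x I assume x: "x \<in> topspace (Euclidean_space 4)" "I \<in> multi_idx 4 2"
    show "lap (twist 4 s k \<Omega>) x I = lin l (twist 4 s k \<Omega>) 0 (twist 4 s k \<Omega>) x I"
      unfolding agreeD[OF lap_twist[OF sg s] x]
      unfolding twist_def agreeD[OF e aff_in_topspace x(2)] by (simp add: lin_def)
  qed
  then show ?thesis
    unfolding eigen_def using smooth_comps_twist[OF s] alt2_twist[OF t] by blast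
qed

definition periodic :: "local_form \<Rightarrow> bool" where
  "periodic \<Omega> \<longleftrightarrow> (\<forall>k. (\<forall>i. k i \<in> \<int>) \<longrightarrow>
     (\<forall>x\<in>topspace (Euclidean_space 4). \<forall>I\<in>multi_idx 4 2. \<Omega> (aff 4 (\<lambda>_. 1) k x) I = \<Omega> x I))"

lemma periodicD:
  "periodic \<Omega> \<Longrightarrow> (\<And>i. k i \<in> \<int>) \<Longrightarrow> x \<in> topspace (Euclidean_space 4) \<Longrightarrow> I \<in> multi_idx 4 2 \<Longrightarrow>
     \<Omega> (aff 4 (\<lambda>_. 1) k x) I = \<Omega> x I"
  unfolding periodic_def by blast

lemma periodicI:
  "(\<And>k x I. (\<And>i. k i \<in> \<int>) \<Longrightarrow> x \<in> topspace (Euclidean_space 4) \<Longrightarrow> I \<in> multi_idx 4 2 \<Longrightarrow>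
     \<Omega> (aff 4 (\<lambda>_. 1) k x) I = \<Omega> x I) \<Longrightarrow> periodic \<Omega>"
  unfolding periodic_def by simp

lemma periodic_lin: "periodic \<Omega> \<Longrightarrow> periodic \<Omega>' \<Longrightarrow> periodic (lin a \<Omega> b \<Omega>')"
  by (rule periodicI) (simp add: lin_def periodicD)

lemma periodic_star: "periodic \<Omega> \<Longrightarrow> periodic (star 4 2 \<Omega>)"
  by (rule periodicI) (simp add: hodge_star_flat periodicD cong: sum.cong)

text \<open>The projections onto the forms fixed and negated by the twist, with star applied to the
  negated part.\<close>

definition sym_star :: "(nat \<Rightarrow> real) \<Rightarrow> (nat \<Rightarrow> real) \<Rightarrow> local_form \<Rightarrow> local_form" where
  "sym_star s k \<Omega> = lin 1 (lin (1/2) \<Omega> (1/2) (twist 4 s k \<Omega>))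
     1 (star 4 2 (lin (1/2) \<Omega> (-1/2) (twist 4 s k \<Omega>)))"

lemma twist_lin: "twist n s k (lin a \<omega> b \<eta>) = lin a (twist n s k \<omega>) b (twist n s k \<eta>)"
  by (simp add: twist_def lin_def fun_eq_iff algebra_simps)

lemma sym_star_lin: "sym_star s k (lin a \<omega> b \<eta>) = lin a (sym_star s k \<omega>) b (sym_star s k \<eta>)"
  unfolding sym_star_def twist_lin star_lin by (simp add: lin_def fun_eq_iff algebra_simps)

lemma agree_twist:
  "agree n p (topspace (Euclidean_space n)) \<omega> \<eta> \<Longrightarrow> agree n p (topspace (Euclidean_space n)) (twist n s k \<omega>) (twist n s k \<eta>)"
  by (simp add: agree_def twist_def)

lemma agree_lin: "agree n p U \<omega> \<omega>' \<Longrightarrow> agree n p U \<eta> \<eta>' \<Longrightarrow> agree n p U (lin a \<omega> b \<eta>) (lin a \<omega>' b \<eta>')"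
  by (simp add: agree_def lin_def)

lemma agree_sym: "agree n p U \<omega> \<eta> \<Longrightarrow> agree n p U \<eta> \<omega>"
  by (simp add: agree_def)

lemma agree_refl: "agree n p U \<omega> \<omega>"
  by (simp add: agree_def)

lemma sym_star_cong:
  "agree 4 2 (topspace (Euclidean_space 4)) \<omega> \<eta> \<Longrightarrow> agree 4 2 (topspace (Euclidean_space 4)) (sym_star s k \<omega>) (sym_star s k \<eta>)"
  unfolding sym_star_def by (intro agree_lin agree_star agree_twist)

lemma eigen_sym_star: "eigen l \<Omega> \<Longrightarrow> \<forall>i. s i = 1 \<or> s i = -1 \<Longrightarrow> eigen l (sym_star s k \<Omega>)"
  unfolding sym_star_def by (intro eigen_lin eigen_star eigen_twist)

lemma star_twist_reversing:
  assumes "\<forall>i. s i = 1 \<or> s i = -1" "(\<Prod>i<4. s i) = -1"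
  shows "twist 4 s k (star 4 2 \<Omega>) = lin (-1) (star 4 2 (twist 4 s k \<Omega>)) 0 \<Omega>"
  unfolding star_twist[OF assms(1)] assms(2) by (simp add: lin_def)

section \<open>Invariant eigenforms of one orientation reversing involution\<close>

locale reversing_involution = torus_involution 4 \<sigma> \<kappa> for \<sigma> \<kappa> +
  assumes det: "(\<Prod>i<4. \<sigma> i) = -1"
begin

lemma sgn': "\<forall>i. \<sigma> i = 1 \<or> \<sigma> i = -1"
  using sgn by blast

abbreviation "tw \<equiv> twist 4 \<sigma> \<kappa>"

text \<open>Moving a lattice translation past the involution only changes the signs of its
  entries.\<close>

lemma periodic_tw:
  assumes "periodic \<Omega>" shows "periodic (tw \<Omega>)"
proof (rule periodicI)
  fix k :: "nat \<Rightarrow> real" and x I assume k: "\<And>i. k i \<in> \<int>" and x: "x \<in> E" and I: "I \<in> multi_idx 4 2"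
  have "aff 4 \<sigma> \<kappa> (aff 4 (\<lambda>_. 1) k x) = aff 4 (\<lambda>_. 1) (\<lambda>i. \<sigma> i * k i) (aff 4 \<sigma> \<kappa> x)"
    by (simp add: aff_aff add_ac)
  moreover have "\<sigma> i * k i \<in> \<int>" for i by (rule Ints_sgn_mult[OF sgn k])
  ultimately have "\<Omega> (aff 4 \<sigma> \<kappa> (aff 4 (\<lambda>_. 1) k x)) I = \<Omega> (aff 4 \<sigma> \<kappa> x) I"
    using periodicD[OF assms _ aff_in_topspace I] by simp
  then show "tw \<Omega> (aff 4 (\<lambda>_. 1) k x) I = tw \<Omega> x I" by (simp add: twist_def)
qed

text \<open>The square of the involution is a lattice translation, invisible to periodic forms, and
  each sign occurs twice.\<close>

lemma tw_tw:
  assumes "periodic \<Omega>" shows "agree 4 2 E (tw (tw \<Omega>)) \<Omega>"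
proof (rule agreeI)
  fix x I assume x: "x \<in> E" and I: "I \<in> multi_idx 4 2"
  have "\<sigma> i * \<sigma> i = 1" for i using sgn[of i] by auto
  then have "aff 4 \<sigma> \<kappa> (aff 4 \<sigma> \<kappa> x) = aff 4 (\<lambda>_. 1) (\<lambda>i. \<sigma> i * \<kappa> i + \<kappa> i) x" by (simp add: aff_aff)
  then have 1: "\<Omega> (aff 4 \<sigma> \<kappa> (aff 4 \<sigma> \<kappa> x)) I = \<Omega> x I"
    using periodicD[OF assms sgn_kappa x I] by simp
  have 2: "prod_list (map \<sigma> I) * (prod_list (map \<sigma> I) * a) = a" for a
    using prod_list_sgn_square[OF sgn', of I] by (simp add: mult.assoc[symmetric])
  show "tw (tw \<Omega>) x I = \<Omega> x I" unfolding twist_def 1 by (rule 2)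
qed

lemma periodic_if_invariant:
  assumes "invariant 2 \<Omega>" shows "periodic \<Omega>" "agree 4 2 E (tw \<Omega>) \<Omega>"
proof -
  have "(\<sigma>, \<kappa>) \<in> G" by (simp add: G_def)
  then show "agree 4 2 E (tw \<Omega>) \<Omega>" by (rule invariantD[OF assms])
  show "periodic \<Omega>"
  proof (rule periodicI)
    fix k :: "nat \<Rightarrow> real" and x I assume k: "\<And>i. k i \<in> \<int>" and x: "x \<in> E" and I: "I \<in> multi_idx 4 2"
    have "(\<lambda>_. 1, k) \<in> G" using k by (simp add: G_def)
    from agreeD[OF invariantD[OF assms this] x I] show "\<Omega> (aff 4 (\<lambda>_. 1) k x) I = \<Omega> x I"
      by (simp add: twist_def map_replicate_const)
  qed
qed

lemma invariant_if_periodic: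
  assumes p: "periodic \<Omega>" and t: "agree 4 2 E (tw \<Omega>) \<Omega>" shows "invariant 2 \<Omega>"
  unfolding invariant_def
proof (intro allI impI agreeI)
  fix s k x I assume sk: "(s, k) \<in> G" and x: "x \<in> E" and I: "I \<in> multi_idx 4 2"
  consider "s = (\<lambda>_. 1)" "\<And>i. k i \<in> \<int>" | "s = \<sigma>" "\<And>i. k i - \<kappa> i \<in> \<int>" using sk unfolding G_def by blast
  then show "twist 4 s k \<Omega> x I = \<Omega> x I"
  proof cases
    case 1
    then show ?thesis using periodicD[OF p 1(2) x I] by (simp add: twist_def map_replicate_const)
  next
    case 2
    \<comment> \<open>Every element over the involution is the involution followed by a lattice
      translation.\<close>
    have "aff 4 \<sigma> k x = aff 4 (\<lambda>_. 1) (\<lambda>i. k i - \<kappa> i) (aff 4 \<sigma> \<kappa> x)" by (simp add: aff_aff)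
    then have "\<Omega> (aff 4 \<sigma> k x) I = \<Omega> (aff 4 \<sigma> \<kappa> x) I"
      using periodicD[OF p 2(2) aff_in_topspace I] by simp
    then have "twist 4 s k \<Omega> x I = tw \<Omega> x I" using 2(1) by (simp add: twist_def)
    then show ?thesis using agreeD[OF t x I] by simp
  qed
qed

text \<open>The twist negates the second projection and anticommutes with star, so the two signs
  cancel on the starred part.\<close>

lemma sym_star_invariant:
  assumes p: "periodic \<Omega>" shows "invariant 2 (sym_star \<sigma> \<kappa> \<Omega>)"
proof (rule invariant_if_periodic)
  show "periodic (sym_star \<sigma> \<kappa> \<Omega>)"
    unfolding sym_star_def by (intro periodic_lin periodic_star periodic_tw p)
  let ?B = "lin (1/2) \<Omega> (-1/2) (tw \<Omega>)"
  have "agree 4 2 E (tw ?B) (lin (-1) ?B 0 ?B)"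
    unfolding twist_lin using tw_tw[OF p] by (simp add: agree_def lin_def)
  from agree_star[OF this, of 2] have B: "agree 4 2 E (star 4 2 (tw ?B)) (lin (-1) (star 4 2 ?B) 0 (star 4 2 ?B))"
    unfolding star_lin .
  show "agree 4 2 E (tw (sym_star \<sigma> \<kappa> \<Omega>)) (sym_star \<sigma> \<kappa> \<Omega>)"
  proof (rule agreeI)
    fix x I assume x: "x \<in> E" "I \<in> multi_idx 4 2"
    show "tw (sym_star \<sigma> \<kappa> \<Omega>) x I = sym_star \<sigma> \<kappa> \<Omega> x I"
      unfolding sym_star_def twist_lin[of 4 \<sigma> \<kappa> 1] star_twist_reversing[OF sgn' det]
      unfolding lin_def[of 1] lin_def[of "-1" _ 0] agreeD[OF B x]
      unfolding twist_lin unfolding lin_def agreeD[OF tw_tw[OF p] x] by simp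
  qed
qed

text \<open>Every chart carries the flat metric and its form is a restriction of the glued one to an
  open set, so the Laplacians coincide there.\<close>

lemma hodge_eigenspace_iff:
  "\<omega> \<in> hodge_eigenspace 4 atlas 2 l \<longleftrightarrow> \<omega> \<in> smooth_forms 4 atlas 2 \<and> eigen l (glue \<omega>)"
proof (cases "\<omega> \<in> smooth_forms 4 atlas 2")
  case True
  have sf: "smooth_comps 4 2 E (glue \<omega>)" "alt2 E (glue \<omega>)"
    using smooth_form_on_glue[OF True] by (simp_all add: smooth_form_on_4_2_iff)
  have *: "lap (\<omega> c) x I = lap (glue \<omega>) x I" if c: "c \<in> atlas" and x: "x \<in> chart_dom c" and I: "I \<in> multi_idx 4 2" for c x I
  proof (rule agreeD[OF lap_cong[OF openin_chart_dom[OF c]] x I])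
    have "smooth_form_on 4 2 (chart_dom c) (\<omega> c)" using True c unfolding smooth_forms_def by blast
    then show "smooth_comps 4 2 (chart_dom c) (\<omega> c)" by (simp add: smooth_form_on_4_2_iff)
    show "smooth_comps 4 2 (chart_dom c) (glue \<omega>)"
      using sf(1) smooth_on_subset[OF chart_dom_subset[OF c]] unfolding smooth_comps_def by blast
    show "agree 4 2 (chart_dom c) (\<omega> c) (glue \<omega>)"
      by (rule agreeI) (rule smooth_forms_eq_glue[OF True c])
  qed
  show ?thesis
  proof
    assume "\<omega> \<in> hodge_eigenspace 4 atlas 2 l"
    then have e: "\<forall>c\<in>atlas. \<forall>x\<in>chart_dom c. \<forall>I\<in>multi_idx 4 2.
        hodge_laplacian 4 (chart_met c) 2 (\<omega> c) x I = l * \<omega> c x I" unfolding hodge_eigenspace_def by blast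
    have "agree 4 2 E (lap (glue \<omega>)) (lin l (glue \<omega>) 0 (glue \<omega>))"
    proof (rule agreeI)
      fix x I assume x: "x \<in> E" and I: "I \<in> multi_idx 4 2"
      note c = chart_at[OF x]
      have "lap (\<omega> (chart_at x)) x I = l * \<omega> (chart_at x) x I"
        using e c I chart_met_atlas[OF c(1)] by metis
      then show "lap (glue \<omega>) x I = lin l (glue \<omega>) 0 (glue \<omega>) x I"
        using *[OF c I] by (simp add: lin_def glue_def)
    qed
    then show "\<omega> \<in> smooth_forms 4 atlas 2 \<and> eigen l (glue \<omega>)" using True sf by (simp add: eigen_def)
  next
    assume "\<omega> \<in> smooth_forms 4 atlas 2 \<and> eigen l (glue \<omega>)"
    then have e: "agree 4 2 E (lap (glue \<omega>)) (lin l (glue \<omega>) 0 (glue \<omega>))" by (simp add: eigen_def)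
    have "hodge_laplacian 4 (chart_met c) 2 (\<omega> c) x I = l * \<omega> c x I"
      if c: "c \<in> atlas" and x: "x \<in> chart_dom c" and I: "I \<in> multi_idx 4 2" for c x I
    proof -
      have "x \<in> E" using x chart_dom_subset[OF c] by blast
      then show ?thesis
        unfolding chart_met_atlas[OF c] *[OF c x I] smooth_forms_eq_glue[OF True c x I]
        using agreeD[OF e _ I, of x] by (simp add: lin_def)
    qed
    then show "\<omega> \<in> hodge_eigenspace 4 atlas 2 l" unfolding hodge_eigenspace_def using True by blast
  qed
qed (simp add: hodge_eigenspace_def)

lemma restr_in_hodge_eigenspace:
  assumes e: "eigen l \<Omega>" and inv: "invariant 2 \<Omega>" shows "restr 2 \<Omega> \<in> hodge_eigenspace 4 atlas 2 l"
proof -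
  have s: "smooth_comps 4 2 E \<Omega>" and t: "alt2 E \<Omega>" using e by (simp_all add: eigen_def)
  have r: "restr 2 \<Omega> \<in> smooth_forms 4 atlas 2"
    by (rule restr_in_smooth_forms[OF _ inv]) (use s t in \<open>simp add: smooth_form_on_4_2_iff\<close>)
  have g: "smooth_comps 4 2 E (glue (restr 2 \<Omega>))" "alt2 E (glue (restr 2 \<Omega>))"
    using smooth_form_on_glue[OF r] by (simp_all add: smooth_form_on_4_2_iff)
  have a: "agree 4 2 E (glue (restr 2 \<Omega>)) \<Omega>" by (rule glue_restr)
  have "agree 4 2 E (lap (glue (restr 2 \<Omega>))) (lap \<Omega>)" by (rule lap_cong[OF openin_topspace g(1) s a])
  also have "agree 4 2 E (lap \<Omega>) (lin l \<Omega> 0 \<Omega>)" using e by (simp add: eigen_def)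
  also have "agree 4 2 E (lin l \<Omega> 0 \<Omega>) (lin l (glue (restr 2 \<Omega>)) 0 (glue (restr 2 \<Omega>)))"
    by (intro agree_lin agree_sym[OF a])
  finally show ?thesis using r g by (simp add: hodge_eigenspace_iff eigen_def)
qed

end

section \<open>Transfer of eigenforms between the two quotients\<close>

locale commuting_involutions =
  A: reversing_involution \<sigma> \<kappa> + B: reversing_involution \<sigma>' \<kappa>' for \<sigma> \<kappa> \<sigma>' \<kappa>' +
  assumes commute: "\<And>i. \<sigma> i * \<kappa>' i + \<kappa> i = \<sigma>' i * \<kappa> i + \<kappa>' i"
begin

definition transfer :: "(nat \<Rightarrow> real) set orbi_form \<Rightarrow> (nat \<Rightarrow> real) set orbi_form" where
  "transfer \<omega> = B.restr 2 (sym_star \<sigma>' \<kappa>' (A.glue \<omega>))"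

text \<open>Comparing dimensions calls for linearity on the whole space of families, so
  \<open>transfer\<close> is defined and shown linear beyond the smooth forms.\<close>

lemma linear_transfer: "Vector_Spaces.linear form_scale form_scale transfer"
proof (rule Vector_Spaces.linear_iff[THEN iffD2], intro conjI allI)
  show "vector_space form_scale" by (rule orbi_form.vector_space_axioms)
  fix x y :: "(nat \<Rightarrow> real) set orbi_form" and r :: real
  have "A.glue (x + y) = lin 1 (A.glue x) 1 (A.glue y)"
    by (simp add: A.glue_def lin_def fun_eq_iff)
  then have "transfer (x + y) = B.restr 2 (lin 1 (sym_star \<sigma>' \<kappa>' (A.glue x)) 1 (sym_star \<sigma>' \<kappa>' (A.glue y)))"
    by (simp add: transfer_def sym_star_lin)
  then show "transfer (x + y) = transfer x + transfer y"
    by (simp add: transfer_def B.restr_def lin_def fun_eq_iff)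
  have "A.glue (form_scale r x) = lin r (A.glue x) 0 (A.glue x)"
    by (simp add: A.glue_def lin_def fun_eq_iff form_scale_def)
  then have "transfer (form_scale r x) = B.restr 2 (lin r (sym_star \<sigma>' \<kappa>' (A.glue x)) 0 (sym_star \<sigma>' \<kappa>' (A.glue x)))"
    by (simp add: transfer_def sym_star_lin)
  then show "transfer (form_scale r x) = form_scale r (transfer x)"
    by (simp add: transfer_def B.restr_def lin_def fun_eq_iff form_scale_def)
qed (rule orbi_form.vector_space_axioms)

lemma transfer_in_hodge_eigenspace:
  assumes "\<omega> \<in> hodge_eigenspace 4 A.atlas 2 l" shows "transfer \<omega> \<in> hodge_eigenspace 4 B.atlas 2 l"
proof -
  have \<omega>: "\<omega> \<in> smooth_forms 4 A.atlas 2" "eigen l (A.glue \<omega>)" using assms by (simp_all add: A.hodge_eigenspace_iff)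
  have "periodic (A.glue \<omega>)" by (rule A.periodic_if_invariant(1)[OF A.invariant_glue[OF \<omega>(1)]])
  then show ?thesis
    unfolding transfer_def
    by (intro B.restr_in_hodge_eigenspace eigen_sym_star \<omega>(2) B.sgn' B.sym_star_invariant)
qed

text \<open>Diagonal linear parts always commute, and \<open>commute\<close> equates the translation
  parts exactly, so this holds before any appeal to periodicity.\<close>

lemma tw_commute: "A.tw (B.tw \<Omega>) = B.tw (A.tw \<Omega>)"
proof -
  have comm: "aff 4 \<sigma> \<kappa> (aff 4 \<sigma>' \<kappa>' x) = aff 4 \<sigma>' \<kappa>' (aff 4 \<sigma> \<kappa> x)" for x
    unfolding aff_aff commute by (simp add: mult.commute)
  show ?thesis unfolding twist_def comm by (intro ext) (rule mult.left_commute)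
qed

text \<open>Both B-parts P and Q of an A-invariant form are A-invariant. Hence the A-twist fixes P
  and negates *Q in P + *Q; the second application keeps P and turns *Q into **Q = Q, and P + Q is
  the form itself.\<close>

lemma sym_star_sym_star:
  assumes \<Omega>: "A.invariant 2 \<Omega>" and alt: "alt2 A.E \<Omega>"
  shows "agree 4 2 A.E (sym_star \<sigma> \<kappa> (sym_star \<sigma>' \<kappa>' \<Omega>)) \<Omega>"
proof -
  let ?P = "lin (1/2) \<Omega> (1/2) (B.tw \<Omega>)" and ?Q = "lin (1/2) \<Omega> (-1/2) (B.tw \<Omega>)"
  have t: "agree 4 2 A.E (A.tw \<Omega>) \<Omega>" by (rule A.periodic_if_invariant(2)[OF \<Omega>])
  have t': "agree 4 2 A.E (A.tw (B.tw \<Omega>)) (B.tw \<Omega>)" unfolding tw_commute by (rule agree_twist[OF t])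
  have P: "agree 4 2 A.E (A.tw ?P) ?P" "agree 4 2 A.E (A.tw ?Q) ?Q"
    unfolding twist_lin by (intro agree_lin t t')+
  have Q: "agree 4 2 A.E (star 4 2 (A.tw ?Q)) (star 4 2 ?Q)" by (rule agree_star[OF P(2)])
  let ?H = "sym_star \<sigma>' \<kappa>' \<Omega>"
  have H: "?H = lin 1 ?P 1 (star 4 2 ?Q)" by (simp add: sym_star_def)
  have twH: "agree 4 2 A.E (A.tw ?H) (lin 1 ?P (-1) (star 4 2 ?Q))"
    unfolding H twist_lin[of 4 \<sigma> \<kappa> 1] star_twist_reversing[OF A.sgn' A.det]
    using P(1) Q by (simp add: agree_def lin_def[of 1] lin_def[of "-1" _ 0])
  have half: "lin (1/2) (lin 1 P 1 Q) (-1/2) (lin 1 P (-1) Q) = Q"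
    "lin (1/2) (lin 1 P 1 Q) (1/2) (lin 1 P (-1) Q) = P" for P Q
    by (simp_all add: lin_def fun_eq_iff algebra_simps)
  have "agree 4 2 A.E (lin (1/2) ?H (-1/2) (A.tw ?H)) (star 4 2 ?Q)"
    using agree_lin[OF agree_refl twH, of "1/2" ?H "-1/2"] unfolding H half .
  then have "agree 4 2 A.E (star 4 2 (lin (1/2) ?H (-1/2) (A.tw ?H))) (star 4 2 (star 4 2 ?Q))"
    by (rule agree_star)
  also have "agree 4 2 A.E (star 4 2 (star 4 2 ?Q)) ?Q"
    by (rule star_star[OF alt2_lin[OF alt alt2_twist[OF alt]]])
  finally have 1: "agree 4 2 A.E (star 4 2 (lin (1/2) ?H (-1/2) (A.tw ?H))) ?Q" .
  have 2: "agree 4 2 A.E (lin (1/2) ?H (1/2) (A.tw ?H)) ?P"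
    using agree_lin[OF agree_refl twH, of "1/2" ?H "1/2"] unfolding H half .
  have "agree 4 2 A.E (sym_star \<sigma> \<kappa> ?H) (lin 1 ?P 1 ?Q)"
    unfolding sym_star_def[of \<sigma>] by (intro agree_lin 1 2)
  also have "lin 1 ?P 1 ?Q = \<Omega>" by (simp add: lin_def fun_eq_iff)
  finally show ?thesis .
qed

end

text \<open>The hypothesis is symmetric, so exchanging the two involutions supplies the inverse
  transfer together with all its properties.\<close>

sublocale commuting_involutions \<subseteq> swapped: commuting_involutions \<sigma>' \<kappa>' \<sigma> \<kappa>
  by unfold_locales (simp add: commute)

context commuting_involutions begin

lemma transfer_transfer:
  assumes "\<omega> \<in> hodge_eigenspace 4 A.atlas 2 l" shows "swapped.transfer (transfer \<omega>) = \<omega>"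
proof -
  have \<omega>: "\<omega> \<in> smooth_forms 4 A.atlas 2" "eigen l (A.glue \<omega>)" using assms by (simp_all add: A.hodge_eigenspace_iff)
  have "agree 4 2 A.E (sym_star \<sigma> \<kappa> (B.glue (transfer \<omega>))) (sym_star \<sigma> \<kappa> (sym_star \<sigma>' \<kappa>' (A.glue \<omega>)))"
    unfolding transfer_def by (rule sym_star_cong[OF B.glue_restr])
  also have "agree 4 2 A.E (sym_star \<sigma> \<kappa> (sym_star \<sigma>' \<kappa>' (A.glue \<omega>))) (A.glue \<omega>)"
    by (rule sym_star_sym_star[OF A.invariant_glue[OF \<omega>(1)]]) (use \<omega>(2) in \<open>simp add: eigen_def\<close>)
  finally show ?thesis
    unfolding swapped.transfer_def using A.restr_cong A.restr_glue[OF \<omega>(1)] by metis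
qed

end

text \<open>The maps are inverse to each other on V and W only. The first claim matches the infinite
  case in \<open>hodge_spec\<close>, and the second transports a basis.\<close>

lemma orbi_form_dim_transfer:
  fixes V W :: "'p orbi_form set"
  assumes f: "Vector_Spaces.linear form_scale form_scale f" and g: "Vector_Spaces.linear form_scale form_scale g"
    and fV: "f ` V \<subseteq> W" and gW: "g ` W \<subseteq> V"
    and gf: "\<And>v. v \<in> V \<Longrightarrow> g (f v) = v" and fg: "\<And>w. w \<in> W \<Longrightarrow> f (g w) = w"
  shows "(\<exists>B. finite B \<and> V \<subseteq> orbi_form.span B) \<longleftrightarrow> (\<exists>B. finite B \<and> W \<subseteq> orbi_form.span B)"
    and "orbi_form.dim V = orbi_form.dim W"
proof -
  interpret vp: vector_space_pair form_scale form_scale by unfold_locales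
  have *: "\<exists>B. finite B \<and> W \<subseteq> orbi_form.span B"
    if h: "\<exists>B. finite B \<and> V \<subseteq> orbi_form.span B" and f: "Vector_Spaces.linear form_scale form_scale f"
      and W: "\<And>w. w \<in> W \<Longrightarrow> f (g w) = w" "g ` W \<subseteq> V"
    for f g and V W :: "'p orbi_form set"
  proof -
    obtain B where B: "finite B" "V \<subseteq> orbi_form.span B" using h by blast
    have "W \<subseteq> f ` V" using W by force
    also have "\<dots> \<subseteq> f ` orbi_form.span B" by (rule image_mono[OF B(2)])
    also have "\<dots> = orbi_form.span (f ` B)" using vp.linear_span_image[OF f] by simp
    finally show ?thesis using B(1) by blast
  qed
  show "(\<exists>B. finite B \<and> V \<subseteq> orbi_form.span B) \<longleftrightarrow> (\<exists>B. finite B \<and> W \<subseteq> orbi_form.span B)"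
    using *[of V f W g, OF _ f fg gW] *[of W g V f, OF _ g gf fV] by blast
  have gf_linear: "Vector_Spaces.linear form_scale form_scale (g \<circ> f)"
    by (rule Vector_Spaces.linear_compose[OF f g])
  \<comment> \<open>Transporting independence requires injectivity on the span; g o f and the
    identity are linear and agree on V, hence on its span.\<close>
  have "g (f v) = v" if "v \<in> orbi_form.span V" for v
    using vp.linear_eq_on_span[OF gf_linear orbi_form.linear_id, of V v] gf that by simp
  then have inj: "inj_on f (orbi_form.span V)" by (rule inj_on_inverseI[of _ g])
  have W: "f ` V = W"
  proof (rule subset_antisym[OF fV], rule subsetI)
    fix w assume w: "w \<in> W"
    then have "g w \<in> V" using gW by (rule subsetD[rotated, OF imageI])
    then show "w \<in> f ` V" by (rule rev_image_eqI) (simp add: fg[OF w])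
  qed
  obtain B where B: "B \<subseteq> V" "orbi_form.independent B" "V \<subseteq> orbi_form.span B" "card B = orbi_form.dim V"
    by (rule orbi_form.basis_exists)
  have injB: "inj_on f (orbi_form.span B)" by (rule inj_on_subset[OF inj orbi_form.span_mono[OF B(1)]])
  have "f ` B \<subseteq> W" using B(1) W by blast
  moreover have "W \<subseteq> orbi_form.span (f ` B)"
    unfolding W[symmetric] vp.linear_span_image[OF f] by (rule image_mono[OF B(3)])
  moreover have "orbi_form.independent (f ` B)"
    by (rule vp.linear_independent_injective_image[OF f B(2) injB])
  ultimately have "card (f ` B) = orbi_form.dim W" by (rule orbi_form.basis_card_eq_dim)
  moreover have "card (f ` B) = card B"
    by (rule card_image[OF inj_on_subset[OF injB orbi_form.span_superset]])
  ultimately show "orbi_form.dim V = orbi_form.dim W" using B(4) by simp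
qed

context commuting_involutions begin

lemma hodge_spec_eq: "hodge_spec 4 A.atlas 2 = hodge_spec 4 B.atlas 2"
proof
  fix l
  note dim = orbi_form_dim_transfer[OF linear_transfer swapped.linear_transfer, of
      "hodge_eigenspace 4 A.atlas 2 l" "hodge_eigenspace 4 B.atlas 2 l"]
  have h: "transfer ` hodge_eigenspace 4 A.atlas 2 l \<subseteq> hodge_eigenspace 4 B.atlas 2 l"
    "swapped.transfer ` hodge_eigenspace 4 B.atlas 2 l \<subseteq> hodge_eigenspace 4 A.atlas 2 l"
    using transfer_in_hodge_eigenspace swapped.transfer_in_hodge_eigenspace by blast+
  show "hodge_spec 4 A.atlas 2 l = hodge_spec 4 B.atlas 2 l"
    unfolding hodge_spec_def
    using dim(1)[OF h transfer_transfer swapped.transfer_transfer]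
      dim(2)[OF h transfer_transfer swapped.transfer_transfer] by simp
qed

end

section \<open>The two quotients\<close>

definition reflection_sgn :: "nat \<Rightarrow> real" where "reflection_sgn i = (if i = 0 then -1 else 1)"

definition half_shift :: "nat \<Rightarrow> real" where "half_shift i = (if i = 3 then 1/2 else 0)"

definition axis_sgn :: "nat \<Rightarrow> real" where "axis_sgn i = (if i = 3 then 1 else -1)"

text \<open>The half shift acts in coordinate 3, which \<open>axis_sgn\<close> leaves alone, so the
  two maps commute on R^4 and not merely modulo the lattice.\<close>

interpretation NO: commuting_involutions reflection_sgn half_shift axis_sgn "\<lambda>_. 0"
proof unfold_locales
  show "(\<Prod>i<4. reflection_sgn i) = -1" by (simp add: numeral_eq_Suc reflection_sgn_def)
  show "(\<Prod>i<4. axis_sgn i) = -1" by (simp add: numeral_eq_Suc axis_sgn_def)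
qed (simp_all add: reflection_sgn_def half_shift_def axis_sgn_def)

text \<open>A fixed point of an element over the involution satisfies 2 * z i = k i in the three
  reflected coordinates, while coordinate 3 is free.\<close>

lemma singular_point_iff:
  assumes z: "z \<in> topspace (Euclidean_space 4)"
  shows "NO.B.orb z \<in> singular_set NO.B.atlas \<longleftrightarrow> (\<forall>i<3. 2 * z i \<in> \<int>)"
proof
  assume "NO.B.orb z \<in> singular_set NO.B.atlas"
  then obtain c x \<gamma> where c: "c \<in> NO.B.atlas" "x \<in> chart_dom c" "NO.B.orb z = chart_map c x"
    "\<gamma> \<in> chart_grp c" "\<gamma> \<noteq> \<one>\<^bsub>BijGroup (chart_dom c)\<^esub>" "\<gamma> x = x"
    unfolding singular_set_def by auto
  obtain y e where y: "c = NO.B.chart y e" "y \<in> topspace (Euclidean_space 4)" using NO.B.atlasE[OF c(1)] by metis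
  obtain s k where sk: "\<gamma> = restrict (aff 4 s k) (cube 4 y e)" "(s, k) \<in> NO.B.G" "aff 4 s k y = y"
    using c(4) unfolding y(1) NO.B.mem_chart_grp by blast
  have xE: "x \<in> topspace (Euclidean_space 4)" using c(2) NO.B.chart_dom_subset[OF c(1)] by blast
  \<comment> \<open>A pure translation in a local group fixes the centre of the chart, hence is the
    identity.\<close>
  have "s \<noteq> (\<lambda>_. 1)"
  proof
    assume s: "s = (\<lambda>_. 1)"
    have "k i = 0" if "i < 4" for i using fun_cong[OF sk(3), of i] that s by (simp add: aff_def)
    then have "aff 4 s k = aff 4 (\<lambda>_. 1) (\<lambda>_. 0)" unfolding s by (simp add: aff_def fun_eq_iff)
    then have "\<gamma> = (\<lambda>x\<in>cube 4 y e. x)"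
      unfolding sk(1) by (auto intro!: restrict_ext aff_trivial[OF subsetD[OF cube_subset_topspace]])
    then show False using c(5) unfolding y(1) by (simp add: BijGroup_def)
  qed
  then have s: "s = axis_sgn" and k: "\<And>i. k i \<in> \<int>" using sk(2) by (auto simp: NO.B.G_def)
  have fixed: "aff 4 s k x = x" using c(2,6) sk(1) y(1) by simp
  have x: "2 * x i \<in> \<int>" if "i < 3" for i
  proof -
    have "2 * x i = k i" using fun_cong[OF fixed, of i] that s by (simp add: aff_def axis_sgn_def)
    then show ?thesis using k[of i] by simp
  qed
  \<comment> \<open>The point fixed in the chart is some x in the orbit of z; half-integrality is
    passed on to z by the element joining them.\<close>
  have "NO.B.orb x = NO.B.orb z" using c(3) NO.B.chart_map_atlas[OF c(1)] by simp
  then obtain s' k' where s': "(s', k') \<in> NO.B.G" "aff 4 s' k' x = z"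
    using NO.B.orb_eq_iff[OF xE z] by blast
  show "\<forall>i<3. 2 * z i \<in> \<int>"
  proof (intro allI impI)
    fix i :: nat assume i: "i < 3"
    have "2 * z i = s' i * (2 * x i) + 2 * k' i"
      unfolding s'(2)[symmetric] using i by (simp add: aff_def)
    moreover have "s' i * (2 * x i) \<in> \<int>"
      by (rule Ints_sgn_mult[OF spec[OF NO.B.G_sgn[OF s'(1)]] x[OF i]])
    ultimately show "2 * z i \<in> \<int>" using NO.B.G_half[OF s'(1), of i] by simp
  qed
next
  assume h: "\<forall>i<3. 2 * z i \<in> \<int>"
  \<comment> \<open>The reflection about z in the first three coordinates, with no movement along
    the last.\<close>
  define k where "k i = (if i < 3 then 2 * z i else 0)" for i
  have G: "(axis_sgn, k) \<in> NO.B.G" using h by (simp add: NO.B.G_def k_def)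
  have fixes_z: "aff 4 axis_sgn k z = z"
  proof
    fix i show "aff 4 axis_sgn k z i = z i"
      using z by (cases "i = 3") (auto simp: aff_def axis_sgn_def k_def topspace_Euclidean_space)
  qed
  obtain e where e: "e > 0" "NO.B.chart z e \<in> NO.B.atlas" using NO.B.ex_chart[OF z] by blast
  let ?\<gamma> = "restrict (aff 4 axis_sgn k) (cube 4 z e)"
  have zc: "z \<in> cube 4 z e" by (rule centre_in_cube[OF z e(1)])
  have "?\<gamma> \<in> chart_grp (NO.B.chart z e)"
    unfolding NO.B.mem_chart_grp using G fixes_z by blast
  moreover have "?\<gamma> \<noteq> \<one>\<^bsub>BijGroup (chart_dom (NO.B.chart z e))\<^esub>"
  proof
    assume eq: "?\<gamma> = \<one>\<^bsub>BijGroup (chart_dom (NO.B.chart z e))\<^esub>"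
    \<comment> \<open>Moving off z in a reflected direction shows that the element is not the
      identity.\<close>
    let ?y = "z(0 := z 0 + e / 2)"
    have "?y \<in> cube 4 z e" using z e(1) by (auto simp: cube_def topspace_Euclidean_space)
    then have "aff 4 axis_sgn k ?y 0 = ?y 0" using fun_cong[OF eq, of ?y] by (simp add: BijGroup_def)
    then show False using e(1) by (simp add: aff_def axis_sgn_def k_def)
  qed
  moreover have "?\<gamma> z = z" using zc fixes_z by simp
  ultimately show "NO.B.orb z \<in> singular_set NO.B.atlas"
    unfolding singular_set_def mem_Collect_eq using e(2) zc
    by (intro exI[of _ "NO.B.chart z e"] exI[of _ z] conjI bexI[of _ ?\<gamma>]) simp_all
qed

lemma singular_set_nonempty: "singular_set NO.B.atlas \<noteq> {}"
  using singular_point_iff[of "\<lambda>_. 0"] by (auto simp: topspace_Euclidean_space)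

text \<open>
  A function vanishing exactly on the line \<open>z\<^sub>0 = x\<^sub>0\<close>, \<open>z\<^sub>1 = x\<^sub>1\<close>, \<open>z\<^sub>2 = x\<^sub>2\<close> has constant sign on
  the connected complement of that line, so its gradient on the line is zero.
\<close>

lemma pd_eq_0_if_zero_set_line:
  assumes V: "cube 4 x e \<subseteq> V" "V \<subseteq> topspace (Euclidean_space 4)" and e: "e > 0"
    and x: "x \<in> topspace (Euclidean_space 4)" and sm: "smooth_on 4 V f"
    and zero: "\<And>z. z \<in> cube 4 x e \<Longrightarrow> f z = 0 \<longleftrightarrow> (\<forall>i<3. z i = x i)" and i: "i < 4"
  shows "pd i f x = 0"
proof -
  have xc: "x \<in> cube 4 x e" by (rule centre_in_cube[OF x e])
  have fx: "f x = 0" using zero[OF xc] by simp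
  show ?thesis
  proof (cases "i = 3")
    case True
    \<comment> \<open>Moving in direction 3 stays on the line, where f is identically zero.\<close>
    have "\<forall>\<^sub>F t in nhds (x 3). x(3 := t) \<in> cube 4 x e"
      by (rule eventually_fun_upd_in_open[OF openin_cube xc]) simp
    then have "\<forall>\<^sub>F t in nhds (x 3). f (x(3 := t)) = 0"
      by (rule eventually_mono) (simp add: zero)
    then have "deriv (\<lambda>t. f (x(3 := t))) (x 3) = deriv (\<lambda>_. 0) (x 3)" by (rule deriv_cong_ev[OF _ refl])
    then show ?thesis using True by (simp add: pd_def)
  next
    case False
    \<comment> \<open>A second direction transverse to the line, making room for a half circle
      around it.\<close>
    define j :: nat where "j = (if i = 0 then 1 else 0)"
    have ij: "i < 3" "j < 3" "i \<noteq> j" using i False by (auto simp: j_def)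
    \<comment> \<open>For \<theta> from 0 to pi this runs along a half circle of radius t from x + t
      e_i to x - t e_i, and it never meets the line.\<close>
    define c where "c t \<theta> = x(i := x i + t * cos \<theta>, j := x j + t * sin \<theta>)" for t \<theta> :: real
    have cube: "c t \<theta> \<in> cube 4 x e" if t: "0 < t" "t < e" for t \<theta>
    proof -
      have "\<bar>t * cos \<theta>\<bar> \<le> t" "\<bar>t * sin \<theta>\<bar> \<le> t"
        using t mult_left_mono[OF abs_cos_le_one, of t \<theta>] mult_left_mono[OF abs_sin_le_one, of t \<theta>]
        by (simp_all add: abs_mult)
      then have "\<bar>t * cos \<theta>\<bar> < e" "\<bar>t * sin \<theta>\<bar> < e" using t by linarith+
      then show ?thesis using e ij x by (auto simp: cube_def c_def topspace_Euclidean_space)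
    qed
    have nz: "f (c t \<theta>) \<noteq> 0" if t: "0 < t" "t < e" for t \<theta>
    proof
      assume "f (c t \<theta>) = 0"
      then have "\<forall>l<3. c t \<theta> l = x l" using zero[OF cube[OF t]] by simp
      then have "c t \<theta> i = x i" "c t \<theta> j = x j" using ij by blast+
      then have "cos \<theta> = 0" "sin \<theta> = 0" using t ij by (simp_all add: c_def)
      then show False using sin_cos_squared_add[of \<theta>] by simp
    qed
    have cont: "continuous_on {0..pi} (\<lambda>\<theta>. f (c t \<theta>))" if t: "0 < t" "t < e" for t
    proof (rule continuous_on_compose2[of V f])
      show "continuous_on V f"
        using smooth_on_imp_continuous[OF sm] unfolding subtopology_Euclidean_space_eq_top_of_set[OF V(2)] by simp
      show "continuous_on {0..pi} (c t)"
      proof (rule continuous_on_coordinatewise_then_product)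
        fix l
        consider "l = j" | "l \<noteq> j" "l = i" | "l \<noteq> j" "l \<noteq> i" by blast
        then show "continuous_on {0..pi} (\<lambda>\<theta>. c t \<theta> l)"
          by cases (simp_all add: c_def continuous_on_add continuous_on_mult
              continuous_on_cos continuous_on_sin)
      qed
      show "c t ` {0..pi} \<subseteq> V" using cube[OF t] V(1) by blast
    qed
    have c0: "c t 0 = x(i := x i + t)" "c t pi = x(i := x i - t)" for t
      using ij by (auto simp: c_def)
    \<comment> \<open>By the intermediate value theorem a change of sign between the endpoints would
      put a zero on the half circle.\<close>
    have same: "\<not> (f (c t 0) < 0 \<and> 0 < f (c t pi))" "\<not> (f (c t pi) < 0 \<and> 0 < f (c t 0))"
      if t: "0 < t" "t < e" for t
    proof -
      show "\<not> (f (c t 0) < 0 \<and> 0 < f (c t pi))"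
        using IVT'[of "\<lambda>\<theta>. f (c t \<theta>)" 0 0 pi, OF _ _ _ cont[OF t]] nz[OF t] pi_ge_zero by force
      show "\<not> (f (c t pi) < 0 \<and> 0 < f (c t 0))"
        using IVT2'[of "\<lambda>\<theta>. f (c t \<theta>)" pi 0 0, OF _ _ _ cont[OF t]] nz[OF t] pi_ge_zero by force
    qed
    let ?D = "pd i f x"
    have "(\<lambda>t. f (x(i := t))) differentiable (at (x i))"
      by (rule smooth_on_differentiable[OF sm i]) (use xc V(1) in blast)
    then have D: "((\<lambda>t. f (x(i := t))) has_real_derivative ?D) (at (x i))"
      by (simp add: pd_def DERIV_deriv_iff_real_differentiable)
    show ?thesis
    \<comment> \<open>A nonzero derivative would give f opposite signs at x + t e_i and x - t e_i
      for small t.\<close>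
    proof (rule ccontr)
      assume "?D \<noteq> 0"
      then consider "?D > 0" | "?D < 0" by linarith
      then show False
      proof cases
        case 1
        obtain d1 where d1: "d1 > 0" "\<forall>h>0. h < d1 \<longrightarrow> f (x(i := x i)) < f (x(i := x i + h))"
          using DERIV_pos_inc_right[OF D 1] by auto
        obtain d2 where d2: "d2 > 0" "\<forall>h>0. h < d2 \<longrightarrow> f (x(i := x i - h)) < f (x(i := x i))"
          using DERIV_pos_inc_left[OF D 1] by auto
        let ?t = "min (min d1 d2) e / 2"
        have t: "0 < ?t" "?t < d1" "?t < d2" "?t < e" using d1(1) d2(1) e by (auto simp: min_def)
        have "f (c ?t pi) < 0" "0 < f (c ?t 0)" using d1(2) d2(2) t fx unfolding c0 by simp_all
        then show False using same(2)[OF t(1,4)] by simp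
      next
        case 2
        obtain d1 where d1: "d1 > 0" "\<forall>h>0. h < d1 \<longrightarrow> f (x(i := x i)) > f (x(i := x i + h))"
          using DERIV_neg_dec_right[OF D 2] by auto
        obtain d2 where d2: "d2 > 0" "\<forall>h>0. h < d2 \<longrightarrow> f (x(i := x i - h)) > f (x(i := x i))"
          using DERIV_neg_dec_left[OF D 2] by auto
        let ?t = "min (min d1 d2) e / 2"
        have t: "0 < ?t" "?t < d1" "?t < d2" "?t < e" using d1(1) d2(1) e by (auto simp: min_def)
        have "f (c ?t 0) < 0" "0 < f (c ?t pi)" using d1(2) d2(2) t fx unfolding c0 by simp_all
        then show False using same(1)[OF t(1,4)] by simp
      qed
    qed
  qed
qed

lemma Ints_half_integer_unique:
  fixes a b :: real
  assumes "2 * a \<in> \<int>" "2 * b \<in> \<int>" "\<bar>a - b\<bar> < 1/2" shows "a = b"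
proof -
  have "2 * a - 2 * b \<in> \<int>" by (rule Ints_diff[OF assms(1,2)])
  then obtain m :: int where m: "2 * a - 2 * b = of_int m" by (rule Ints_cases)
  then have "\<bar>of_int m :: real\<bar> < 1" using assms(3) by linarith
  then have "m = 0" by linarith
  then show ?thesis using m by simp
qed

text \<open>Near each of its points the singular set is a line, and a function vanishing exactly on
  a line has zero gradient there, so it cannot define a hypersurface.\<close>

lemma not_singular_set_codim_one: "\<not> singular_set_codim_one 4 NO.B.atlas"
  unfolding singular_set_codim_one_def
proof
  assume "\<exists>c\<in>NO.B.atlas. \<exists>x\<in>chart_dom c.
      hypersurface_at 4 {z \<in> chart_dom c. chart_map c z \<in> singular_set NO.B.atlas} x"
  then obtain c x where c: "c \<in> NO.B.atlas" and x: "x \<in> chart_dom c"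
    and hyp: "hypersurface_at 4 {z \<in> chart_dom c. chart_map c z \<in> singular_set NO.B.atlas} x" by blast
  let ?S = "{z \<in> chart_dom c. chart_map c z \<in> singular_set NO.B.atlas}"
  have S: "z \<in> ?S \<longleftrightarrow> (\<forall>i<3. 2 * z i \<in> \<int>)" if "z \<in> chart_dom c" for z
    using that singular_point_iff[of z] NO.B.chart_dom_subset[OF c] NO.B.chart_map_atlas[OF c] by auto
  obtain V f where V: "openin (Euclidean_space 4) V" "x \<in> V" and sm: "smooth_on 4 V f"
    and grad: "\<forall>z\<in>V. \<exists>i<4. pd i f z \<noteq> 0" and SV: "?S \<inter> V = {z \<in> V. f z = 0}" and xS: "x \<in> ?S"
    using hyp unfolding hypersurface_at_def by blast
  have xE: "x \<in> topspace (Euclidean_space 4)" using x NO.B.chart_dom_subset[OF c] by blast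
  have "openin (Euclidean_space 4) (V \<inter> chart_dom c)"
    by (rule openin_Int[OF V(1) NO.B.openin_chart_dom[OF c]])
  then obtain e0 where e0: "e0 > 0" "cube 4 x e0 \<subseteq> V \<inter> chart_dom c"
    using V(2) x unfolding openin_Euclidean_space_iff by blast
  \<comment> \<open>Half integers closer than 1/2 coincide, so inside this box only the line through
    x remains of the singular set.\<close>
  let ?e = "min e0 (1/2)"
  have "?e \<le> e0" by simp
  then have sub: "cube 4 x ?e \<subseteq> V \<inter> chart_dom c" by (rule subset_trans[OF cube_mono e0(2)])
  have xS': "\<forall>i<3. 2 * x i \<in> \<int>" using xS S[OF x] by blast
  have zero: "f z = 0 \<longleftrightarrow> (\<forall>i<3. z i = x i)" if z: "z \<in> cube 4 x ?e" for z
  proof -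
    have zV: "z \<in> V" "z \<in> chart_dom c" using z sub by blast+
    have "f z = 0 \<longleftrightarrow> z \<in> ?S" using SV zV by blast
    also have "\<dots> \<longleftrightarrow> (\<forall>i<3. 2 * z i \<in> \<int>)" by (rule S[OF zV(2)])
    also have "\<dots> \<longleftrightarrow> (\<forall>i<3. z i = x i)"
    proof
      assume h: "\<forall>i<3. 2 * z i \<in> \<int>"
      show "\<forall>i<3. z i = x i"
      proof (intro allI impI)
        fix i :: nat assume i: "i < 3"
        have "\<bar>z i - x i\<bar> < ?e" using z i unfolding cube_def by simp
        then show "z i = x i" using Ints_half_integer_unique[of "z i" "x i"] h xS' i by simp
      qed
    qed (use xS' in simp)
    finally show ?thesis .
  qed
  have "pd i f x = 0" if "i < 4" for i
    by (rule pd_eq_0_if_zero_set_line[OF _ openin_subset[OF V(1)] _ xE sm zero that])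
       (use sub e0(1) in auto)
  then show False using grad V(2) by blast
qed

theorem mainTheorem2:
  shows "\<exists>m\<ge>1. \<exists>(X :: (nat \<Rightarrow> real) set topology) A (Y :: (nat \<Rightarrow> real) set topology) B.
           closed_riemannian_manifold (2 * m) X A \<and>
           compact_riemannian_orbifold (2 * m) Y B \<and>
           singular_set B \<noteq> {} \<and>
           \<not> singular_set_codim_one (2 * m) B \<and>
           hodge_spec (2 * m) A m = hodge_spec (2 * m) B m"
proof (intro exI conjI)
  show "(1 :: nat) \<le> 2" by simp
  have four: "2 * 2 = (4 :: nat)" by simp
  have "half_shift 3 \<notin> \<int>"
  proof
    assume "half_shift 3 \<in> \<int>"
    then have "(1/2 :: real) = 0"
      by (intro Ints_half_integer_unique) (simp_all add: half_shift_def)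
    then show False by simp
  qed
  \<comment> \<open>Coordinate 3 witnesses freeness: there the first involution is a translation by
    1/2.\<close>
  then show "closed_riemannian_manifold (2 * 2) NO.A.qtop NO.A.atlas"
    unfolding four by (intro NO.A.closed_riemannian_manifold_atlas[of 3]) (simp_all add: reflection_sgn_def)
  show "compact_riemannian_orbifold (2 * 2) NO.B.qtop NO.B.atlas"
    unfolding four by (rule NO.B.compact_riemannian_orbifold_atlas)
  show "singular_set NO.B.atlas \<noteq> {}" by (rule singular_set_nonempty)
  show "\<not> singular_set_codim_one (2 * 2) NO.B.atlas" unfolding four by (rule not_singular_set_codim_one)
  show "hodge_spec (2 * 2) NO.A.atlas 2 = hodge_spec (2 * 2) NO.B.atlas 2"
    unfolding four by (rule NO.hodge_spec_eq)
qed

end
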